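(* The following are equivalent for a monomorphism $X\le Y$ in $\Sigma\mathrm{Vect}$: (1) $X\le Y$ is a $\Sigma$-closed embedding; (2) for every small set $I$, every family $(f_i)_{i\in I}\in(X\mathbf{k})^I$ which is summable in $Y\mathbf{k}$ is summable in $X\mathbf{k}$ (in which case the sums agree); (3) the quotient $Y/X$ computed in $\mathrm{Ind}\text{-}(\mathrm{Vect}^{\mathrm{op}})$ is again in $\Sigma\mathrm{Vect}$.
   Context: Fix a field $\mathbf{k}$ and a (non-trivial) Grothendieck universe; sets in it are small. $\mathrm{Vect}$ is the category of small $\mathbf{k}$-vector spaces, $[\mathrm{Vect},\mathrm{Vect}]$ the category of $\mathbf{k}$-additive functors (acting $\mathbf{k}$-linearly on hom-spaces) and natural transformations, $\mathbb{Y}V:=\mathrm{Vect}(V,-)$. $\mathrm{Ind}\text{-}(\mathrm{Vect}^{\mathrm{op}})$ is the full subcategory of $[\mathrm{Vect},\mathrm{Vect}]$ on the small functors, i.e. those isomorphic to a colimit, over a small directed poset, of representables; it is Abelian with small limits and colimits computed pointwise. For a small set $I$, $\delta_i:\mathbf{k}^{\oplus I}\to\mathbf{k}$ is the $i$-th coordinate functional and $\sigma:\mathbf{k}^{\oplus I}\to\mathbf{k}$ is the functional with value $1$ on all canonical basis vectors. For $X\in[\mathrm{Vect},\mathrm{Vect}]$, $(x_i)_{i\in I}\in(X\mathbf{k})^I$ is summable if there is $x\in X(\mathbf{k}^{\oplus I})$ with $X(\delta_i)(x)=x_i$ for all $i$; then $X(\sigma)(x)$ is a sum of it. $X$ is a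 strong $\mathbf{k}$-vector space if every summable family has a unique sum and $X$ is $\mathbf{k}$-concrete (for all $V$ and $f,g:\mathbb{Y}V\to X$: $f=g$ iff $f,g$ have the same component at $\mathbf{k}$). $\Sigma\mathrm{Vect}$ is the full subcategory of $[\mathrm{Vect},\mathrm{Vect}]$ on the strong $\mathbf{k}$-vector spaces; it is contained in $\mathrm{Ind}\text{-}(\mathrm{Vect}^{\mathrm{op}})$ as a reflective subcategory. Arrows $e:a\to b$, $m:c\to d$ satisfy $e\perp m$ ($m$ is right orthogonal to $e$) if for all $l:a\to c$, $k:b\to d$ with $ml=ke$ there is a unique $h:b\to c$ with $he=l$, $mh=k$. A $\Sigma$-closed embedding is a monomorphism of $\mathrm{Ind}\text{-}(\mathrm{Vect}^{\mathrm{op}})$ that is right orthogonal to the canonical inclusion $(\mathbb{Y}\mathbf{k})^{\oplus\kappa}\to(\mathbb{Y}\mathbf{k})^{\kappa}$ for every small cardinal $\kappa$. *)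

theory Defs
  imports "HOL-Algebra.Module"
begin

section \<open>The universe\<close>

text \<open>A type of this class is (the set of all elements of) a Grothendieck universe: \<open>elts x\<close> is the
  set of members of \<open>x\<close>, and transitivity of the universe is reflected in \<open>elts\<close> taking values in
  sets of elements of the same type. Extensionality and foundation are inherited from the ambient
  set theory. The functions \<open>f\<close> in \<open>family_union\<close> are arbitrary, so replacement is second-order.
  Non-triviality is the existence of an infinite member, which excludes the hereditarily finite
  sets.\<close>

class grothendieck_universe =
  fixes elts :: "'a \<Rightarrow> 'a set"
  assumes extensionality: "elts x = elts y \<Longrightarrow> x = y"
    and foundation: "wf {(x, y). x \<in> elts y}"
    and subsets: "A \<subseteq> elts x \<Longrightarrow> \<exists>z. elts z = A"
    and pairing: "\<exists>z. elts z = {x, y}"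
    and powerset: "\<exists>z. elts z = {y. elts y \<subseteq> elts x}"
    and family_union: "\<exists>z. elts z = (\<Union>i\<in>elts x. elts (f i))"
    and infinity: "\<exists>z. infinite (elts z)"

definition small :: "'u::grothendieck_universe set \<Rightarrow> bool" where
  "small A \<longleftrightarrow> (\<exists>z. elts z = A)"

definition set_code :: "'u::grothendieck_universe set \<Rightarrow> 'u" where
  "set_code A = (THE z. elts z = A)"

definition kpair :: "'u::grothendieck_universe \<Rightarrow> 'u \<Rightarrow> 'u" where
  "kpair x y = set_code {set_code {x}, set_code {x, y}}"

text \<open>A function on a small set \<open>A\<close> becomes an element of the universe through its graph;
  \<open>fapp A\<close> is the inverse of \<open>fcode A\<close> on extensional functions.\<close>

definition fcode :: "'u::grothendieck_universe set \<Rightarrow> ('u \<Rightarrow> 'u) \<Rightarrow> 'u" where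
  "fcode A f = set_code ((\<lambda>x. kpair x (f x)) ` A)"

definition fapp :: "'u::grothendieck_universe set \<Rightarrow> 'u \<Rightarrow> 'u \<Rightarrow> 'u" where
  "fapp A a = (\<lambda>x\<in>A. THE y. kpair x y \<in> elts a)"

section \<open>Small vector spaces\<close>

text \<open>The record fields \<open>mult\<close> and \<open>one\<close> of a module carry no meaning, and likewise the values of its
  operations outside the carrier. Objects of \<open>vect K\<close> differing only there are isomorphic through
  the identity of the common carrier, so that \<open>vect K\<close> is equivalent to the category in which such
  objects are identified. Morphisms are extensional, hence determined by their values on the
  carrier.\<close>

definition vect :: "'u::grothendieck_universe ring \<Rightarrow> ('u, 'u) module set" where
  "vect K = {V. module K V \<and> small (carrier V)}"

definition linear_map :: "'u ring \<Rightarrow> ('u, 'a) module \<Rightarrow> ('u, 'b) module \<Rightarrow> ('a \<Rightarrow> 'b) \<Rightarrow> bool" where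
  "linear_map K M N f \<longleftrightarrow>
     f \<in> carrier M \<rightarrow> carrier N \<and>
     (\<forall>x\<in>carrier M. \<forall>y\<in>carrier M. f (x \<oplus>\<^bsub>M\<^esub> y) = f x \<oplus>\<^bsub>N\<^esub> f y) \<and>
     (\<forall>c\<in>carrier K. \<forall>x\<in>carrier M. f (c \<odot>\<^bsub>M\<^esub> x) = c \<odot>\<^bsub>N\<^esub> f x)"

definition lin :: "'u ring \<Rightarrow> ('u, 'u) module \<Rightarrow> ('u, 'u) module \<Rightarrow> ('u \<Rightarrow> 'u) set" where
  "lin K V W = {f \<in> extensional (carrier V). linear_map K V W f}"

definition self_module :: "'u ring \<Rightarrow> ('u, 'u) module" where
  "self_module K = \<lparr>carrier = carrier K, mult = mult K, one = one K, zero = zero K, add = add K,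
     smult = mult K\<rparr>"

definition power_module :: "'u set \<Rightarrow> ('u, 'u) module \<Rightarrow> ('u, 'u \<Rightarrow> 'u) module" where
  "power_module A M = \<lparr>carrier = A \<rightarrow>\<^sub>E carrier M, mult = undefined, one = undefined,
     zero = (\<lambda>i\<in>A. \<zero>\<^bsub>M\<^esub>), add = (\<lambda>f g. \<lambda>i\<in>A. f i \<oplus>\<^bsub>M\<^esub> g i), smult = (\<lambda>c f. \<lambda>i\<in>A. c \<odot>\<^bsub>M\<^esub> f i)\<rparr>"

definition copower_module :: "'u set \<Rightarrow> ('u, 'u) module \<Rightarrow> ('u, 'u \<Rightarrow> 'u) module" where
  "copower_module A M = (power_module A M)
     \<lparr>carrier := {f \<in> A \<rightarrow>\<^sub>E carrier M. finite {i \<in> A. f i \<noteq> \<zero>\<^bsub>M\<^esub>}}\<rparr>"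

definition hom_module :: "'u ring \<Rightarrow> ('u, 'u) module \<Rightarrow> ('u, 'u) module \<Rightarrow> ('u, 'u \<Rightarrow> 'u) module" where
  "hom_module K V W = (power_module (carrier V) W)\<lparr>carrier := lin K V W\<rparr>"

text \<open>Transport of structure along \<open>fcode A\<close> for a module of extensional functions on \<open>A\<close>.\<close>

definition coded ::
  "'u::grothendieck_universe set \<Rightarrow> ('u, 'u \<Rightarrow> 'u) module \<Rightarrow> ('u, 'u) module" where
  "coded A N = \<lparr>carrier = fcode A ` carrier N, mult = undefined, one = undefined,
     zero = fcode A \<zero>\<^bsub>N\<^esub>,
     add = (\<lambda>a b. fcode A (fapp A a \<oplus>\<^bsub>N\<^esub> fapp A b)),
     smult = (\<lambda>c a. fcode A (c \<odot>\<^bsub>N\<^esub> fapp A a))\<rparr>"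

definition free_space :: "'u::grothendieck_universe ring \<Rightarrow> 'u set \<Rightarrow> ('u, 'u) module" where
  "free_space K I = coded I (copower_module I (self_module K))"

definition coord :: "'u::grothendieck_universe ring \<Rightarrow> 'u set \<Rightarrow> 'u \<Rightarrow> 'u \<Rightarrow> 'u" where
  "coord K I i = (\<lambda>v\<in>carrier (free_space K I). fapp I v i)"

text \<open>The linear functional with value \<open>1\<close> on all canonical basis vectors sends a vector to the sum
  of its finitely many nonzero coordinates.\<close>

definition sum_functional :: "'u::grothendieck_universe ring \<Rightarrow> 'u set \<Rightarrow> 'u \<Rightarrow> 'u" where
  "sum_functional K I = (\<lambda>v\<in>carrier (free_space K I).
     finsum K (fapp I v) {i \<in> I. fapp I v i \<noteq> \<zero>\<^bsub>K\<^esub>})"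

section \<open>Functors and natural transformations\<close>

record 'u vfunctor =
  obj :: "('u, 'u) module \<Rightarrow> ('u, 'u) module"
  arr :: "('u, 'u) module \<Rightarrow> ('u, 'u) module \<Rightarrow> ('u \<Rightarrow> 'u) \<Rightarrow> ('u \<Rightarrow> 'u)"

definition additive_functor :: "'u::grothendieck_universe ring \<Rightarrow> 'u vfunctor \<Rightarrow> bool" where
  "additive_functor K X \<longleftrightarrow>
     (\<forall>V\<in>vect K. obj X V \<in> vect K) \<and>
     (\<forall>V\<in>vect K. arr X V V (\<lambda>v\<in>carrier V. v) = (\<lambda>x\<in>carrier (obj X V). x)) \<and>
     (\<forall>U\<in>vect K. \<forall>V\<in>vect K. \<forall>W\<in>vect K. \<forall>f\<in>lin K U V. \<forall>g\<in>lin K V W.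
        arr X U W (compose (carrier U) g f) = compose (carrier (obj X U)) (arr X V W g) (arr X U V f)) \<and>
     (\<forall>V\<in>vect K. \<forall>W\<in>vect K.
        linear_map K (hom_module K V W) (hom_module K (obj X V) (obj X W)) (arr X V W))"

definition nat_trans ::
  "'u::grothendieck_universe ring \<Rightarrow> 'u vfunctor \<Rightarrow> 'u vfunctor \<Rightarrow> (('u, 'u) module \<Rightarrow> 'u \<Rightarrow> 'u) set" where
  "nat_trans K X Y = {\<eta> \<in> extensional (vect K).
     (\<forall>V\<in>vect K. \<eta> V \<in> lin K (obj X V) (obj Y V)) \<and>
     (\<forall>V\<in>vect K. \<forall>W\<in>vect K. \<forall>f\<in>lin K V W.
        compose (carrier (obj X V)) (\<eta> W) (arr X V W f) =
        compose (carrier (obj X V)) (arr Y V W f) (\<eta> V))}"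

definition nt_id :: "'u::grothendieck_universe ring \<Rightarrow> 'u vfunctor \<Rightarrow> ('u, 'u) module \<Rightarrow> 'u \<Rightarrow> 'u" where
  "nt_id K X = (\<lambda>V\<in>vect K. \<lambda>x\<in>carrier (obj X V). x)"

definition nt_zero ::
  "'u::grothendieck_universe ring \<Rightarrow> 'u vfunctor \<Rightarrow> 'u vfunctor \<Rightarrow> ('u, 'u) module \<Rightarrow> 'u \<Rightarrow> 'u" where
  "nt_zero K X Y = (\<lambda>V\<in>vect K. \<lambda>x\<in>carrier (obj X V). \<zero>\<^bsub>obj Y V\<^esub>)"

text \<open>The composite of \<open>\<eta>\<close> with source \<open>X\<close> followed by \<open>\<zeta>\<close>.\<close>

definition nt_comp ::
  "'u::grothendieck_universe ring \<Rightarrow> 'u vfunctor \<Rightarrow> (('u, 'u) module \<Rightarrow> 'u \<Rightarrow> 'u) \<Rightarrow>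
   (('u, 'u) module \<Rightarrow> 'u \<Rightarrow> 'u) \<Rightarrow> ('u, 'u) module \<Rightarrow> 'u \<Rightarrow> 'u" where
  "nt_comp K X \<zeta> \<eta> = (\<lambda>V\<in>vect K. compose (carrier (obj X V)) (\<zeta> V) (\<eta> V))"

definition yoneda :: "'u::grothendieck_universe ring \<Rightarrow> ('u, 'u) module \<Rightarrow> 'u vfunctor" where
  "yoneda K V = \<lparr>obj = (\<lambda>W. coded (carrier V) (hom_module K V W)),
     arr = (\<lambda>W W' g. \<lambda>a\<in>carrier (coded (carrier V) (hom_module K V W)).
       fcode (carrier V) (compose (carrier V) g (fapp (carrier V) a)))\<rparr>"

text \<open>The pointwise copower and power of \<open>F\<close>, with the canonical inclusion of the former into the
  latter.\<close>

definition copower_functor :: "'u::grothendieck_universe set \<Rightarrow> 'u vfunctor \<Rightarrow> 'u vfunctor" where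
  "copower_functor I F = \<lparr>obj = (\<lambda>V. coded I (copower_module I (obj F V))),
     arr = (\<lambda>V W f. \<lambda>a\<in>carrier (coded I (copower_module I (obj F V))).
       fcode I (\<lambda>i\<in>I. arr F V W f (fapp I a i)))\<rparr>"

definition power_functor :: "'u::grothendieck_universe set \<Rightarrow> 'u vfunctor \<Rightarrow> 'u vfunctor" where
  "power_functor I F = \<lparr>obj = (\<lambda>V. coded I (power_module I (obj F V))),
     arr = (\<lambda>V W f. \<lambda>a\<in>carrier (coded I (power_module I (obj F V))).
       fcode I (\<lambda>i\<in>I. arr F V W f (fapp I a i)))\<rparr>"

definition copower_inclusion ::
  "'u::grothendieck_universe ring \<Rightarrow> 'u set \<Rightarrow> 'u vfunctor \<Rightarrow> ('u, 'u) module \<Rightarrow> 'u \<Rightarrow> 'u" where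
  "copower_inclusion K I F = (\<lambda>V\<in>vect K. \<lambda>a\<in>carrier (obj (copower_functor I F) V). a)"

section \<open>Small functors\<close>

definition directed_poset :: "'u set \<Rightarrow> 'u rel \<Rightarrow> bool" where
  "directed_poset J r \<longleftrightarrow> partial_order_on J r \<and> J \<noteq> {} \<and>
     (\<forall>i\<in>J. \<forall>j\<in>J. \<exists>k\<in>J. (i, k) \<in> r \<and> (j, k) \<in> r)"

definition diagram ::
  "'u::grothendieck_universe ring \<Rightarrow> 'u set \<Rightarrow> 'u rel \<Rightarrow> ('u \<Rightarrow> 'u vfunctor) \<Rightarrow>
   ('u \<Rightarrow> 'u \<Rightarrow> ('u, 'u) module \<Rightarrow> 'u \<Rightarrow> 'u) \<Rightarrow> bool" where
  "diagram K J r D t \<longleftrightarrow>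
     (\<forall>i\<in>J. additive_functor K (D i)) \<and>
     (\<forall>i\<in>J. \<forall>j\<in>J. (i, j) \<in> r \<longrightarrow> t i j \<in> nat_trans K (D i) (D j)) \<and>
     (\<forall>i\<in>J. t i i = nt_id K (D i)) \<and>
     (\<forall>i\<in>J. \<forall>j\<in>J. \<forall>k\<in>J. (i, j) \<in> r \<longrightarrow> (j, k) \<in> r \<longrightarrow> t i k = nt_comp K (D i) (t j k) (t i j))"

definition cocone ::
  "'u::grothendieck_universe ring \<Rightarrow> 'u set \<Rightarrow> 'u rel \<Rightarrow> ('u \<Rightarrow> 'u vfunctor) \<Rightarrow>
   ('u \<Rightarrow> 'u \<Rightarrow> ('u, 'u) module \<Rightarrow> 'u \<Rightarrow> 'u) \<Rightarrow> 'u vfunctor \<Rightarrow>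
   ('u \<Rightarrow> ('u, 'u) module \<Rightarrow> 'u \<Rightarrow> 'u) \<Rightarrow> bool" where
  "cocone K J r D t Z c \<longleftrightarrow>
     (\<forall>i\<in>J. c i \<in> nat_trans K (D i) Z) \<and>
     (\<forall>i\<in>J. \<forall>j\<in>J. (i, j) \<in> r \<longrightarrow> nt_comp K (D i) (c j) (t i j) = c i)"

text \<open>A colimit in the category of all additive functors.\<close>

definition colimit_cocone ::
  "'u::grothendieck_universe ring \<Rightarrow> 'u set \<Rightarrow> 'u rel \<Rightarrow> ('u \<Rightarrow> 'u vfunctor) \<Rightarrow>
   ('u \<Rightarrow> 'u \<Rightarrow> ('u, 'u) module \<Rightarrow> 'u \<Rightarrow> 'u) \<Rightarrow> 'u vfunctor \<Rightarrow>
   ('u \<Rightarrow> ('u, 'u) module \<Rightarrow> 'u \<Rightarrow> 'u) \<Rightarrow> bool" where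
  "colimit_cocone K J r D t X c \<longleftrightarrow>
     cocone K J r D t X c \<and>
     (\<forall>Z d. additive_functor K Z \<longrightarrow> cocone K J r D t Z d \<longrightarrow>
        (\<exists>!u. u \<in> nat_trans K X Z \<and> (\<forall>i\<in>J. nt_comp K (D i) u (c i) = d i)))"

definition small_functor :: "'u::grothendieck_universe ring \<Rightarrow> 'u vfunctor \<Rightarrow> bool" where
  "small_functor K X \<longleftrightarrow>
     additive_functor K X \<and>
     (\<exists>J r V t c. small J \<and> directed_poset J r \<and> (\<forall>j\<in>J. V j \<in> vect K) \<and>
        diagram K J r (\<lambda>j. yoneda K (V j)) t \<and>
        colimit_cocone K J r (\<lambda>j. yoneda K (V j)) t X c)"

section \<open>Strong vector spaces\<close>

definition is_sum ::
  "'u::grothendieck_universe ring \<Rightarrow> 'u vfunctor \<Rightarrow> 'u set \<Rightarrow> ('u \<Rightarrow> 'u) \<Rightarrow> 'u \<Rightarrow> bool" where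
  "is_sum K X I f s \<longleftrightarrow>
     (\<exists>x\<in>carrier (obj X (free_space K I)).
        (\<forall>i\<in>I. arr X (free_space K I) (self_module K) (coord K I i) x = f i) \<and>
        s = arr X (free_space K I) (self_module K) (sum_functional K I) x)"

definition summable_family ::
  "'u::grothendieck_universe ring \<Rightarrow> 'u vfunctor \<Rightarrow> 'u set \<Rightarrow> ('u \<Rightarrow> 'u) \<Rightarrow> bool" where
  "summable_family K X I f \<longleftrightarrow>
     (\<exists>x\<in>carrier (obj X (free_space K I)).
        \<forall>i\<in>I. arr X (free_space K I) (self_module K) (coord K I i) x = f i)"

definition unique_sums :: "'u::grothendieck_universe ring \<Rightarrow> 'u vfunctor \<Rightarrow> bool" where
  "unique_sums K X \<longleftrightarrow>
     (\<forall>I. small I \<longrightarrow> (\<forall>f\<in>I \<rightarrow> carrier (obj X (self_module K)).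
        summable_family K X I f \<longrightarrow> (\<exists>!s. is_sum K X I f s)))"

definition concrete :: "'u::grothendieck_universe ring \<Rightarrow> 'u vfunctor \<Rightarrow> bool" where
  "concrete K X \<longleftrightarrow>
     (\<forall>V\<in>vect K. \<forall>f\<in>nat_trans K (yoneda K V) X. \<forall>g\<in>nat_trans K (yoneda K V) X.
        f = g \<longleftrightarrow> f (self_module K) = g (self_module K))"

definition strong_space :: "'u::grothendieck_universe ring \<Rightarrow> 'u vfunctor \<Rightarrow> bool" where
  "strong_space K X \<longleftrightarrow> additive_functor K X \<and> unique_sums K X \<and> concrete K X"

section \<open>Monomorphisms, cokernels and closed embeddings\<close>

text \<open>A full subcategory of the category of additive functors is given by a predicate \<open>\<C>\<close> on
  its objects.\<close>

definition mono_in ::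
  "'u::grothendieck_universe ring \<Rightarrow> ('u vfunctor \<Rightarrow> bool) \<Rightarrow> 'u vfunctor \<Rightarrow> 'u vfunctor \<Rightarrow>
   (('u, 'u) module \<Rightarrow> 'u \<Rightarrow> 'u) \<Rightarrow> bool" where
  "mono_in K \<C> X Y m \<longleftrightarrow>
     \<C> X \<and> \<C> Y \<and> m \<in> nat_trans K X Y \<and>
     (\<forall>Z. \<C> Z \<longrightarrow> (\<forall>f\<in>nat_trans K Z X. \<forall>g\<in>nat_trans K Z X.
        nt_comp K Z m f = nt_comp K Z m g \<longrightarrow> f = g))"

definition cokernel_in ::
  "'u::grothendieck_universe ring \<Rightarrow> ('u vfunctor \<Rightarrow> bool) \<Rightarrow> 'u vfunctor \<Rightarrow> 'u vfunctor \<Rightarrow>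
   (('u, 'u) module \<Rightarrow> 'u \<Rightarrow> 'u) \<Rightarrow> 'u vfunctor \<Rightarrow> (('u, 'u) module \<Rightarrow> 'u \<Rightarrow> 'u) \<Rightarrow> bool" where
  "cokernel_in K \<C> X Y m Q q \<longleftrightarrow>
     \<C> Q \<and> q \<in> nat_trans K Y Q \<and> nt_comp K X q m = nt_zero K X Q \<and>
     (\<forall>Z. \<C> Z \<longrightarrow> (\<forall>g\<in>nat_trans K Y Z. nt_comp K X g m = nt_zero K X Z \<longrightarrow>
        (\<exists>!h. h \<in> nat_trans K Q Z \<and> nt_comp K Y h q = g)))"

text \<open>\<open>e \<bottom> m\<close> for \<open>e: A \<rightarrow> B\<close> and \<open>m: C \<rightarrow> D\<close>.\<close>

definition orthogonal ::
  "'u::grothendieck_universe ring \<Rightarrow>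
   'u vfunctor \<Rightarrow> 'u vfunctor \<Rightarrow> (('u, 'u) module \<Rightarrow> 'u \<Rightarrow> 'u) \<Rightarrow>
   'u vfunctor \<Rightarrow> 'u vfunctor \<Rightarrow> (('u, 'u) module \<Rightarrow> 'u \<Rightarrow> 'u) \<Rightarrow> bool" where
  "orthogonal K A B e C D m \<longleftrightarrow>
     (\<forall>l\<in>nat_trans K A C. \<forall>k\<in>nat_trans K B D. nt_comp K A m l = nt_comp K A k e \<longrightarrow>
        (\<exists>!h. h \<in> nat_trans K B C \<and> nt_comp K A h e = l \<and> nt_comp K B m h = k))"

text \<open>A small cardinal is realised by the small index sets of that cardinality; the inclusion depends
  on the index set only up to isomorphism.\<close>

definition closed_embedding ::
  "'u::grothendieck_universe ring \<Rightarrow> 'u vfunctor \<Rightarrow> 'u vfunctor \<Rightarrow>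
   (('u, 'u) module \<Rightarrow> 'u \<Rightarrow> 'u) \<Rightarrow> bool" where
  "closed_embedding K X Y m \<longleftrightarrow>
     mono_in K (small_functor K) X Y m \<and>
     (\<forall>I. small I \<longrightarrow>
        orthogonal K (copower_functor I (yoneda K (self_module K)))
          (power_functor I (yoneda K (self_module K)))
          (copower_inclusion K I (yoneda K (self_module K))) X Y m)"

end

theory Submission
  imports Defs "HOL-Library.Countable_Set"
begin

text \<open>An additive functor \<open>X\<close> is strong iff the coordinate maps embed \<open>X (k\<^sup>\<oplus>\<^sup>I)\<close> into \<open>(X k)\<^sup>I\<close> for all
  small \<open>I\<close>. With \<open>X\<close> viewed as a subfunctor of \<open>Y\<close>, all three conditions then say the same: an element of
  \<open>Y (k\<^sup>\<oplus>\<^sup>I)\<close> whose coordinates lie in \<open>X k\<close> lies in \<open>X (k\<^sup>\<oplus>\<^sup>I)\<close>. For closed embeddings this is because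
  the power \<open>(\<Y>k)\<^sup>I\<close> is represented by \<open>k\<^sup>\<oplus>\<^sup>I\<close>, and for the quotient it is the embedding property
  of \<open>Y/X\<close>.

  That these functors are small rests on a cardinality bound: in a strong space a nonzero value occurs only
  finitely often in a summable family, so every element of \<open>X V\<close> comes from \<open>X (k\<^sup>\<oplus>\<^sup>B)\<close> for a fixed small
  \<open>B\<close>. The property passes to quotients, and an additive functor with this property is a directed colimit of
  representables.\<close>

section \<open>Coding in the universe\<close>

text \<open>Every object of \<open>vect K\<close> is a retract of some \<open>free I\<close>, and
  additive functors preserve retracts; this is why coordinates on free spaces control all of
  \<open>X\<close>. A sum is read off with one functional only, so exploiting uniqueness of sums
  takes suitable endomorphisms of \<open>free I\<close>; all of those used are instances of
  \<open>reindex\<close>.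

  The obstacle is size: cokernels and closed embeddings are formed among small functors, while
  strength is a condition over all small index sets at once. Finite fibres allow the relevant
  indices of a family to be renamed as pairs of a value and a position among the indices with that
  value, hence by elements of one set built from \<open>X k\<close> and a fixed infinite set. The
  embedding property itself can be lost in \<open>Y/X\<close>, so smallness cannot be derived from
  it there.

  The colimit has to run over a small directed poset. Short exact sequences of vector spaces split,
  so additive functors respect kernels and finite intersections of subspaces; this is what makes a
  poset of subspaces of a single space directed.\<close>

lemma small_elts [simp]: "small (elts z)"
  by (auto simp: small_def)

lemma elts_set_code [simp]:
  assumes "small A" shows "elts (set_code A) = A"
proof -
  obtain z where z: "elts z = A" using assms by (auto simp: small_def)
  then have "set_code A = z"
    unfolding set_code_def by (metis (mono_tags, lifting) extensionality the_equality)
  with z show ?thesis by simp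
qed

lemma small_subset: "small B \<Longrightarrow> A \<subseteq> B \<Longrightarrow> small A"
  unfolding small_def using subsets by metis

lemma small_pair [simp]: "small {x, y}"
  unfolding small_def by (rule pairing)

lemma small_singleton [simp]: "small {x}"
  using small_pair[of x x] by simp

lemma small_UN:
  fixes A :: "'u::grothendieck_universe set" and B :: "'u \<Rightarrow> 'u set"
  assumes "small A" "\<And>i. i \<in> A \<Longrightarrow> small (B i)"
  shows "small (\<Union>i\<in>A. B i)"
proof -
  obtain a where a: "elts a = A" using assms(1) by (auto simp: small_def)
  obtain z where "elts z = (\<Union>i\<in>elts a. elts (set_code (B i)))"
    using family_union[of "\<lambda>i. set_code (B i)" a] ..
  also have "\<dots> = (\<Union>i\<in>A. B i)" using assms(2) a by simp
  finally show ?thesis by (auto simp: small_def)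
qed

lemma small_image:
  fixes A :: "'u::grothendieck_universe set" and f :: "'u \<Rightarrow> 'u"
  shows "small A \<Longrightarrow> small (f ` A)"
  using small_UN[of A "\<lambda>i. {f i}"] by (simp add: UNION_singleton_eq_range)

text \<open>Subsets of a small set are sets and not elements of the universe;
  \<open>set_code\<close> turns them into elements, so that \<open>small\<close> can speak about the
  power set.\<close>

lemma small_Pow:
  assumes "small A" shows "small (set_code ` Pow A)"
proof -
  obtain a where a: "elts a = A" using assms by (auto simp: small_def)
  obtain z where "elts z = {y. elts y \<subseteq> elts a}" using powerset by blast
  then have "small {y. elts y \<subseteq> A}" using a by (auto simp: small_def)
  then show ?thesis
    by (rule small_subset) (use elts_set_code[OF small_subset[OF assms]] in auto)
qed

lemma set_code_inject: "small A \<Longrightarrow> small B \<Longrightarrow> set_code A = set_code B \<longleftrightarrow> A = B"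
  by (metis elts_set_code)

lemma kpair_inject [simp]: "kpair x y = kpair x' y' \<longleftrightarrow> x = x' \<and> y = y'"
  by (auto simp: kpair_def set_code_inject doubleton_eq_iff)

lemma small_kpair:
  assumes "small A" "small B" shows "small ((\<lambda>(x, y). kpair x y) ` (A \<times> B))"
proof -
  have "(\<lambda>(x, y). kpair x y) ` (A \<times> B) = (\<Union>x\<in>A. kpair x ` B)" by auto
  with assms show ?thesis by (simp add: small_UN small_image)
qed

text \<open>A graph on \<open>A\<close> remembers only the values on \<open>A\<close>, and decoding
  returns \<open>undefined\<close> elsewhere; extensional functions are the ones for which nothing
  is lost.\<close>

lemma fapp_fcode:
  assumes "small A" "f \<in> extensional A" shows "fapp A (fcode A f) = f"
proof
  fix x
  show "fapp A (fcode A f) x = f x"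
  proof (cases "x \<in> A")
    case True
    then have "(THE y. kpair x y \<in> elts (fcode A f)) = f x"
      unfolding fcode_def using small_image[OF assms(1), of "\<lambda>x. kpair x (f x)"]
      by (intro the_equality) (auto simp: image_iff)
    with True show ?thesis by (simp add: fapp_def)
  next
    case False
    with assms show ?thesis by (simp add: fapp_def extensional_def)
  qed
qed

lemma fapp_extensional [simp]: "fapp A a \<in> extensional A"
  by (simp add: fapp_def)

text \<open>The graph of a function from \<open>A\<close> to \<open>B\<close> is a subset of the
  small set of coded pairs, so its code is among the codes of a power set.\<close>

lemma small_fcode:
  assumes "small A" "small B" "F \<subseteq> A \<rightarrow> B" shows "small (fcode A ` F)"
proof (rule small_subset)
  show "small (set_code ` Pow ((\<lambda>(x, y). kpair x y) ` (A \<times> B)))"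
    by (intro small_Pow small_kpair assms)
  show "fcode A ` F \<subseteq> set_code ` Pow ((\<lambda>(x, y). kpair x y) ` (A \<times> B))"
    using assms(3) by (fastforce simp: fcode_def)
qed

text \<open>Supplies infinitely many labels inside one small set; they number the members of finite
  fibres in \<open>separated_bounded\<close>.\<close>

lemma small_infinite:
  obtains Z :: "'u::grothendieck_universe set" and e :: "nat \<Rightarrow> 'u"
  where "small Z" "inj e" "range e \<subseteq> Z"
proof -
  obtain z :: 'u where "infinite (elts z)" using infinity by blast
  then obtain e :: "nat \<Rightarrow> 'u" where "inj e" "range e \<subseteq> elts z"
    using infinite_countable_subset by blast
  then show ?thesis using that[of "elts z" e] by simp
qed

section \<open>Modules and linear maps\<close>

text \<open>The module axioms are equations together with the existence of negatives, and all of
  these pass to surjective images. The case of interest is transport along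
  \<open>fcode A\<close>.\<close>

lemma module_surj_image:
  assumes "module K M" and C: "carrier N = \<rho> ` carrier M"
    and zero: "\<zero>\<^bsub>N\<^esub> = \<rho> \<zero>\<^bsub>M\<^esub>"
    and add: "\<And>x y. x \<in> carrier M \<Longrightarrow> y \<in> carrier M \<Longrightarrow> \<rho> x \<oplus>\<^bsub>N\<^esub> \<rho> y = \<rho> (x \<oplus>\<^bsub>M\<^esub> y)"
    and smult: "\<And>c x. c \<in> carrier K \<Longrightarrow> x \<in> carrier M \<Longrightarrow> c \<odot>\<^bsub>N\<^esub> \<rho> x = \<rho> (c \<odot>\<^bsub>M\<^esub> x)"
  shows "module K N"
proof -
  interpret M: module K M by fact
  show ?thesis
  proof (rule moduleI)
    show "cring K" by (rule M.R.is_cring)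
    show "abelian_group N"
    proof (rule abelian_groupI)
      fix x assume "x \<in> carrier N"
      then obtain a where a: "a \<in> carrier M" "x = \<rho> a" by (auto simp: C)
      then have "\<rho> (\<ominus>\<^bsub>M\<^esub> a) \<in> carrier N" "\<rho> (\<ominus>\<^bsub>M\<^esub> a) \<oplus>\<^bsub>N\<^esub> x = \<zero>\<^bsub>N\<^esub>"
        by (simp_all add: C zero add M.M.l_neg)
      then show "\<exists>y\<in>carrier N. y \<oplus>\<^bsub>N\<^esub> x = \<zero>\<^bsub>N\<^esub>" by blast
    qed (auto simp: C zero add M.M.a_ac)
  qed (auto simp: C add smult M.smult_l_distr M.smult_r_distr M.smult_assoc1)
qed

text \<open>One closure criterion for full powers, finitely supported families and spaces of linear
  maps alike. Negatives are obtained as multiples by minus one, so closure under scalars covers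
  them.\<close>

lemma module_power_submodule:
  assumes "module K M" and "C \<subseteq> A \<rightarrow>\<^sub>E carrier M" and zero: "(\<lambda>i\<in>A. \<zero>\<^bsub>M\<^esub>) \<in> C"
    and add: "\<And>f g. f \<in> C \<Longrightarrow> g \<in> C \<Longrightarrow> (\<lambda>i\<in>A. f i \<oplus>\<^bsub>M\<^esub> g i) \<in> C"
    and smult: "\<And>c f. c \<in> carrier K \<Longrightarrow> f \<in> C \<Longrightarrow> (\<lambda>i\<in>A. c \<odot>\<^bsub>M\<^esub> f i) \<in> C"
  shows "module K ((power_module A M)\<lparr>carrier := C\<rparr>)" (is "module K ?N")
proof -
  interpret M: module K M by fact
  have C: "f i \<in> carrier M" if "f \<in> C" "i \<in> A" for f i
    using assms(2) that by (auto simp: PiE_iff)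
  have ext: "f \<in> extensional A" if "f \<in> C" for f
    using assms(2) that by (auto simp: PiE_iff)
  show ?thesis
  proof (rule moduleI)
    show "cring K" by (rule M.R.is_cring)
    show "abelian_group ?N"
    proof (rule abelian_groupI)
      fix f assume "f \<in> carrier ?N"
      then have f: "f \<in> C" by simp
      let ?g = "\<lambda>i\<in>A. (\<ominus>\<^bsub>K\<^esub> \<one>\<^bsub>K\<^esub>) \<odot>\<^bsub>M\<^esub> f i"
      have "?g \<in> C" by (rule smult) (use f in simp_all)
      moreover have "?g \<oplus>\<^bsub>?N\<^esub> f = \<zero>\<^bsub>?N\<^esub>"
        using C[OF f] by (auto simp: power_module_def M.smult_l_minus M.M.l_neg)
      ultimately show "\<exists>g\<in>carrier ?N. g \<oplus>\<^bsub>?N\<^esub> f = \<zero>\<^bsub>?N\<^esub>" by auto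
    next
      fix f assume "f \<in> carrier ?N"
      then show "\<zero>\<^bsub>?N\<^esub> \<oplus>\<^bsub>?N\<^esub> f = f"
        by (intro extensionalityI[of _ A]) (auto simp: power_module_def C ext)
    qed (use add zero C in \<open>auto simp: power_module_def M.M.a_ac intro!: restrict_ext\<close>)
  next
    fix f assume "f \<in> carrier ?N"
    then show "\<one>\<^bsub>K\<^esub> \<odot>\<^bsub>?N\<^esub> f = f"
      by (intro extensionalityI[of _ A]) (auto simp: power_module_def C ext)
  qed (use C smult in \<open>auto simp: power_module_def M.smult_l_distr M.smult_r_distr M.smult_assoc1 intro!: restrict_ext\<close>)
qed

lemma module_coded:
  assumes "small A" "module K N" "carrier N \<subseteq> extensional A"
  shows "module K (coded A N)"
proof (rule module_surj_image[OF assms(2), where \<rho> = "fcode A"])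
  have "fapp A (fcode A f) = f" if "f \<in> carrier N" for f
    using that assms by (auto intro: fapp_fcode)
  then show "fcode A x \<oplus>\<^bsub>coded A N\<^esub> fcode A y = fcode A (x \<oplus>\<^bsub>N\<^esub> y)"
    if "x \<in> carrier N" "y \<in> carrier N" for x y using that by (simp add: coded_def)
  show "c \<odot>\<^bsub>coded A N\<^esub> fcode A x = fcode A (c \<odot>\<^bsub>N\<^esub> x)"
    if "x \<in> carrier N" for c x
    using that \<open>\<And>f. f \<in> carrier N \<Longrightarrow> fapp A (fcode A f) = f\<close> by (simp add: coded_def)
qed (simp_all add: coded_def)

locale small_vect =
  fixes K :: "'u::grothendieck_universe ring"
  assumes field_K: "field K" and small_K: "small (carrier K)"
begin

lemma cring_K: "cring K"
  using field_K by (simp add: field_def domain_def)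

lemma vect_module: "V \<in> vect K \<Longrightarrow> module K V"
  by (simp add: vect_def)

lemma vect_small: "V \<in> vect K \<Longrightarrow> small (carrier V)"
  by (simp add: vect_def)

lemma vect_abelian_group: "V \<in> vect K \<Longrightarrow> abelian_group V"
  by (rule module.axioms(2)[OF vect_module])

lemma vect_add_closed [simp]:
  "V \<in> vect K \<Longrightarrow> x \<in> carrier V \<Longrightarrow> y \<in> carrier V \<Longrightarrow> x \<oplus>\<^bsub>V\<^esub> y \<in> carrier V"
  by (rule abelian_groupE(1)[OF vect_abelian_group])

lemma vect_smult_closed [simp]:
  "V \<in> vect K \<Longrightarrow> c \<in> carrier K \<Longrightarrow> x \<in> carrier V \<Longrightarrow> c \<odot>\<^bsub>V\<^esub> x \<in> carrier V"
  by (rule module.smult_closed[OF vect_module])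

lemma vect_zero_closed [simp]: "V \<in> vect K \<Longrightarrow> \<zero>\<^bsub>V\<^esub> \<in> carrier V"
  by (rule abelian_groupE(2)[OF vect_abelian_group])

lemma vect_minus_closed [simp]:
  "V \<in> vect K \<Longrightarrow> x \<in> carrier V \<Longrightarrow> y \<in> carrier V \<Longrightarrow> x \<ominus>\<^bsub>V\<^esub> y \<in> carrier V"
  by (rule abelian_group.minus_closed[OF vect_abelian_group])

lemma vect_l_zero [simp]: "V \<in> vect K \<Longrightarrow> x \<in> carrier V \<Longrightarrow> \<zero>\<^bsub>V\<^esub> \<oplus>\<^bsub>V\<^esub> x = x"
  by (rule abelian_groupE(5)[OF vect_abelian_group])

lemma vect_r_zero [simp]: "V \<in> vect K \<Longrightarrow> x \<in> carrier V \<Longrightarrow> x \<oplus>\<^bsub>V\<^esub> \<zero>\<^bsub>V\<^esub> = x"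
  using abelian_groupE(4)[OF vect_abelian_group, of V x "\<zero>\<^bsub>V\<^esub>"] by simp

lemma vect_add_minus_cancel:
  assumes "V \<in> vect K" "x \<in> carrier V" "y \<in> carrier V"
  shows "y \<oplus>\<^bsub>V\<^esub> (x \<ominus>\<^bsub>V\<^esub> y) = x"
proof -
  interpret abelian_group V by (rule vect_abelian_group) fact
  show ?thesis using assms by (simp add: minus_eq a_ac l_neg r_neg r_neg1 r_neg2)
qed

lemma vect_minus_eq_zero_iff:
  assumes "V \<in> vect K" "x \<in> carrier V" "y \<in> carrier V"
  shows "x \<ominus>\<^bsub>V\<^esub> y = \<zero>\<^bsub>V\<^esub> \<longleftrightarrow> x = y"
proof -
  interpret abelian_group V by (rule vect_abelian_group) fact
  show ?thesis
  proof
    assume "x \<ominus>\<^bsub>V\<^esub> y = \<zero>\<^bsub>V\<^esub>"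
    with vect_add_minus_cancel[OF assms] assms show "x = y" by simp
  qed (use assms in \<open>simp add: minus_eq r_neg\<close>)
qed

text \<open>Reduces subtraction to the two operations that \<open>linear_map\<close> speaks
  about.\<close>

lemma vect_minus_via_smult:
  assumes "V \<in> vect K" "x \<in> carrier V" "y \<in> carrier V"
  shows "x \<ominus>\<^bsub>V\<^esub> y = x \<oplus>\<^bsub>V\<^esub> (\<ominus>\<^bsub>K\<^esub> \<one>\<^bsub>K\<^esub>) \<odot>\<^bsub>V\<^esub> y"
proof -
  interpret module K V by (rule vect_module) fact
  show ?thesis using assms by (simp add: smult_l_minus M.minus_eq)
qed

lemma vect_minus_zero [simp]:
  assumes "V \<in> vect K" "x \<in> carrier V" shows "x \<ominus>\<^bsub>V\<^esub> \<zero>\<^bsub>V\<^esub> = x"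
proof -
  interpret abelian_group V by (rule vect_abelian_group) fact
  show ?thesis using assms by (simp add: minus_eq)
qed

lemma neg_one_closed [simp]: "\<ominus>\<^bsub>K\<^esub> \<one>\<^bsub>K\<^esub> \<in> carrier K"
proof -
  interpret cring K by (rule cring_K)
  show ?thesis by simp
qed

lemma lin_closed [simp]: "f \<in> lin K V W \<Longrightarrow> x \<in> carrier V \<Longrightarrow> f x \<in> carrier W"
  unfolding lin_def linear_map_def by blast

lemma lin_add:
  "f \<in> lin K V W \<Longrightarrow> x \<in> carrier V \<Longrightarrow> y \<in> carrier V \<Longrightarrow> f (x \<oplus>\<^bsub>V\<^esub> y) = f x \<oplus>\<^bsub>W\<^esub> f y"
  unfolding lin_def linear_map_def by blast

lemma lin_smult:
  "f \<in> lin K V W \<Longrightarrow> c \<in> carrier K \<Longrightarrow> x \<in> carrier V \<Longrightarrow> f (c \<odot>\<^bsub>V\<^esub> x) = c \<odot>\<^bsub>W\<^esub> f x"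
  unfolding lin_def linear_map_def by blast

lemma lin_ext [simp]: "f \<in> lin K V W \<Longrightarrow> f \<in> extensional (carrier V)"
  by (simp add: lin_def)

lemma linI:
  assumes "f \<in> extensional (carrier V)"
    and "\<And>x. x \<in> carrier V \<Longrightarrow> f x \<in> carrier W"
    and "\<And>x y. x \<in> carrier V \<Longrightarrow> y \<in> carrier V \<Longrightarrow> f (x \<oplus>\<^bsub>V\<^esub> y) = f x \<oplus>\<^bsub>W\<^esub> f y"
    and "\<And>c x. c \<in> carrier K \<Longrightarrow> x \<in> carrier V \<Longrightarrow> f (c \<odot>\<^bsub>V\<^esub> x) = c \<odot>\<^bsub>W\<^esub> f x"
  shows "f \<in> lin K V W"
  using assms unfolding lin_def linear_map_def by blast

lemma lin_restrictI:
  assumes "V \<in> vect K"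
    and "\<And>x. x \<in> carrier V \<Longrightarrow> f x \<in> carrier W"
    and "\<And>x y. x \<in> carrier V \<Longrightarrow> y \<in> carrier V \<Longrightarrow> f (x \<oplus>\<^bsub>V\<^esub> y) = f x \<oplus>\<^bsub>W\<^esub> f y"
    and "\<And>c x. c \<in> carrier K \<Longrightarrow> x \<in> carrier V \<Longrightarrow> f (c \<odot>\<^bsub>V\<^esub> x) = c \<odot>\<^bsub>W\<^esub> f x"
  shows "(\<lambda>x\<in>carrier V. f x) \<in> lin K V W"
  using assms by (intro linI) auto

lemma lin_eqI:
  "f \<in> lin K V W \<Longrightarrow> g \<in> lin K V W \<Longrightarrow> (\<And>x. x \<in> carrier V \<Longrightarrow> f x = g x) \<Longrightarrow> f = g"
  by (rule extensionalityI[of _ "carrier V"]) auto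

lemma lin_0 [simp]:
  assumes "f \<in> lin K V W" "V \<in> vect K" "W \<in> vect K" shows "f \<zero>\<^bsub>V\<^esub> = \<zero>\<^bsub>W\<^esub>"
proof -
  interpret V: module K V by (rule vect_module) fact
  interpret W: module K W by (rule vect_module) fact
  show ?thesis using lin_smult[OF assms(1), of "\<zero>\<^bsub>K\<^esub>" "\<zero>\<^bsub>V\<^esub>"] assms by simp
qed

lemma lin_minus:
  assumes "f \<in> lin K V W" "V \<in> vect K" "W \<in> vect K" "x \<in> carrier V" "y \<in> carrier V"
  shows "f (x \<ominus>\<^bsub>V\<^esub> y) = f x \<ominus>\<^bsub>W\<^esub> f y"
  using assms by (simp add: vect_minus_via_smult lin_add[OF assms(1)] lin_smult[OF assms(1)])

lemma lin_compose:
  assumes "V \<in> vect K" "f \<in> lin K V W" "g \<in> lin K W U"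
  shows "compose (carrier V) g f \<in> lin K V U"
  unfolding compose_def using assms
  by (intro lin_restrictI) (auto simp: lin_add[OF assms(2)] lin_smult[OF assms(2)]
      lin_add[OF assms(3)] lin_smult[OF assms(3)])

lemma lin_id: "V \<in> vect K \<Longrightarrow> (\<lambda>x\<in>carrier V. x) \<in> lin K V V"
  by (rule lin_restrictI) auto

lemma lin_zero_map: "V \<in> vect K \<Longrightarrow> W \<in> vect K \<Longrightarrow> (\<lambda>x\<in>carrier V. \<zero>\<^bsub>W\<^esub>) \<in> lin K V W"
  by (rule lin_restrictI) (auto simp: module.smult_r_null[OF vect_module])

lemma lin_add_map:
  assumes "V \<in> vect K" "W \<in> vect K" "f \<in> lin K V W" "g \<in> lin K V W"
  shows "(\<lambda>x\<in>carrier V. f x \<oplus>\<^bsub>W\<^esub> g x) \<in> lin K V W"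
proof -
  interpret W: module K W by (rule vect_module) fact
  show ?thesis using assms
    by (intro lin_restrictI) (auto simp: lin_add[OF assms(3)] lin_smult[OF assms(3)]
      lin_add[OF assms(4)] lin_smult[OF assms(4)] W.M.a_ac W.smult_r_distr)
qed

lemma lin_smult_map:
  assumes "V \<in> vect K" "W \<in> vect K" "f \<in> lin K V W" "c \<in> carrier K"
  shows "(\<lambda>x\<in>carrier V. c \<odot>\<^bsub>W\<^esub> f x) \<in> lin K V W"
proof -
  interpret W: module K W by (rule vect_module) fact
  show ?thesis using assms
    by (intro lin_restrictI) (auto simp: lin_add[OF assms(3)] lin_smult[OF assms(3)]
      W.smult_r_distr W.smult_assoc1[symmetric] W.m_comm)
qed

lemma lin_minus_map:
  assumes "V \<in> vect K" "W \<in> vect K" "f \<in> lin K V W" "g \<in> lin K V W"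
  shows "(\<lambda>x\<in>carrier V. f x \<ominus>\<^bsub>W\<^esub> g x) \<in> lin K V W"
proof -
  have "(\<lambda>x\<in>carrier V. f x \<ominus>\<^bsub>W\<^esub> g x) =
    (\<lambda>x\<in>carrier V. f x \<oplus>\<^bsub>W\<^esub> (\<lambda>x\<in>carrier V. (\<ominus>\<^bsub>K\<^esub> \<one>\<^bsub>K\<^esub>) \<odot>\<^bsub>W\<^esub> g x) x)"
    using assms by (auto simp: vect_minus_via_smult)
  also have "\<dots> \<in> lin K V W" by (intro lin_add_map lin_smult_map assms neg_one_closed)
  finally show ?thesis .
qed

section \<open>Subspaces, complements and splittings\<close>

lemma vect_submoduleI:
  assumes "V \<in> vect K" "U \<subseteq> carrier V" "\<zero>\<^bsub>V\<^esub> \<in> U"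
    and "\<And>x y. x \<in> U \<Longrightarrow> y \<in> U \<Longrightarrow> x \<oplus>\<^bsub>V\<^esub> y \<in> U"
    and "\<And>c x. c \<in> carrier K \<Longrightarrow> x \<in> U \<Longrightarrow> c \<odot>\<^bsub>V\<^esub> x \<in> U"
  shows "submodule U K V"
proof -
  interpret V: module K V by (rule vect_module) fact
  show ?thesis
  proof (rule V.submoduleI)
    fix x assume x: "x \<in> U"
    then have "\<ominus>\<^bsub>V\<^esub> x = (\<ominus>\<^bsub>K\<^esub> \<one>\<^bsub>K\<^esub>) \<odot>\<^bsub>V\<^esub> x"
      using assms(2) by (auto simp: V.smult_l_minus)
    with assms(5)[OF _ x] show "\<ominus>\<^bsub>V\<^esub> x \<in> U" by simp
  qed (use assms in auto)
qed

lemma vect_submodule: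
  assumes "V \<in> vect K" "submodule U K V"
  shows "U \<subseteq> carrier V" "\<zero>\<^bsub>V\<^esub> \<in> U" "\<And>x y. x \<in> U \<Longrightarrow> y \<in> U \<Longrightarrow> x \<oplus>\<^bsub>V\<^esub> y \<in> U"
    "\<And>c x. c \<in> carrier K \<Longrightarrow> x \<in> U \<Longrightarrow> c \<odot>\<^bsub>V\<^esub> x \<in> U"
    "\<And>x y. x \<in> U \<Longrightarrow> y \<in> U \<Longrightarrow> x \<ominus>\<^bsub>V\<^esub> y \<in> U"
proof -
  interpret V: module K V by (rule vect_module) fact
  note E = V.submoduleE[OF assms(2)]
  show "U \<subseteq> carrier V" "\<And>x y. x \<in> U \<Longrightarrow> y \<in> U \<Longrightarrow> x \<oplus>\<^bsub>V\<^esub> y \<in> U"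
    "\<And>c x. c \<in> carrier K \<Longrightarrow> x \<in> U \<Longrightarrow> c \<odot>\<^bsub>V\<^esub> x \<in> U"
    "\<And>x y. x \<in> U \<Longrightarrow> y \<in> U \<Longrightarrow> x \<ominus>\<^bsub>V\<^esub> y \<in> U"
    using E by (auto simp: V.M.minus_eq)
  obtain u where "u \<in> U" using E by blast
  then show "\<zero>\<^bsub>V\<^esub> \<in> U"
    using E(1) E(4)[of "\<zero>\<^bsub>K\<^esub>" u] V.smult_l_null[of u] by auto
qed

lemma sub_vect:
  assumes "V \<in> vect K" "submodule U K V" shows "V\<lparr>carrier := U\<rparr> \<in> vect K"
  using submodule.submodule_is_module[OF assms(2) vect_module] assms
    small_subset[OF vect_small[OF assms(1)] vect_submodule(1)[OF assms]]
  by (simp add: vect_def)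

lemma lin_incl:
  assumes "V \<in> vect K" "submodule U K V" shows "(\<lambda>u\<in>U. u) \<in> lin K (V\<lparr>carrier := U\<rparr>) V"
  using vect_submodule[OF assms] by (intro linI) auto

lemma lin_codomain:
  assumes "f \<in> lin K V W" "\<And>x. x \<in> carrier V \<Longrightarrow> f x \<in> U"
  shows "f \<in> lin K V (W\<lparr>carrier := U\<rparr>)"
  using assms unfolding lin_def linear_map_def by auto

lemma kernel_submodule:
  assumes "V \<in> vect K" "W \<in> vect K" "f \<in> lin K V W"
  shows "submodule {x \<in> carrier V. f x = \<zero>\<^bsub>W\<^esub>} K V"
proof -
  interpret W: module K W by (rule vect_module) fact
  show ?thesis using assms
    by (intro vect_submoduleI) (auto simp: lin_add[OF assms(3)] lin_smult[OF assms(3)])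
qed

lemma image_submodule:
  assumes "V \<in> vect K" "W \<in> vect K" "f \<in> lin K V W"
  shows "submodule (f ` carrier V) K W"
proof (rule vect_submoduleI)
  show "\<zero>\<^bsub>W\<^esub> \<in> f ` carrier V" using assms lin_0[OF assms(3,1,2)] by (metis imageI vect_zero_closed)
  show "x \<oplus>\<^bsub>W\<^esub> y \<in> f ` carrier V" if "x \<in> f ` carrier V" "y \<in> f ` carrier V" for x y
    using that assms by (auto simp: lin_add[OF assms(3), symmetric])
  show "c \<odot>\<^bsub>W\<^esub> x \<in> f ` carrier V" if "c \<in> carrier K" "x \<in> f ` carrier V" for c x
    using that assms by (auto simp: lin_smult[OF assms(3), symmetric])
qed (use assms in auto)

text \<open>Zorn's lemma gives a subspace \<open>W\<close> maximal among those meeting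
  \<open>U\<close> only in zero. A vector outside \<open>W + U\<close> could be adjoined to
  \<open>W\<close> without producing a nonzero element of \<open>U\<close>, because nonzero scalars
  are invertible; this contradicts maximality.\<close>

lemma complement_exists:
  assumes V: "V \<in> vect K" and U: "submodule U K V"
  obtains W where "submodule W K V" "W \<inter> U = {\<zero>\<^bsub>V\<^esub>}"
    "\<And>v. v \<in> carrier V \<Longrightarrow> \<exists>w\<in>W. \<exists>u\<in>U. v = w \<oplus>\<^bsub>V\<^esub> u"
proof -
  interpret V: module K V by (rule vect_module) fact
  interpret F: field K by (rule field_K)
  note Us = vect_submodule[OF V U]
  let ?A = "{W. submodule W K V \<and> W \<inter> U = {\<zero>\<^bsub>V\<^esub>}}"
  have "\<exists>M\<in>?A. \<forall>X\<in>?A. M \<subseteq> X \<longrightarrow> X = M"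
  proof (rule subset_Zorn_nonempty)
    have "submodule {\<zero>\<^bsub>V\<^esub>} K V" by (rule vect_submoduleI[OF V]) auto
    then show "?A \<noteq> {}" using Us(2) by blast
  next
    fix \<C> assume ne: "\<C> \<noteq> {}" and ch: "subset.chain ?A \<C>"
    then have mem: "submodule W K V" "W \<inter> U = {\<zero>\<^bsub>V\<^esub>}" if "W \<in> \<C>" for W
      using that by (auto simp: subset.chain_def)
    note s = vect_submodule[OF V mem(1)]
    have "submodule (\<Union>\<C>) K V"
    proof (rule vect_submoduleI[OF V])
      fix x y assume "x \<in> \<Union>\<C>" "y \<in> \<Union>\<C>"
      then obtain A B where "A \<in> \<C>" "B \<in> \<C>" "x \<in> A" "y \<in> B" by blast
      moreover from this have "A \<subseteq> B \<or> B \<subseteq> A" using ch by (auto simp: subset.chain_def)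
      ultimately show "x \<oplus>\<^bsub>V\<^esub> y \<in> \<Union>\<C>" using s(3) by blast
    next
      show "\<Union>\<C> \<subseteq> carrier V" using s(1) by blast
      show "\<zero>\<^bsub>V\<^esub> \<in> \<Union>\<C>" using s(2) ne by blast
      show "c \<odot>\<^bsub>V\<^esub> x \<in> \<Union>\<C>" if "c \<in> carrier K" "x \<in> \<Union>\<C>" for c x using that s(4) by blast
    qed
    moreover have "\<Union>\<C> \<inter> U = {\<zero>\<^bsub>V\<^esub>}" using mem(2) ne by blast
    ultimately show "\<Union>\<C> \<in> ?A" by blast
  qed
  then obtain W where "W \<in> ?A" and mx: "\<forall>X\<in>?A. W \<subseteq> X \<longrightarrow> X = W" ..
  then have W: "submodule W K V" "W \<inter> U = {\<zero>\<^bsub>V\<^esub>}" by simp_all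
  have max: "X = W" if "submodule X K V" "X \<inter> U = {\<zero>\<^bsub>V\<^esub>}" "W \<subseteq> X" for X
    using mx that by simp
  note Ws = vect_submodule[OF V W(1)]
  have "\<exists>w\<in>W. \<exists>u\<in>U. v = w \<oplus>\<^bsub>V\<^esub> u" if v: "v \<in> carrier V" for v
  proof (rule ccontr)
    assume no: "\<not> ?thesis"
    \<comment> \<open>The span of \<open>W\<close> and \<open>v\<close>, which maximality will force
      to equal \<open>W\<close>.\<close>
    let ?X = "{w \<oplus>\<^bsub>V\<^esub> c \<odot>\<^bsub>V\<^esub> v | w c. w \<in> W \<and> c \<in> carrier K}"
    have memX: "w \<oplus>\<^bsub>V\<^esub> c \<odot>\<^bsub>V\<^esub> v \<in> ?X" if "w \<in> W" "c \<in> carrier K" for w c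
      using that by blast
    have "submodule ?X K V"
    proof (rule vect_submoduleI[OF V])
      show "?X \<subseteq> carrier V" using Ws(1) v by auto
      show "\<zero>\<^bsub>V\<^esub> \<in> ?X" using memX[of "\<zero>\<^bsub>V\<^esub>" "\<zero>\<^bsub>K\<^esub>"] Ws(2) v by simp
    next
      fix x y assume "x \<in> ?X" "y \<in> ?X"
      then obtain w c w' c' where *: "w \<in> W" "c \<in> carrier K" "w' \<in> W" "c' \<in> carrier K"
        "x = w \<oplus>\<^bsub>V\<^esub> c \<odot>\<^bsub>V\<^esub> v" "y = w' \<oplus>\<^bsub>V\<^esub> c' \<odot>\<^bsub>V\<^esub> v" by blast
      then have "w \<in> carrier V" "w' \<in> carrier V" using Ws(1) by auto
      with * v have "x \<oplus>\<^bsub>V\<^esub> y = (w \<oplus>\<^bsub>V\<^esub> w') \<oplus>\<^bsub>V\<^esub> (c \<oplus>\<^bsub>K\<^esub> c') \<odot>\<^bsub>V\<^esub> v"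
        by (simp add: V.smult_l_distr V.M.a_ac)
      with * Ws(3) show "x \<oplus>\<^bsub>V\<^esub> y \<in> ?X" by blast
    next
      fix a x assume a: "a \<in> carrier K" and "x \<in> ?X"
      then obtain w c where *: "w \<in> W" "c \<in> carrier K" "x = w \<oplus>\<^bsub>V\<^esub> c \<odot>\<^bsub>V\<^esub> v" by blast
      then have "w \<in> carrier V" using Ws(1) by auto
      with * v a have "a \<odot>\<^bsub>V\<^esub> x = a \<odot>\<^bsub>V\<^esub> w \<oplus>\<^bsub>V\<^esub> (a \<otimes>\<^bsub>K\<^esub> c) \<odot>\<^bsub>V\<^esub> v"
        by (simp add: V.smult_r_distr V.smult_assoc1)
      with * a Ws(4) show "a \<odot>\<^bsub>V\<^esub> x \<in> ?X" by blast
    qed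
    moreover have "?X \<inter> U = {\<zero>\<^bsub>V\<^esub>}"
    proof -
      have "x = \<zero>\<^bsub>V\<^esub>" if x: "x \<in> ?X" "x \<in> U" for x
      proof -
        obtain w c where *: "w \<in> W" "c \<in> carrier K" "x = w \<oplus>\<^bsub>V\<^esub> c \<odot>\<^bsub>V\<^esub> v" using x by blast
        then have w: "w \<in> carrier V" and xV: "x \<in> carrier V" using Ws(1) Us(1) x by auto
        show ?thesis
        proof (cases "c = \<zero>\<^bsub>K\<^esub>")
          case True
          with *(3) w v have "x = w" by simp
          then have "x \<in> W \<inter> U" using *(1) x(2) by simp
          then show ?thesis by (simp only: W(2) singleton_iff)
        next
          case False
          \<comment> \<open>If \<open>x = w + c v\<close> lies in \<open>U\<close> and
            \<open>c\<close> is nonzero, dividing by \<open>c\<close> writes \<open>v\<close> as an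
            element of \<open>W + U\<close>, which is excluded.\<close>
          define d where "d = inv\<^bsub>K\<^esub> c"
          have d: "d \<in> carrier K" "d \<otimes>\<^bsub>K\<^esub> c = \<one>\<^bsub>K\<^esub>"
            using False * F.field_Units by (auto simp: d_def)
          have "c \<odot>\<^bsub>V\<^esub> v = x \<ominus>\<^bsub>V\<^esub> w"
            using * w v xV by (simp add: V.M.minus_eq V.M.a_ac V.M.r_neg V.M.r_neg1 V.M.r_neg2)
          then have "v = d \<odot>\<^bsub>V\<^esub> (x \<ominus>\<^bsub>V\<^esub> w)"
            using d * v V.smult_assoc1[of d c v] by simp
          also have "\<dots> = d \<odot>\<^bsub>V\<^esub> ((\<ominus>\<^bsub>K\<^esub> \<one>\<^bsub>K\<^esub>) \<odot>\<^bsub>V\<^esub> w) \<oplus>\<^bsub>V\<^esub> d \<odot>\<^bsub>V\<^esub> x"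
            using d w xV V by (simp add: vect_minus_via_smult V.smult_r_distr V.M.a_comm)
          finally have "v = d \<odot>\<^bsub>V\<^esub> ((\<ominus>\<^bsub>K\<^esub> \<one>\<^bsub>K\<^esub>) \<odot>\<^bsub>V\<^esub> w) \<oplus>\<^bsub>V\<^esub> d \<odot>\<^bsub>V\<^esub> x" .
          moreover have "d \<odot>\<^bsub>V\<^esub> ((\<ominus>\<^bsub>K\<^esub> \<one>\<^bsub>K\<^esub>) \<odot>\<^bsub>V\<^esub> w) \<in> W" "d \<odot>\<^bsub>V\<^esub> x \<in> U"
            using d * x Ws(4) Us(4) by auto
          ultimately show ?thesis using no by blast
        qed
      qed
      moreover have "\<zero>\<^bsub>V\<^esub> \<in> ?X"
        using memX[of "\<zero>\<^bsub>V\<^esub>" "\<zero>\<^bsub>K\<^esub>"] Ws(2) v by simp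
      ultimately show ?thesis using Us(2) by blast
    qed
    moreover have "W \<subseteq> ?X"
    proof
      fix w assume "w \<in> W"
      moreover from this have "w \<in> carrier V" using Ws(1) by blast
      ultimately show "w \<in> ?X" using memX[of w "\<zero>\<^bsub>K\<^esub>"] v by simp
    qed
    ultimately have "?X = W" by (rule max)
    moreover have "v \<in> ?X"
      using memX[of "\<zero>\<^bsub>V\<^esub>" "\<one>\<^bsub>K\<^esub>"] Ws(2) v by simp
    ultimately have "v \<in> W" by simp
    \<comment> \<open>Now \<open>v = v + 0\<close> is a decomposition of the kind assumed not to
      exist.\<close>
    then have "\<exists>u\<in>U. v = v \<oplus>\<^bsub>V\<^esub> u" using Us(2) v by force
    with \<open>v \<in> W\<close> no show False by blast
  qed
  with W show ?thesis using that by blast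
qed

text \<open>The projection onto \<open>U\<close> along a complement. It is typed as an endomorphism
  of \<open>V\<close>, so that its difference from the identity can be formed;
  \<open>lin_codomain\<close> restricts the target to \<open>U\<close> where that is wanted.\<close>

lemma retraction_exists:
  assumes V: "V \<in> vect K" and U: "submodule U K V"
  obtains r where "r \<in> lin K V V" "\<And>v. v \<in> carrier V \<Longrightarrow> r v \<in> U" "\<And>u. u \<in> U \<Longrightarrow> r u = u"
proof -
  interpret V: module K V by (rule vect_module) fact
  note Us = vect_submodule[OF V U]
  obtain W where W: "submodule W K V" "W \<inter> U = {\<zero>\<^bsub>V\<^esub>}"
    and dec: "\<And>v. v \<in> carrier V \<Longrightarrow> \<exists>w\<in>W. \<exists>u\<in>U. v = w \<oplus>\<^bsub>V\<^esub> u"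
    by (rule complement_exists[OF V U]) (rule that)
  note Ws = vect_submodule[OF V W(1)]
  \<comment> \<open>Two decompositions of the same vector satisfy \<open>u' - u = w - w'\<close>,
    and this vector lies in both \<open>W\<close> and \<open>U\<close>.\<close>
  have uniq: "u = u'" if "w \<oplus>\<^bsub>V\<^esub> u = w' \<oplus>\<^bsub>V\<^esub> u'" "w \<in> W" "w' \<in> W" "u \<in> U" "u' \<in> U" for w w' u u'
  proof -
    have c: "w \<in> carrier V" "w' \<in> carrier V" "u \<in> carrier V" "u' \<in> carrier V"
      using that Us(1) Ws(1) by auto
    have "(w \<ominus>\<^bsub>V\<^esub> w') \<oplus>\<^bsub>V\<^esub> (w' \<oplus>\<^bsub>V\<^esub> u) = w' \<oplus>\<^bsub>V\<^esub> u'"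
      using c that(1) by (simp add: V.M.minus_eq V.M.a_assoc V.M.r_neg1)
    also have "\<dots> = (u' \<ominus>\<^bsub>V\<^esub> u) \<oplus>\<^bsub>V\<^esub> (u \<oplus>\<^bsub>V\<^esub> w')"
      using c by (simp add: V.M.minus_eq V.M.a_assoc V.M.r_neg1 V.M.a_comm[of w' u'])
    also have "u \<oplus>\<^bsub>V\<^esub> w' = w' \<oplus>\<^bsub>V\<^esub> u" using c by (simp add: V.M.a_comm)
    finally have "w \<ominus>\<^bsub>V\<^esub> w' = u' \<ominus>\<^bsub>V\<^esub> u" using c by simp
    then have "u' \<ominus>\<^bsub>V\<^esub> u \<in> W \<inter> U" using Us(5) Ws(5) that by (metis Int_iff)
    with W(2) have "u' \<ominus>\<^bsub>V\<^esub> u = \<zero>\<^bsub>V\<^esub>" by blast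
    with c V show ?thesis by (simp add: vect_minus_eq_zero_iff)
  qed
  define p where "p v = (THE u. u \<in> U \<and> (\<exists>w\<in>W. v = w \<oplus>\<^bsub>V\<^esub> u))" for v
  have p: "p v = u" if "v = w \<oplus>\<^bsub>V\<^esub> u" "w \<in> W" "u \<in> U" for v w u
    unfolding p_def using that uniq by blast
  have pU: "p v \<in> U" if "v \<in> carrier V" for v
    using dec[OF that] p by metis
  show thesis
  proof (rule that[of "\<lambda>v\<in>carrier V. p v"])
    show "(\<lambda>v\<in>carrier V. p v) \<in> lin K V V"
    proof (rule lin_restrictI[OF V])
      fix x y assume "x \<in> carrier V" "y \<in> carrier V"
      then obtain w u w' u' where *: "w \<in> W" "u \<in> U" "x = w \<oplus>\<^bsub>V\<^esub> u" "w' \<in> W" "u' \<in> U" "y = w' \<oplus>\<^bsub>V\<^esub> u'"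
        using dec by metis
      then have "w \<in> carrier V" "w' \<in> carrier V" "u \<in> carrier V" "u' \<in> carrier V"
        using Us(1) Ws(1) by auto
      with * have "x \<oplus>\<^bsub>V\<^esub> y = (w \<oplus>\<^bsub>V\<^esub> w') \<oplus>\<^bsub>V\<^esub> (u \<oplus>\<^bsub>V\<^esub> u')" by (simp add: V.M.a_ac)
      with * Ws(3) Us(3) p show "p (x \<oplus>\<^bsub>V\<^esub> y) = p x \<oplus>\<^bsub>V\<^esub> p y" by metis
    next
      fix c x assume c: "c \<in> carrier K" "x \<in> carrier V"
      then obtain w u where *: "w \<in> W" "u \<in> U" "x = w \<oplus>\<^bsub>V\<^esub> u"
        using dec by metis
      then have "w \<in> carrier V" "u \<in> carrier V"
        using Us(1) Ws(1) by auto
      with * c have "c \<odot>\<^bsub>V\<^esub> x = c \<odot>\<^bsub>V\<^esub> w \<oplus>\<^bsub>V\<^esub> c \<odot>\<^bsub>V\<^esub> u" by (simp add: V.smult_r_distr)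
      with * c Ws(4) Us(4) p show "p (c \<odot>\<^bsub>V\<^esub> x) = c \<odot>\<^bsub>V\<^esub> p x" by metis
    qed (use pU Us(1) in blast)
    show "(\<lambda>v\<in>carrier V. p v) v \<in> U" if "v \<in> carrier V" for v using that pU by simp
    show "(\<lambda>v\<in>carrier V. p v) u = u" if "u \<in> U" for u
    proof -
      have u: "u \<in> carrier V" using that Us(1) by blast
      then have "p u = u" by (intro p[of _ "\<zero>\<^bsub>V\<^esub>"]) (use that Ws(2) in auto)
      with u show ?thesis by simp
    qed
  qed
qed

text \<open>The kernel condition makes \<open>e v\<close> depend on \<open>f v\<close> only, which
  defines a map on the image of \<open>f\<close>; a retraction \<open>r\<close> of \<open>W\<close>
  onto this image extends it to all of \<open>W\<close>.\<close>

lemma factor_through: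
  assumes V: "V \<in> vect K" and W: "W \<in> vect K" and T: "T \<in> vect K"
    and f: "f \<in> lin K V W" and e: "e \<in> lin K V T"
    and ker: "\<And>v. v \<in> carrier V \<Longrightarrow> f v = \<zero>\<^bsub>W\<^esub> \<Longrightarrow> e v = \<zero>\<^bsub>T\<^esub>"
  obtains g where "g \<in> lin K W T" "\<And>v. v \<in> carrier V \<Longrightarrow> e v = g (f v)"
proof -
  obtain r where r: "r \<in> lin K W W" "\<And>w. w \<in> carrier W \<Longrightarrow> r w \<in> f ` carrier V"
    "\<And>w. w \<in> f ` carrier V \<Longrightarrow> r w = w"
    by (rule retraction_exists[OF W image_submodule[OF V W f]]) (rule that)
  have wd: "e v = e v'" if "f v = f v'" "v \<in> carrier V" "v' \<in> carrier V" for v v'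
  proof -
    have "f (v \<ominus>\<^bsub>V\<^esub> v') = \<zero>\<^bsub>W\<^esub>"
      using that f V W by (simp add: lin_minus[OF f V W] vect_minus_eq_zero_iff)
    then have "e (v \<ominus>\<^bsub>V\<^esub> v') = \<zero>\<^bsub>T\<^esub>" using ker that V by simp
    with that e V T show ?thesis by (simp add: lin_minus[OF e V T] vect_minus_eq_zero_iff)
  qed
  \<comment> \<open>By \<open>wd\<close> every preimage of \<open>r w\<close> under \<open>f\<close>
    gives the same value, so the choice does not matter.\<close>
  define h where "h w = e (SOME v. v \<in> carrier V \<and> f v = r w)" for w
  have h: "h w = e v" if "f v = r w" "v \<in> carrier V" for v w
  proof -
    have "(SOME v. v \<in> carrier V \<and> f v = r w) \<in> carrier V \<and>
      f (SOME v. v \<in> carrier V \<and> f v = r w) = r w"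
      by (rule someI[of _ v]) (use that in simp)
    then show ?thesis unfolding h_def using wd that by metis
  qed
  have ex: "\<exists>v\<in>carrier V. f v = r w" if "w \<in> carrier W" for w
    using r(2)[OF that] by auto
  show thesis
  proof (rule that[of "\<lambda>w\<in>carrier W. h w"])
    show "(\<lambda>w\<in>carrier W. h w) \<in> lin K W T"
    proof (rule lin_restrictI[OF W])
      fix x assume "x \<in> carrier W" then show "h x \<in> carrier T" using ex h e lin_closed by metis
    next
      fix x y assume xy: "x \<in> carrier W" "y \<in> carrier W"
      then obtain a b where ab: "a \<in> carrier V" "b \<in> carrier V" "f a = r x" "f b = r y" using ex by metis
      then have "f (a \<oplus>\<^bsub>V\<^esub> b) = r (x \<oplus>\<^bsub>W\<^esub> y)" using xy by (simp add: lin_add[OF f] lin_add[OF r(1)])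
      with ab V have "h (x \<oplus>\<^bsub>W\<^esub> y) = e (a \<oplus>\<^bsub>V\<^esub> b)" "h x = e a" "h y = e b" by (auto intro: h)
      with ab show "h (x \<oplus>\<^bsub>W\<^esub> y) = h x \<oplus>\<^bsub>T\<^esub> h y" by (simp add: lin_add[OF e])
    next
      fix c x assume xy: "c \<in> carrier K" "x \<in> carrier W"
      then obtain a where ab: "a \<in> carrier V" "f a = r x" using ex by metis
      then have "f (c \<odot>\<^bsub>V\<^esub> a) = r (c \<odot>\<^bsub>W\<^esub> x)" using xy by (simp add: lin_smult[OF f] lin_smult[OF r(1)])
      with ab xy V have "h (c \<odot>\<^bsub>W\<^esub> x) = e (c \<odot>\<^bsub>V\<^esub> a)" "h x = e a" by (auto intro: h)
      with ab xy show "h (c \<odot>\<^bsub>W\<^esub> x) = c \<odot>\<^bsub>T\<^esub> h x" by (simp add: lin_smult[OF e])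
    qed
    show "e v = (\<lambda>w\<in>carrier W. h w) (f v)" if v: "v \<in> carrier V" for v
    proof -
      have "h (f v) = e v" by (rule h) (use r(3) v in auto)
      with v f show ?thesis by simp
    qed
  qed
qed

text \<open>With \<open>r\<close> a retraction onto the kernel of \<open>f\<close>, the vector
  \<open>v - r v\<close> depends on \<open>f v\<close> only; as a function of \<open>f v\<close> it
  is the section.\<close>

lemma section_exists:
  assumes V: "V \<in> vect K" and W: "W \<in> vect K" and f: "f \<in> lin K V W"
    and surj: "f ` carrier V = carrier W"
  obtains s where "s \<in> lin K W V" "\<And>w. w \<in> carrier W \<Longrightarrow> f (s w) = w"
proof -
  let ?N = "{x \<in> carrier V. f x = \<zero>\<^bsub>W\<^esub>}"
  obtain r where r: "r \<in> lin K V V" "\<And>v. v \<in> carrier V \<Longrightarrow> r v \<in> ?N" "\<And>v. v \<in> ?N \<Longrightarrow> r v = v"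
    by (rule retraction_exists[OF V kernel_submodule[OF V W f]]) (rule that)
  let ?e = "\<lambda>v\<in>carrier V. (\<lambda>v\<in>carrier V. v) v \<ominus>\<^bsub>V\<^esub> r v"
  have e: "?e \<in> lin K V V" by (intro lin_minus_map lin_id V r)
  obtain s where s: "s \<in> lin K W V" "\<And>v. v \<in> carrier V \<Longrightarrow> ?e v = s (f v)"
  proof (rule factor_through[OF V W V f e])
    show "?e v = \<zero>\<^bsub>V\<^esub>" if "v \<in> carrier V" "f v = \<zero>\<^bsub>W\<^esub>" for v
      using that r(3)[of v] V by (simp add: vect_minus_eq_zero_iff)
  qed (rule that)
  show thesis
  proof (rule that[OF s(1)])
    fix w assume "w \<in> carrier W"
    then obtain v where v: "v \<in> carrier V" "w = f v" using surj by blast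
    then have "f (s w) = f (v \<ominus>\<^bsub>V\<^esub> r v)" using s(2)[of v] by simp
    also have "\<dots> = w" using v r(2)[of v] V W f r(1)
      by (simp add: lin_minus[OF f V W])
    finally show "f (s w) = w" .
  qed
qed

section \<open>Free spaces\<close>

abbreviation line :: "('u, 'u) module" where "line \<equiv> self_module K"

lemma self_module_simps [simp]:
  "carrier line = carrier K" "\<zero>\<^bsub>line\<^esub> = \<zero>\<^bsub>K\<^esub>" "add line = add K" "smult line = mult K"
  by (simp_all add: self_module_def)

lemma K_closed [simp]:
  "\<zero>\<^bsub>K\<^esub> \<in> carrier K" "\<one>\<^bsub>K\<^esub> \<in> carrier K"
  "x \<in> carrier K \<Longrightarrow> y \<in> carrier K \<Longrightarrow> x \<oplus>\<^bsub>K\<^esub> y \<in> carrier K"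
  "x \<in> carrier K \<Longrightarrow> y \<in> carrier K \<Longrightarrow> x \<otimes>\<^bsub>K\<^esub> y \<in> carrier K"
proof -
  interpret cring K by (rule cring_K)
  show "\<zero>\<^bsub>K\<^esub> \<in> carrier K" "\<one>\<^bsub>K\<^esub> \<in> carrier K"
    "x \<in> carrier K \<Longrightarrow> y \<in> carrier K \<Longrightarrow> x \<oplus>\<^bsub>K\<^esub> y \<in> carrier K"
    "x \<in> carrier K \<Longrightarrow> y \<in> carrier K \<Longrightarrow> x \<otimes>\<^bsub>K\<^esub> y \<in> carrier K" by simp_all
qed

lemma K_simps [simp]:
  "x \<in> carrier K \<Longrightarrow> \<zero>\<^bsub>K\<^esub> \<oplus>\<^bsub>K\<^esub> x = x" "x \<in> carrier K \<Longrightarrow> x \<oplus>\<^bsub>K\<^esub> \<zero>\<^bsub>K\<^esub> = x"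
  "x \<in> carrier K \<Longrightarrow> \<one>\<^bsub>K\<^esub> \<otimes>\<^bsub>K\<^esub> x = x" "x \<in> carrier K \<Longrightarrow> x \<otimes>\<^bsub>K\<^esub> \<one>\<^bsub>K\<^esub> = x"
  "x \<in> carrier K \<Longrightarrow> \<zero>\<^bsub>K\<^esub> \<otimes>\<^bsub>K\<^esub> x = \<zero>\<^bsub>K\<^esub>" "x \<in> carrier K \<Longrightarrow> x \<otimes>\<^bsub>K\<^esub> \<zero>\<^bsub>K\<^esub> = \<zero>\<^bsub>K\<^esub>"
proof -
  interpret cring K by (rule cring_K)
  show "x \<in> carrier K \<Longrightarrow> \<zero>\<^bsub>K\<^esub> \<oplus>\<^bsub>K\<^esub> x = x" "x \<in> carrier K \<Longrightarrow> x \<oplus>\<^bsub>K\<^esub> \<zero>\<^bsub>K\<^esub> = x"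
    "x \<in> carrier K \<Longrightarrow> \<one>\<^bsub>K\<^esub> \<otimes>\<^bsub>K\<^esub> x = x" "x \<in> carrier K \<Longrightarrow> x \<otimes>\<^bsub>K\<^esub> \<one>\<^bsub>K\<^esub> = x"
    "x \<in> carrier K \<Longrightarrow> \<zero>\<^bsub>K\<^esub> \<otimes>\<^bsub>K\<^esub> x = \<zero>\<^bsub>K\<^esub>" "x \<in> carrier K \<Longrightarrow> x \<otimes>\<^bsub>K\<^esub> \<zero>\<^bsub>K\<^esub> = \<zero>\<^bsub>K\<^esub>"
    by simp_all
qed

lemma line_vect [simp]: "line \<in> vect K"
proof -
  interpret cring K by (rule cring_K)
  have "module K line"
  proof (rule moduleI)
    show "cring K" by (rule is_cring)
    show "abelian_group line"
    proof (rule abelian_groupI)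
      fix x assume "x \<in> carrier line"
      then show "\<exists>y\<in>carrier line. y \<oplus>\<^bsub>line\<^esub> x = \<zero>\<^bsub>line\<^esub>"
        by (intro bexI[of _ "\<ominus>\<^bsub>K\<^esub> x"]) (simp_all add: l_neg)
    qed (simp_all add: a_ac)
  qed (simp_all add: l_distr r_distr m_assoc)
  then show ?thesis by (simp add: vect_def small_K)
qed

abbreviation free :: "'u set \<Rightarrow> ('u, 'u) module" where "free I \<equiv> free_space K I"

definition vec :: "'u set \<Rightarrow> ('u \<Rightarrow> 'u) \<Rightarrow> 'u" where
  "vec I f = fcode I (\<lambda>i\<in>I. f i)"

text \<open>The inclusion of the line spanned by the basis vector at \<open>i\<close>. It takes the
  scalar as an argument in order to be an arrow out of \<open>line\<close>, to which functors can be
  applied; the basis vector itself is the value at one.\<close>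

definition basis_map :: "'u set \<Rightarrow> 'u \<Rightarrow> 'u \<Rightarrow> 'u" where
  "basis_map I i = (\<lambda>c\<in>carrier K. vec I (\<lambda>j. if j = i then c else \<zero>\<^bsub>K\<^esub>))"

lemma power_vect:
  assumes I: "small I" and M: "M \<in> vect K" shows "coded I (power_module I M) \<in> vect K"
proof -
  have eq: "power_module I M = (power_module I M)\<lparr>carrier := I \<rightarrow>\<^sub>E carrier M\<rparr>"
    by (simp add: power_module_def)
  have "module K (power_module I M)"
    by (subst eq, rule module_power_submodule[OF vect_module[OF M]]) (use M in \<open>auto simp: PiE_iff\<close>)
  then have "module K (coded I (power_module I M))"
    by (rule module_coded[OF I]) (simp add: power_module_def PiE_def)
  moreover have "small (carrier (coded I (power_module I M)))"
    unfolding coded_def power_module_def by simp (rule small_fcode[OF I vect_small[OF M]], auto)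
  ultimately show ?thesis by (simp add: vect_def)
qed

lemma copower_vect:
  assumes I: "small I" and M: "M \<in> vect K" shows "coded I (copower_module I M) \<in> vect K"
proof -
  interpret M: module K M by (rule vect_module[OF M])
  let ?C = "{f \<in> I \<rightarrow>\<^sub>E carrier M. finite {i \<in> I. f i \<noteq> \<zero>\<^bsub>M\<^esub>}}"
  have "module K ((power_module I M)\<lparr>carrier := ?C\<rparr>)"
  proof (rule module_power_submodule[OF vect_module[OF M]])
    show "(\<lambda>i\<in>I. f i \<oplus>\<^bsub>M\<^esub> g i) \<in> ?C" if "f \<in> ?C" "g \<in> ?C" for f g
    proof -
      have "finite ({i \<in> I. f i \<noteq> \<zero>\<^bsub>M\<^esub>} \<union> {i \<in> I. g i \<noteq> \<zero>\<^bsub>M\<^esub>})" using that by simp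
      then have "finite {i \<in> I. f i \<oplus>\<^bsub>M\<^esub> g i \<noteq> \<zero>\<^bsub>M\<^esub>}"
        by (rule rev_finite_subset) auto
      with that show ?thesis by (auto simp: PiE_iff cong: conj_cong)
    qed
    show "(\<lambda>i\<in>I. c \<odot>\<^bsub>M\<^esub> f i) \<in> ?C" if "c \<in> carrier K" "f \<in> ?C" for c f
    proof -
      have "finite {i \<in> I. f i \<noteq> \<zero>\<^bsub>M\<^esub>}" using that by simp
      then have "finite {i \<in> I. c \<odot>\<^bsub>M\<^esub> f i \<noteq> \<zero>\<^bsub>M\<^esub>}"
        by (rule rev_finite_subset) (use that in auto)
      with that show ?thesis by (auto simp: PiE_iff cong: conj_cong)
    qed
  qed (auto cong: conj_cong)
  then have "module K (coded I (copower_module I M))"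
    unfolding copower_module_def by (rule module_coded[OF I]) (auto simp: PiE_iff)
  moreover have "small (carrier (coded I (copower_module I M)))"
    unfolding coded_def copower_module_def
    by simp (rule small_fcode[OF I vect_small[OF M]], auto)
  ultimately show ?thesis by (simp add: vect_def)
qed

lemma free_vect [simp]: "small I \<Longrightarrow> free I \<in> vect K"
  unfolding free_space_def by (simp add: copower_vect)

lemma vec_free [simp]:
  assumes "\<And>i. i \<in> I \<Longrightarrow> f i \<in> carrier K" "finite {i \<in> I. f i \<noteq> \<zero>\<^bsub>K\<^esub>}"
  shows "vec I f \<in> carrier (free I)"
  using assms unfolding vec_def free_space_def coded_def copower_module_def
  by (auto intro!: imageI cong: conj_cong)

lemma fapp_vec [simp]: "small I \<Longrightarrow> i \<in> I \<Longrightarrow> fapp I (vec I f) i = f i"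
  by (simp add: vec_def fapp_fcode)

context
  fixes I :: "'u set"
  assumes I: "small I"
begin

lemma freeE:
  assumes "v \<in> carrier (free I)"
  obtains f where "f \<in> I \<rightarrow>\<^sub>E carrier K" "finite {i \<in> I. f i \<noteq> \<zero>\<^bsub>K\<^esub>}" "v = fcode I f" "fapp I v = f"
proof -
  obtain f where f: "f \<in> I \<rightarrow>\<^sub>E carrier K" "finite {i \<in> I. f i \<noteq> \<zero>\<^bsub>K\<^esub>}" "v = fcode I f"
    using assms unfolding free_space_def coded_def copower_module_def by auto
  moreover have "fapp I v = f" using f I by (auto simp: fapp_fcode PiE_iff)
  ultimately show ?thesis using that by blast
qed

lemma fapp_closed [simp]: "v \<in> carrier (free I) \<Longrightarrow> i \<in> I \<Longrightarrow> fapp I v i \<in> carrier K"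
  by (erule freeE) auto

lemma fapp_finite [simp]: "v \<in> carrier (free I) \<Longrightarrow> finite {i \<in> I. fapp I v i \<noteq> \<zero>\<^bsub>K\<^esub>}"
  by (erule freeE) auto

lemma fapp_add [simp]:
  assumes "v \<in> carrier (free I)" "w \<in> carrier (free I)" "i \<in> I"
  shows "fapp I (v \<oplus>\<^bsub>free I\<^esub> w) i = fapp I v i \<oplus>\<^bsub>K\<^esub> fapp I w i"
  using assms I unfolding free_space_def coded_def copower_module_def power_module_def
  by (simp add: fapp_fcode)

lemma fapp_smult [simp]:
  assumes "c \<in> carrier K" "v \<in> carrier (free I)" "i \<in> I"
  shows "fapp I (c \<odot>\<^bsub>free I\<^esub> v) i = c \<otimes>\<^bsub>K\<^esub> fapp I v i"
  using assms I unfolding free_space_def coded_def copower_module_def power_module_def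
  by (simp add: fapp_fcode)

lemma fapp_zero [simp]: "i \<in> I \<Longrightarrow> fapp I \<zero>\<^bsub>free I\<^esub> i = \<zero>\<^bsub>K\<^esub>"
  using I unfolding free_space_def coded_def copower_module_def power_module_def
  by (simp add: fapp_fcode)

lemma free_eqI:
  assumes "v \<in> carrier (free I)" "w \<in> carrier (free I)" "\<And>i. i \<in> I \<Longrightarrow> fapp I v i = fapp I w i"
  shows "v = w"
proof -
  obtain f where f: "f \<in> I \<rightarrow>\<^sub>E carrier K" "v = fcode I f" "fapp I v = f"
    using freeE[OF assms(1)] by metis
  obtain g where g: "g \<in> I \<rightarrow>\<^sub>E carrier K" "w = fcode I g" "fapp I w = g"
    using freeE[OF assms(2)] by metis
  have "f = g" using f g assms(3) by (metis PiE_ext)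
  with f g show ?thesis by simp
qed

lemma lin_freeI:
  assumes "V \<in> vect K" "\<And>v i. v \<in> carrier V \<Longrightarrow> i \<in> I \<Longrightarrow> g v i \<in> carrier K"
    "\<And>v. v \<in> carrier V \<Longrightarrow> finite {i \<in> I. g v i \<noteq> \<zero>\<^bsub>K\<^esub>}"
    "\<And>v w i. v \<in> carrier V \<Longrightarrow> w \<in> carrier V \<Longrightarrow> i \<in> I \<Longrightarrow> g (v \<oplus>\<^bsub>V\<^esub> w) i = g v i \<oplus>\<^bsub>K\<^esub> g w i"
    "\<And>c v i. c \<in> carrier K \<Longrightarrow> v \<in> carrier V \<Longrightarrow> i \<in> I \<Longrightarrow> g (c \<odot>\<^bsub>V\<^esub> v) i = c \<otimes>\<^bsub>K\<^esub> g v i"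
  shows "(\<lambda>v\<in>carrier V. vec I (g v)) \<in> lin K V (free I)"
proof (rule lin_restrictI[OF assms(1)])
  have mem: "vec I (g v) \<in> carrier (free I)" if "v \<in> carrier V" for v
    using assms that by auto
  then show "vec I (g v) \<in> carrier (free I)" if "v \<in> carrier V" for v using that .
  show "vec I (g (v \<oplus>\<^bsub>V\<^esub> w)) = vec I (g v) \<oplus>\<^bsub>free I\<^esub> vec I (g w)"
    if "v \<in> carrier V" "w \<in> carrier V" for v w
    by (rule free_eqI) (use that mem assms(1,4) I in auto)
  show "vec I (g (c \<odot>\<^bsub>V\<^esub> v)) = c \<odot>\<^bsub>free I\<^esub> vec I (g v)"
    if "c \<in> carrier K" "v \<in> carrier V" for c v
    by (rule free_eqI) (use that mem assms(1,5) I in auto)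
qed

lemma coord_lin [simp]: "i \<in> I \<Longrightarrow> coord K I i \<in> lin K (free I) line"
  unfolding coord_def by (rule lin_restrictI) (use I in auto)

lemma coord_apply [simp]: "v \<in> carrier (free I) \<Longrightarrow> coord K I i v = fapp I v i"
  by (simp add: coord_def)

lemma finite_single_support [simp]: "finite {j \<in> I. (if j = i then c else z) \<noteq> z}"
  by (rule finite_subset[of _ "{i}"]) auto

lemma basis_map_lin [simp]: "i \<in> I \<Longrightarrow> basis_map I i \<in> lin K line (free I)"
proof -
  assume "i \<in> I"
  have "(\<lambda>c\<in>carrier line. vec I ((\<lambda>c j. if j = i then c else \<zero>\<^bsub>K\<^esub>) c)) \<in> lin K line (free I)"
    by (rule lin_freeI) auto
  then show ?thesis by (simp add: basis_map_def)
qed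

lemma basis_map_closed [simp]: "i \<in> I \<Longrightarrow> c \<in> carrier K \<Longrightarrow> basis_map I i c \<in> carrier (free I)"
  using lin_closed[OF basis_map_lin] by simp

lemma fapp_basis_map [simp]:
  "c \<in> carrier K \<Longrightarrow> j \<in> I \<Longrightarrow> fapp I (basis_map I i c) j = (if j = i then c else \<zero>\<^bsub>K\<^esub>)"
  using I by (simp add: basis_map_def)

text \<open>The induction runs over a finite set containing the support and not over the support
  itself, so that it suffices for the removal of one coordinate to leave the support inside a
  smaller set.\<close>

lemma free_induct [consumes 1, case_names zero add basis]:
  assumes v: "v \<in> carrier (free I)" and zero: "P \<zero>\<^bsub>free I\<^esub>"
    and add: "\<And>v w. v \<in> carrier (free I) \<Longrightarrow> w \<in> carrier (free I) \<Longrightarrow> P v \<Longrightarrow> P w \<Longrightarrow> P (v \<oplus>\<^bsub>free I\<^esub> w)"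
    and basis: "\<And>i c. i \<in> I \<Longrightarrow> c \<in> carrier K \<Longrightarrow> P (basis_map I i c)"
  shows "P v"
proof -
  have "P v" if "finite S" "v \<in> carrier (free I)" "{i \<in> I. fapp I v i \<noteq> \<zero>\<^bsub>K\<^esub>} \<subseteq> S" "S \<subseteq> I" for S v
    using that
  proof (induction S arbitrary: v)
    case empty
    have "v = \<zero>\<^bsub>free I\<^esub>" by (rule free_eqI) (use I empty.prems in auto)
    with zero show ?case by simp
  next
    case (insert i S)
    let ?w = "vec I (\<lambda>j. if j = i then \<zero>\<^bsub>K\<^esub> else fapp I v j)"
    have sub: "{j \<in> I. (if j = i then \<zero>\<^bsub>K\<^esub> else fapp I v j) \<noteq> \<zero>\<^bsub>K\<^esub>} \<subseteq> S"
      using insert.prems by auto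
    have w: "?w \<in> carrier (free I)"
      by (rule vec_free) (use insert.prems finite_subset[OF sub insert.hyps(1)] in auto)
    have Pw: "P ?w" by (rule insert.IH) (use w sub I insert.prems in auto)
    have b: "basis_map I i (fapp I v i) \<in> carrier (free I)" using insert.prems by simp
    have Pb: "P (basis_map I i (fapp I v i))" by (rule basis) (use insert.prems in auto)
    have eq: "v = ?w \<oplus>\<^bsub>free I\<^esub> basis_map I i (fapp I v i)"
      by (rule free_eqI) (use insert.prems w I in auto)
    show ?case by (subst eq) (rule add[OF w b Pw Pb])
  qed
  from this[OF fapp_finite[OF v] v] show ?thesis by auto
qed

lemma free_lin_eqI:
  assumes "W \<in> vect K" "f \<in> lin K (free I) W" "g \<in> lin K (free I) W"
    and "\<And>i c. i \<in> I \<Longrightarrow> c \<in> carrier K \<Longrightarrow> f (basis_map I i c) = g (basis_map I i c)"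
  shows "f = g"
proof (rule lin_eqI[OF assms(2,3)])
  fix v assume "v \<in> carrier (free I)"
  then show "f v = g v"
    by (induction rule: free_induct)
      (use I assms in \<open>auto simp: lin_add[OF assms(2)] lin_add[OF assms(3)]\<close>)
qed

text \<open>The universal property of the free space: the linear map with prescribed images
  \<open>w i\<close> of the basis vectors. Restricting to the support makes the sum finite.\<close>

definition lincomb :: "('u, 'u) module \<Rightarrow> ('u \<Rightarrow> 'u) \<Rightarrow> 'u \<Rightarrow> 'u" where
  "lincomb V w = (\<lambda>v\<in>carrier (free I).
     finsum V (\<lambda>i. fapp I v i \<odot>\<^bsub>V\<^esub> w i) {i \<in> I. fapp I v i \<noteq> \<zero>\<^bsub>K\<^esub>})"

lemma
  assumes V: "V \<in> vect K" and w: "\<And>i. i \<in> I \<Longrightarrow> w i \<in> carrier V"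
  shows lincomb_lin: "lincomb V w \<in> lin K (free I) V"
    and lincomb_basis_map: "i \<in> I \<Longrightarrow> c \<in> carrier K \<Longrightarrow> lincomb V w (basis_map I i c) = c \<odot>\<^bsub>V\<^esub> w i"
proof -
  interpret V: module K V by (rule vect_module) fact
  let ?s = "\<lambda>v. finsum V (\<lambda>i. fapp I v i \<odot>\<^bsub>V\<^esub> w i)"
  \<comment> \<open>Sums for different vectors can only be compared over a common finite index set,
    so the support is first enlarged.\<close>
  have over: "lincomb V w v = ?s v S"
    if "v \<in> carrier (free I)" "finite S" "{i \<in> I. fapp I v i \<noteq> \<zero>\<^bsub>K\<^esub>} \<subseteq> S" "S \<subseteq> I" for v S
    using that w unfolding lincomb_def
    by (auto intro!: V.M.add.finprod_mono_neutral_cong_left)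
  have finsum_closed: "?s v S \<in> carrier V" if "v \<in> carrier (free I)" "S \<subseteq> I" for v S
    using that w by (intro V.M.finsum_closed) auto
  show "lincomb V w \<in> lin K (free I) V"
  proof (rule linI)
    fix v u assume vu: "v \<in> carrier (free I)" "u \<in> carrier (free I)"
    let ?S = "{i \<in> I. fapp I v i \<noteq> \<zero>\<^bsub>K\<^esub>} \<union> {i \<in> I. fapp I u i \<noteq> \<zero>\<^bsub>K\<^esub>}"
    have "lincomb V w (v \<oplus>\<^bsub>free I\<^esub> u) = ?s (v \<oplus>\<^bsub>free I\<^esub> u) ?S"
      by (rule over) (use vu I in auto)
    also have "\<dots> = finsum V (\<lambda>i. fapp I v i \<odot>\<^bsub>V\<^esub> w i \<oplus>\<^bsub>V\<^esub> fapp I u i \<odot>\<^bsub>V\<^esub> w i) ?S"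
      using vu w by (intro V.M.finsum_cong') (auto simp: V.smult_l_distr)
    also have "\<dots> = ?s v ?S \<oplus>\<^bsub>V\<^esub> ?s u ?S"
      using vu w by (intro V.M.finsum_addf) auto
    also have "?s v ?S = lincomb V w v" by (rule over[symmetric]) (use vu in auto)
    also have "?s u ?S = lincomb V w u" by (rule over[symmetric]) (use vu in auto)
    finally show "lincomb V w (v \<oplus>\<^bsub>free I\<^esub> u) = lincomb V w v \<oplus>\<^bsub>V\<^esub> lincomb V w u" .
  next
    fix c v assume cv: "c \<in> carrier K" "v \<in> carrier (free I)"
    let ?S = "{i \<in> I. fapp I v i \<noteq> \<zero>\<^bsub>K\<^esub>}"
    have "lincomb V w (c \<odot>\<^bsub>free I\<^esub> v) = ?s (c \<odot>\<^bsub>free I\<^esub> v) ?S"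
      by (rule over) (use cv I in auto)
    also have "\<dots> = finsum V (\<lambda>i. c \<odot>\<^bsub>V\<^esub> (fapp I v i \<odot>\<^bsub>V\<^esub> w i)) ?S"
      using cv w by (intro V.M.finsum_cong') (auto simp: V.smult_assoc1)
    also have "\<dots> = c \<odot>\<^bsub>V\<^esub> ?s v ?S"
      using cv w by (intro V.finsum_smult_ldistr[symmetric]) auto
    also have "?s v ?S = lincomb V w v" by (rule over[symmetric]) (use cv in auto)
    finally show "lincomb V w (c \<odot>\<^bsub>free I\<^esub> v) = c \<odot>\<^bsub>V\<^esub> lincomb V w v" .
  qed (simp_all add: lincomb_def finsum_closed)
  show "lincomb V w (basis_map I i c) = c \<odot>\<^bsub>V\<^esub> w i" if ic: "i \<in> I" "c \<in> carrier K"
  proof -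
    have "lincomb V w (basis_map I i c) = ?s (basis_map I i c) {i}"
      by (rule over) (use ic in \<open>auto split: if_splits\<close>)
    also have "\<dots> = c \<odot>\<^bsub>V\<^esub> w i" using ic w by simp
    finally show ?thesis .
  qed
qed

lemma sum_functional_eq: "sum_functional K I = lincomb line (\<lambda>_. \<one>\<^bsub>K\<^esub>)"
proof -
  interpret L: module K line by (rule vect_module) simp
  have eq: "finsum K = finsum line"
    by (simp add: finsum_def finprod_def self_module_def fun_eq_iff)
  show ?thesis unfolding sum_functional_def lincomb_def eq
    by (rule restrict_ext, rule L.M.finsum_cong') auto
qed

lemma sum_functional_lin [simp]: "sum_functional K I \<in> lin K (free I) line"
  unfolding sum_functional_eq by (rule lincomb_lin) auto

lemma sum_functional_basis_map [simp]:
  "i \<in> I \<Longrightarrow> c \<in> carrier K \<Longrightarrow> sum_functional K I (basis_map I i c) = c"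
  unfolding sum_functional_eq by (subst lincomb_basis_map) auto

end

text \<open>The index set is the carrier of \<open>V\<close> itself: the linear combination map on
  the family of all vectors is onto, and surjections split.\<close>

lemma free_retract:
  assumes V: "V \<in> vect K"
  obtains I s r where "small I" "s \<in> lin K V (free I)" "r \<in> lin K (free I) V"
    "\<And>v. v \<in> carrier V \<Longrightarrow> r (s v) = v"
proof -
  let ?I = "carrier V"
  have I: "small ?I" by (rule vect_small[OF V])
  let ?r = "lincomb ?I V (\<lambda>v. v)"
  have r: "?r \<in> lin K (free ?I) V" by (rule lincomb_lin[OF I V])
  have "v \<in> ?r ` carrier (free ?I)" if "v \<in> carrier V" for v
    using lincomb_basis_map[OF I V, of "\<lambda>v. v" v "\<one>\<^bsub>K\<^esub>"] that I
    by (intro image_eqI[of _ _ "basis_map ?I v \<one>\<^bsub>K\<^esub>"]) (simp_all add: module.smult_one[OF vect_module[OF V]])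
  then have surj: "?r ` carrier (free ?I) = carrier V" using r by auto
  obtain s where "s \<in> lin K V (free ?I)" "\<And>v. v \<in> carrier V \<Longrightarrow> ?r (s v) = v"
    by (rule section_exists[OF free_vect[OF I] V r surj]) (rule that)
  then show ?thesis using that[OF I _ r] by blast
qed

text \<open>Coordinate \<open>i\<close> of the result is \<open>c i\<close> times coordinate
  \<open>p i\<close> of the argument for \<open>i\<close> in \<open>D\<close>, and zero for the
  other \<open>i\<close>. Diagonal maps, coordinate inclusions and projections, and shifts are all
  of this form.\<close>

definition reindex :: "'u set \<Rightarrow> 'u set \<Rightarrow> 'u set \<Rightarrow> ('u \<Rightarrow> 'u) \<Rightarrow> ('u \<Rightarrow> 'u) \<Rightarrow> 'u \<Rightarrow> 'u" where
  "reindex J I D p c = (\<lambda>v\<in>carrier (free J).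
     vec I (\<lambda>i. if i \<in> D then c i \<otimes>\<^bsub>K\<^esub> fapp J v (p i) else \<zero>\<^bsub>K\<^esub>))"

text \<open>Injectivity of \<open>p\<close> on \<open>D\<close> means that each coordinate is copied
  to at most one place, which keeps supports finite.\<close>

lemma reindex:
  assumes "small I" "small J" "D \<subseteq> I" "inj_on p D" "p ` D \<subseteq> J" "\<And>i. i \<in> D \<Longrightarrow> c i \<in> carrier K"
  shows reindex_lin: "reindex J I D p c \<in> lin K (free J) (free I)"
    and fapp_reindex: "v \<in> carrier (free J) \<Longrightarrow> i \<in> I \<Longrightarrow>
      fapp I (reindex J I D p c v) i = (if i \<in> D then c i \<otimes>\<^bsub>K\<^esub> fapp J v (p i) else \<zero>\<^bsub>K\<^esub>)"
proof -
  interpret cring K by (rule cring_K)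
  show "reindex J I D p c \<in> lin K (free J) (free I)"
    unfolding reindex_def
  proof (rule lin_freeI)
    fix v assume v: "v \<in> carrier (free J)"
    have "finite (p ` {i \<in> D. fapp J v (p i) \<noteq> \<zero>\<^bsub>K\<^esub>})"
      by (rule finite_subset[OF _ fapp_finite[OF assms(2) v]]) (use assms in auto)
    then have "finite {i \<in> D. fapp J v (p i) \<noteq> \<zero>\<^bsub>K\<^esub>}"
      by (rule finite_imageD) (use assms in \<open>auto intro: inj_on_subset\<close>)
    then show "finite {i \<in> I. (if i \<in> D then c i \<otimes>\<^bsub>K\<^esub> fapp J v (p i) else \<zero>\<^bsub>K\<^esub>) \<noteq> \<zero>\<^bsub>K\<^esub>}"
      by (rule rev_finite_subset) (use assms in \<open>auto split: if_splits\<close>)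
  qed (use assms in \<open>auto simp: r_distr m_ac\<close>)
  show "v \<in> carrier (free J) \<Longrightarrow> i \<in> I \<Longrightarrow>
      fapp I (reindex J I D p c v) i = (if i \<in> D then c i \<otimes>\<^bsub>K\<^esub> fapp J v (p i) else \<zero>\<^bsub>K\<^esub>)"
    using assms(1) by (simp add: reindex_def)
qed

section \<open>Functors\<close>

text \<open>What \<open>nat_transI\<close> asks of the source of a transformation. The power and
  copower functors enter the argument through this property.\<close>

definition vect_valued :: "'u vfunctor \<Rightarrow> bool" where
  "vect_valued X \<longleftrightarrow> (\<forall>V\<in>vect K. obj X V \<in> vect K) \<and>
     (\<forall>V\<in>vect K. \<forall>W\<in>vect K. \<forall>f\<in>lin K V W. \<forall>x\<in>carrier (obj X V). arr X V W f x \<in> carrier (obj X W))"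

lemma hom_module_simps [simp]:
  "carrier (hom_module K V W) = lin K V W"
  "f \<oplus>\<^bsub>hom_module K V W\<^esub> g = (\<lambda>v\<in>carrier V. f v \<oplus>\<^bsub>W\<^esub> g v)"
  "c \<odot>\<^bsub>hom_module K V W\<^esub> f = (\<lambda>v\<in>carrier V. c \<odot>\<^bsub>W\<^esub> f v)"
  "\<zero>\<^bsub>hom_module K V W\<^esub> = (\<lambda>v\<in>carrier V. \<zero>\<^bsub>W\<^esub>)"
  by (simp_all add: hom_module_def power_module_def)

lemma valued_obj [simp]: "vect_valued X \<Longrightarrow> V \<in> vect K \<Longrightarrow> obj X V \<in> vect K"
  by (simp add: vect_valued_def)

lemma valued_arr:
  "vect_valued X \<Longrightarrow> V \<in> vect K \<Longrightarrow> W \<in> vect K \<Longrightarrow> f \<in> lin K V W \<Longrightarrow> x \<in> carrier (obj X V) \<Longrightarrow>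
    arr X V W f x \<in> carrier (obj X W)"
  by (simp add: vect_valued_def)

lemma additive_lin [simp]:
  assumes "additive_functor K X" "V \<in> vect K" "W \<in> vect K" "f \<in> lin K V W"
  shows "arr X V W f \<in> lin K (obj X V) (obj X W)"
proof -
  have "linear_map K (hom_module K V W) (hom_module K (obj X V) (obj X W)) (arr X V W)"
    using assms unfolding additive_functor_def by blast
  then have "arr X V W \<in> lin K V W \<rightarrow> lin K (obj X V) (obj X W)" by (simp add: linear_map_def)
  with assms(4) show ?thesis by (rule funcset_mem[rotated])
qed

lemma additive_valued: "additive_functor K X \<Longrightarrow> vect_valued X"
  unfolding vect_valued_def
  by (intro conjI ballI lin_closed[OF additive_lin]) (auto simp: additive_functor_def)

lemma additive_obj [simp]: "additive_functor K X \<Longrightarrow> V \<in> vect K \<Longrightarrow> obj X V \<in> vect K"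
  by (simp add: additive_valued)

lemma additive_closed [simp]:
  "additive_functor K X \<Longrightarrow> V \<in> vect K \<Longrightarrow> W \<in> vect K \<Longrightarrow> f \<in> lin K V W \<Longrightarrow> x \<in> carrier (obj X V) \<Longrightarrow>
    arr X V W f x \<in> carrier (obj X W)"
  by (rule lin_closed[OF additive_lin])

context
  fixes X :: "'u vfunctor"
  assumes X: "additive_functor K X"
begin

lemma additive_id:
  assumes "V \<in> vect K" "f \<in> lin K V V" "\<And>v. v \<in> carrier V \<Longrightarrow> f v = v" "x \<in> carrier (obj X V)"
  shows "arr X V V f x = x"
proof -
  have f: "f = (\<lambda>v\<in>carrier V. v)"
    by (rule lin_eqI[OF assms(2) lin_id]) (use assms in auto)
  have "arr X V V f = (\<lambda>x\<in>carrier (obj X V). x)"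
    using X assms(1) unfolding f additive_functor_def by blast
  with assms(4) show ?thesis by simp
qed

text \<open>The composite is passed as a separate map \<open>h\<close> that agrees with it on
  elements; the neighbouring lemmas have the same form. Identities between linear maps can then be
  verified pointwise when a functor is applied to them.\<close>

lemma additive_comp:
  assumes "U \<in> vect K" "V \<in> vect K" "W \<in> vect K" "f \<in> lin K U V" "g \<in> lin K V W" "h \<in> lin K U W"
    and "\<And>u. u \<in> carrier U \<Longrightarrow> h u = g (f u)" "x \<in> carrier (obj X U)"
  shows "arr X V W g (arr X U V f x) = arr X U W h x"
proof -
  have h: "h = compose (carrier U) g f"
    by (rule lin_eqI[OF assms(6) lin_compose[OF assms(1,4,5)]]) (use assms in \<open>auto simp: compose_eq\<close>)
  have "arr X U W h = compose (carrier (obj X U)) (arr X V W g) (arr X U V f)"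
    using X assms(1-5) unfolding h additive_functor_def by blast
  with assms(8) show ?thesis by (simp add: compose_eq)
qed

lemma additive_add:
  assumes "V \<in> vect K" "W \<in> vect K" "f \<in> lin K V W" "g \<in> lin K V W" "h \<in> lin K V W"
    and "\<And>u. u \<in> carrier V \<Longrightarrow> h u = f u \<oplus>\<^bsub>W\<^esub> g u" "x \<in> carrier (obj X V)"
  shows "arr X V W h x = arr X V W f x \<oplus>\<^bsub>obj X W\<^esub> arr X V W g x"
proof -
  have h: "h = f \<oplus>\<^bsub>hom_module K V W\<^esub> g"
    using lin_eqI[OF assms(5) lin_add_map[OF assms(1-4)]] assms by simp
  have "linear_map K (hom_module K V W) (hom_module K (obj X V) (obj X W)) (arr X V W)"
    using X assms unfolding additive_functor_def by blast
  then have "arr X V W h = arr X V W f \<oplus>\<^bsub>hom_module K (obj X V) (obj X W)\<^esub> arr X V W g"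
    unfolding h using assms(3,4) unfolding linear_map_def hom_module_simps(1) by blast
  with assms(7) show ?thesis by simp
qed

lemma additive_smult:
  assumes "V \<in> vect K" "W \<in> vect K" "f \<in> lin K V W" "c \<in> carrier K" "h \<in> lin K V W"
    and "\<And>u. u \<in> carrier V \<Longrightarrow> h u = c \<odot>\<^bsub>W\<^esub> f u" "x \<in> carrier (obj X V)"
  shows "arr X V W h x = c \<odot>\<^bsub>obj X W\<^esub> arr X V W f x"
proof -
  have h: "h = c \<odot>\<^bsub>hom_module K V W\<^esub> f"
    using lin_eqI[OF assms(5) lin_smult_map[OF assms(1-4)]] assms by simp
  have "linear_map K (hom_module K V W) (hom_module K (obj X V) (obj X W)) (arr X V W)"
    using X assms unfolding additive_functor_def by blast
  then have "arr X V W h = c \<odot>\<^bsub>hom_module K (obj X V) (obj X W)\<^esub> arr X V W f"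
    unfolding h using assms(3,4) unfolding linear_map_def hom_module_simps(1) by blast
  with assms(7) show ?thesis by simp
qed

text \<open>A vanishing map is zero times itself, so this is a case of compatibility with
  scalars.\<close>

lemma additive_zero:
  assumes "V \<in> vect K" "W \<in> vect K" "f \<in> lin K V W"
    and "\<And>u. u \<in> carrier V \<Longrightarrow> f u = \<zero>\<^bsub>W\<^esub>" "x \<in> carrier (obj X V)"
  shows "arr X V W f x = \<zero>\<^bsub>obj X W\<^esub>"
proof -
  have "arr X V W f x = \<zero>\<^bsub>K\<^esub> \<odot>\<^bsub>obj X W\<^esub> arr X V W f x"
    by (rule additive_smult) (use assms X in \<open>auto simp: module.smult_r_null[OF vect_module]\<close>)
  also have "\<dots> = \<zero>\<^bsub>obj X W\<^esub>"
    using assms X by (intro module.smult_l_null[OF vect_module]) auto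
  finally show ?thesis .
qed

end

section \<open>Natural transformations and their pointwise handling\<close>

lemma nt_lin: "\<eta> \<in> nat_trans K X Y \<Longrightarrow> V \<in> vect K \<Longrightarrow> \<eta> V \<in> lin K (obj X V) (obj Y V)"
  by (simp add: nat_trans_def)

lemma nt_closed [simp]:
  "\<eta> \<in> nat_trans K X Y \<Longrightarrow> V \<in> vect K \<Longrightarrow> x \<in> carrier (obj X V) \<Longrightarrow> \<eta> V x \<in> carrier (obj Y V)"
  by (rule lin_closed[OF nt_lin])

lemma nt_nat:
  assumes "\<eta> \<in> nat_trans K X Y" "V \<in> vect K" "W \<in> vect K" "f \<in> lin K V W" "x \<in> carrier (obj X V)"
  shows "\<eta> W (arr X V W f x) = arr Y V W f (\<eta> V x)"
proof -
  have "compose (carrier (obj X V)) (\<eta> W) (arr X V W f) =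
        compose (carrier (obj X V)) (arr Y V W f) (\<eta> V)"
    using assms(1-4) by (simp add: nat_trans_def)
  from fun_cong[OF this, of x] assms(5) show ?thesis by (simp add: compose_eq)
qed

lemma nt_eqI:
  assumes "\<eta> \<in> nat_trans K X Y" "\<zeta> \<in> nat_trans K X Y"
    and "\<And>V x. V \<in> vect K \<Longrightarrow> x \<in> carrier (obj X V) \<Longrightarrow> \<eta> V x = \<zeta> V x"
  shows "\<eta> = \<zeta>"
proof (rule extensionalityI[of _ "vect K"])
  fix V assume V: "V \<in> vect K"
  show "\<eta> V = \<zeta> V"
    by (rule lin_eqI[OF nt_lin[OF assms(1) V] nt_lin[OF assms(2) V]]) (rule assms(3)[OF V])
qed (use assms in \<open>auto simp: nat_trans_def\<close>)

lemma nat_transI: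
  assumes "vect_valued X"
    and "\<And>V x. V \<in> vect K \<Longrightarrow> x \<in> carrier (obj X V) \<Longrightarrow> h V x \<in> carrier (obj Y V)"
    and "\<And>V x y. V \<in> vect K \<Longrightarrow> x \<in> carrier (obj X V) \<Longrightarrow> y \<in> carrier (obj X V) \<Longrightarrow>
      h V (x \<oplus>\<^bsub>obj X V\<^esub> y) = h V x \<oplus>\<^bsub>obj Y V\<^esub> h V y"
    and "\<And>V c x. V \<in> vect K \<Longrightarrow> c \<in> carrier K \<Longrightarrow> x \<in> carrier (obj X V) \<Longrightarrow>
      h V (c \<odot>\<^bsub>obj X V\<^esub> x) = c \<odot>\<^bsub>obj Y V\<^esub> h V x"
    and "\<And>V W f x. V \<in> vect K \<Longrightarrow> W \<in> vect K \<Longrightarrow> f \<in> lin K V W \<Longrightarrow> x \<in> carrier (obj X V) \<Longrightarrow>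
      h W (arr X V W f x) = arr Y V W f (h V x)"
  shows "(\<lambda>V\<in>vect K. \<lambda>x\<in>carrier (obj X V). h V x) \<in> nat_trans K X Y"
  unfolding nat_trans_def
proof (intro CollectI conjI ballI)
  show "(\<lambda>V\<in>vect K. \<lambda>x\<in>carrier (obj X V). h V x) V \<in> lin K (obj X V) (obj Y V)"
    if "V \<in> vect K" for V
    using that assms by (simp add: lin_restrictI)
  fix V W f assume "V \<in> vect K" "W \<in> vect K" "f \<in> lin K V W"
  then show "compose (carrier (obj X V)) ((\<lambda>V\<in>vect K. \<lambda>x\<in>carrier (obj X V). h V x) W) (arr X V W f) =
    compose (carrier (obj X V)) (arr Y V W f) ((\<lambda>V\<in>vect K. \<lambda>x\<in>carrier (obj X V). h V x) V)"
    unfolding compose_def using assms(5) valued_arr[OF assms(1)]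
    by (intro restrict_ext) simp
qed simp

lemma nt_comp_apply [simp]:
  "V \<in> vect K \<Longrightarrow> x \<in> carrier (obj X V) \<Longrightarrow> nt_comp K X \<zeta> \<eta> V x = \<zeta> V (\<eta> V x)"
  by (simp add: nt_comp_def compose_eq)

lemma nt_comp_nat_trans:
  assumes "vect_valued X" "\<eta> \<in> nat_trans K X Y" "\<zeta> \<in> nat_trans K Y Z"
  shows "nt_comp K X \<zeta> \<eta> \<in> nat_trans K X Z"
  unfolding nt_comp_def compose_def using assms
  by (intro nat_transI) (auto simp: lin_add[OF nt_lin[OF assms(2)]] lin_add[OF nt_lin[OF assms(3)]]
    lin_smult[OF nt_lin[OF assms(2)]] lin_smult[OF nt_lin[OF assms(3)]]
    nt_nat[OF assms(2)] nt_nat[OF assms(3)])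

lemma nt_comp_eqI:
  assumes "\<theta> \<in> nat_trans K X Z"
    and "\<And>V x. V \<in> vect K \<Longrightarrow> x \<in> carrier (obj X V) \<Longrightarrow> \<zeta> V (\<eta> V x) = \<theta> V x"
  shows "nt_comp K X \<zeta> \<eta> = \<theta>"
proof (rule extensionalityI[of _ "vect K"])
  fix V assume V: "V \<in> vect K"
  show "nt_comp K X \<zeta> \<eta> V = \<theta> V"
    by (rule extensionalityI[of _ "carrier (obj X V)"])
      (use V assms(2) lin_ext[OF nt_lin[OF assms(1) V]] in \<open>auto simp: nt_comp_def compose_eq\<close>)
qed (use assms in \<open>auto simp: nat_trans_def nt_comp_def\<close>)

lemma nt_zero_apply [simp]:
  "V \<in> vect K \<Longrightarrow> x \<in> carrier (obj X V) \<Longrightarrow> nt_zero K X Y V x = \<zero>\<^bsub>obj Y V\<^esub>"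
  by (simp add: nt_zero_def)

lemma nt_zero_nat_trans:
  assumes "additive_functor K X" "additive_functor K Y"
  shows "nt_zero K X Y \<in> nat_trans K X Y"
  unfolding nt_zero_def using assms
  by (intro nat_transI) (auto simp: additive_valued module.smult_r_null[OF vect_module] lin_0[OF additive_lin])

text \<open>Pointwise the factorisation inverts \<open>m\<close> on its image. Linearity and
  naturality of the result hold because they hold after applying the injective maps
  \<open>m V\<close>.\<close>

lemma nt_factor:
  assumes A: "vect_valued A" and X: "additive_functor K X" and Y: "additive_functor K Y"
    and m: "m \<in> nat_trans K X Y" and k: "k \<in> nat_trans K A Y"
    and inj: "\<And>V. V \<in> vect K \<Longrightarrow> inj_on (m V) (carrier (obj X V))"
    and img: "\<And>V a. V \<in> vect K \<Longrightarrow> a \<in> carrier (obj A V) \<Longrightarrow> k V a \<in> m V ` carrier (obj X V)"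
  obtains h where "h \<in> nat_trans K A X"
    "\<And>V a. V \<in> vect K \<Longrightarrow> a \<in> carrier (obj A V) \<Longrightarrow> m V (h V a) = k V a"
proof -
  define g where "g V a = inv_into (carrier (obj X V)) (m V) (k V a)" for V a
  have g: "g V a \<in> carrier (obj X V)" "m V (g V a) = k V a"
    if "V \<in> vect K" "a \<in> carrier (obj A V)" for V a
    using img[OF that] by (auto simp: g_def inv_into_into f_inv_into_f)
  have eq: "x = y" if "V \<in> vect K" "x \<in> carrier (obj X V)" "y \<in> carrier (obj X V)" "m V x = m V y" for V x y
    using inj[OF that(1)] that by (auto dest: inj_onD)
  have "(\<lambda>V\<in>vect K. \<lambda>a\<in>carrier (obj A V). g V a) \<in> nat_trans K A X"
  proof (rule nat_transI[OF A])
    fix V x assume V: "V \<in> vect K" and x: "x \<in> carrier (obj A V)"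
    then show "g V x \<in> carrier (obj X V)" by (rule g)
    have [simp]: "obj A V \<in> vect K" "obj X V \<in> vect K" using A X V by simp_all
    note gx = g[OF V x]
    show "g V (x \<oplus>\<^bsub>obj A V\<^esub> y) = g V x \<oplus>\<^bsub>obj X V\<^esub> g V y" if y: "y \<in> carrier (obj A V)" for y
    proof (rule eq[OF V])
      have xy: "x \<oplus>\<^bsub>obj A V\<^esub> y \<in> carrier (obj A V)" using x y by simp
      show "g V (x \<oplus>\<^bsub>obj A V\<^esub> y) \<in> carrier (obj X V)" by (rule g[OF V xy])
      show "g V x \<oplus>\<^bsub>obj X V\<^esub> g V y \<in> carrier (obj X V)" using gx g[OF V y] by simp
      show "m V (g V (x \<oplus>\<^bsub>obj A V\<^esub> y)) = m V (g V x \<oplus>\<^bsub>obj X V\<^esub> g V y)"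
        by (simp add: g[OF V xy] gx g[OF V y] lin_add[OF nt_lin[OF m V]] lin_add[OF nt_lin[OF k V] x y])
    qed
    show "g V (c \<odot>\<^bsub>obj A V\<^esub> x) = c \<odot>\<^bsub>obj X V\<^esub> g V x" if c: "c \<in> carrier K" for c
    proof (rule eq[OF V])
      have cx: "c \<odot>\<^bsub>obj A V\<^esub> x \<in> carrier (obj A V)" using x c by simp
      show "g V (c \<odot>\<^bsub>obj A V\<^esub> x) \<in> carrier (obj X V)" by (rule g[OF V cx])
      show "c \<odot>\<^bsub>obj X V\<^esub> g V x \<in> carrier (obj X V)" using gx c by simp
      show "m V (g V (c \<odot>\<^bsub>obj A V\<^esub> x)) = m V (c \<odot>\<^bsub>obj X V\<^esub> g V x)"
        by (simp add: g[OF V cx] gx c lin_smult[OF nt_lin[OF m V]] lin_smult[OF nt_lin[OF k V] c x])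
    qed
    show "g W (arr A V W f x) = arr X V W f (g V x)" if W: "W \<in> vect K" and f: "f \<in> lin K V W" for W f
    proof (rule eq[OF W])
      have fx: "arr A V W f x \<in> carrier (obj A W)" by (rule valued_arr[OF A V W f x])
      show "g W (arr A V W f x) \<in> carrier (obj X W)" by (rule g[OF W fx])
      show "arr X V W f (g V x) \<in> carrier (obj X W)" by (rule additive_closed[OF X V W f gx(1)])
      show "m W (g W (arr A V W f x)) = m W (arr X V W f (g V x))"
        by (simp add: g[OF W fx] gx nt_nat[OF m V W f] nt_nat[OF k V W f x])
    qed
  qed
  then show ?thesis using that g by simp
qed

lemma injective_mono_in:
  assumes "\<C> X" "\<C> Y" "m \<in> nat_trans K X Y"
    and "\<And>V. V \<in> vect K \<Longrightarrow> inj_on (m V) (carrier (obj X V))"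
  shows "mono_in K \<C> X Y m"
  unfolding mono_in_def
proof (intro conjI allI impI ballI)
  fix Z f g
  assume fg: "f \<in> nat_trans K Z X" "g \<in> nat_trans K Z X" and eq: "nt_comp K Z m f = nt_comp K Z m g"
  show "f = g"
  proof (rule nt_eqI[OF fg])
    fix V x assume V: "V \<in> vect K" "x \<in> carrier (obj Z V)"
    from fun_cong[OF fun_cong[OF eq]] have "nt_comp K Z m f V x = nt_comp K Z m g V x" .
    with V have "m V (f V x) = m V (g V x)" by simp
    with V fg assms(4)[OF V(1)] show "f V x = g V x" by (auto dest: inj_onD)
  qed
qed (use assms in auto)

subsection \<open>Representable functors\<close>

lemma fapp_lin [simp]: "V \<in> vect K \<Longrightarrow> f \<in> lin K V W \<Longrightarrow> fapp (carrier V) (fcode (carrier V) f) = f"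
  by (simp add: fapp_fcode vect_small)

lemma carrier_yoneda [simp]: "carrier (obj (yoneda K V) W) = fcode (carrier V) ` lin K V W"
  by (simp add: yoneda_def coded_def)

lemma arr_yoneda [simp]:
  "V \<in> vect K \<Longrightarrow> f \<in> lin K V W \<Longrightarrow>
    arr (yoneda K V) W W' g (fcode (carrier V) f) = fcode (carrier V) (compose (carrier V) g f)"
  by (auto simp: yoneda_def coded_def)

lemma arr_yoneda_ext: "arr (yoneda K V) W W' g \<in> extensional (carrier (obj (yoneda K V) W))"
  by (simp add: yoneda_def)

lemma yoneda_ops [simp]:
  assumes "V \<in> vect K" "f \<in> lin K V W"
  shows "\<zero>\<^bsub>obj (yoneda K V) W\<^esub> = fcode (carrier V) (\<lambda>v\<in>carrier V. \<zero>\<^bsub>W\<^esub>)"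
    and "g \<in> lin K V W \<Longrightarrow> fcode (carrier V) f \<oplus>\<^bsub>obj (yoneda K V) W\<^esub> fcode (carrier V) g =
      fcode (carrier V) (\<lambda>v\<in>carrier V. f v \<oplus>\<^bsub>W\<^esub> g v)"
    and "c \<odot>\<^bsub>obj (yoneda K V) W\<^esub> fcode (carrier V) f = fcode (carrier V) (\<lambda>v\<in>carrier V. c \<odot>\<^bsub>W\<^esub> f v)"
  using assms by (simp_all add: yoneda_def coded_def)

lemma fcode_lin_inject [simp]:
  "V \<in> vect K \<Longrightarrow> f \<in> lin K V W \<Longrightarrow> g \<in> lin K V W \<Longrightarrow> fcode (carrier V) f = fcode (carrier V) g \<longleftrightarrow> f = g"
  by (metis fapp_lin)

lemma yoneda_vect:
  assumes V: "V \<in> vect K" and W: "W \<in> vect K" shows "obj (yoneda K V) W \<in> vect K"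
proof -
  have "module K (hom_module K V W)"
    unfolding hom_module_def
  proof (rule module_power_submodule[OF vect_module[OF W]])
    show "lin K V W \<subseteq> carrier V \<rightarrow>\<^sub>E carrier W"
      by (intro subsetI) (simp add: PiE_iff)
  qed (use V W in \<open>auto intro: lin_zero_map lin_add_map lin_smult_map\<close>)
  then have "module K (obj (yoneda K V) W)"
    unfolding yoneda_def vfunctor.simps
    by (rule module_coded[OF vect_small[OF V]]) (use lin_ext in auto)
  moreover have "small (carrier (obj (yoneda K V) W))"
    unfolding carrier_yoneda by (rule small_fcode[OF vect_small[OF V] vect_small[OF W]]) auto
  ultimately show ?thesis by (simp add: vect_def)
qed

lemma yoneda_additive [simp]:
  assumes V: "V \<in> vect K" shows "additive_functor K (yoneda K V)"
  unfolding additive_functor_def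
proof (intro conjI ballI)
  fix W assume W: "W \<in> vect K"
  show "obj (yoneda K V) W \<in> vect K" by (rule yoneda_vect[OF V W])
  show "arr (yoneda K V) W W (\<lambda>v\<in>carrier W. v) = (\<lambda>x\<in>carrier (obj (yoneda K V) W). x)"
    by (rule extensionalityI[OF arr_yoneda_ext]) (use V in \<open>auto simp: Id_compose Pi_def\<close>)
next
  fix U W T f g
  assume U: "U \<in> vect K" "W \<in> vect K" "T \<in> vect K" and f: "f \<in> lin K U W" and g: "g \<in> lin K W T"
  show "arr (yoneda K V) U T (compose (carrier U) g f) =
    compose (carrier (obj (yoneda K V) U)) (arr (yoneda K V) W T g) (arr (yoneda K V) U W f)"
  proof (rule extensionalityI[OF arr_yoneda_ext])
    fix x assume "x \<in> carrier (obj (yoneda K V) U)"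
    then obtain h where h: "h \<in> lin K V U" "x = fcode (carrier V) h" by auto
    have "compose (carrier V) (compose (carrier U) g f) h = compose (carrier V) g (compose (carrier V) f h)"
      using h by (auto simp: compose_def)
    with h V U f show "arr (yoneda K V) U T (compose (carrier U) g f) x =
      compose (carrier (obj (yoneda K V) U)) (arr (yoneda K V) W T g) (arr (yoneda K V) U W f) x"
      by (simp add: compose_eq lin_compose[OF V h(1) f])
  qed simp
next
  fix U W assume U: "U \<in> vect K" and W: "W \<in> vect K"
  note [simp] = lin_compose[OF V] lin_add_map[OF V W] lin_smult_map[OF V W] lin_add_map[OF V U] lin_smult_map[OF V U]
  interpret W: module K W by (rule vect_module[OF W])
  show "linear_map K (hom_module K U W) (hom_module K (obj (yoneda K V) U) (obj (yoneda K V) W))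
     (arr (yoneda K V) U W)"
    unfolding linear_map_def hom_module_simps
  proof (intro conjI ballI funcsetI)
    fix f assume f: "f \<in> lin K U W"
    show "arr (yoneda K V) U W f \<in> lin K (obj (yoneda K V) U) (obj (yoneda K V) W)"
    proof (rule linI[OF arr_yoneda_ext])
      fix x y assume "x \<in> carrier (obj (yoneda K V) U)" "y \<in> carrier (obj (yoneda K V) U)"
      then obtain a b where ab: "a \<in> lin K V U" "b \<in> lin K V U" "x = fcode (carrier V) a" "y = fcode (carrier V) b"
        by auto
      have "compose (carrier V) f (\<lambda>v\<in>carrier V. a v \<oplus>\<^bsub>U\<^esub> b v) =
        (\<lambda>v\<in>carrier V. compose (carrier V) f a v \<oplus>\<^bsub>W\<^esub> compose (carrier V) f b v)"
        using ab f by (auto simp: compose_def lin_add[OF f])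
      with ab f V show "arr (yoneda K V) U W f (x \<oplus>\<^bsub>obj (yoneda K V) U\<^esub> y) =
        arr (yoneda K V) U W f x \<oplus>\<^bsub>obj (yoneda K V) W\<^esub> arr (yoneda K V) U W f y"
        by simp
    next
      fix c x assume c: "c \<in> carrier K" "x \<in> carrier (obj (yoneda K V) U)"
      then obtain a where ab: "a \<in> lin K V U" "x = fcode (carrier V) a"
        by auto
      have "compose (carrier V) f (\<lambda>v\<in>carrier V. c \<odot>\<^bsub>U\<^esub> a v) =
        (\<lambda>v\<in>carrier V. c \<odot>\<^bsub>W\<^esub> compose (carrier V) f a v)"
        using ab f c by (auto simp: compose_def lin_smult[OF f])
      with ab f V c show "arr (yoneda K V) U W f (c \<odot>\<^bsub>obj (yoneda K V) U\<^esub> x) =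
        c \<odot>\<^bsub>obj (yoneda K V) W\<^esub> arr (yoneda K V) U W f x"
        by simp
    qed (use V f in auto)
  next
    fix f g assume f: "f \<in> lin K U W" and g: "g \<in> lin K U W"
    show "arr (yoneda K V) U W (\<lambda>v\<in>carrier U. f v \<oplus>\<^bsub>W\<^esub> g v) =
      (\<lambda>v\<in>carrier (obj (yoneda K V) U). arr (yoneda K V) U W f v \<oplus>\<^bsub>obj (yoneda K V) W\<^esub> arr (yoneda K V) U W g v)"
    proof (rule extensionalityI[OF arr_yoneda_ext])
      fix x assume "x \<in> carrier (obj (yoneda K V) U)"
      then obtain a where ab: "a \<in> lin K V U" "x = fcode (carrier V) a" by auto
      have "compose (carrier V) (\<lambda>v\<in>carrier U. f v \<oplus>\<^bsub>W\<^esub> g v) a =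
        (\<lambda>v\<in>carrier V. compose (carrier V) f a v \<oplus>\<^bsub>W\<^esub> compose (carrier V) g a v)"
        using ab by (auto simp: compose_def)
      with ab f g V show "arr (yoneda K V) U W (\<lambda>v\<in>carrier U. f v \<oplus>\<^bsub>W\<^esub> g v) x =
        (\<lambda>v\<in>carrier (obj (yoneda K V) U). arr (yoneda K V) U W f v \<oplus>\<^bsub>obj (yoneda K V) W\<^esub> arr (yoneda K V) U W g v) x"
        by simp
    qed simp
  next
    fix c f assume c: "c \<in> carrier K" and f: "f \<in> lin K U W"
    show "arr (yoneda K V) U W (\<lambda>v\<in>carrier U. c \<odot>\<^bsub>W\<^esub> f v) =
      (\<lambda>v\<in>carrier (obj (yoneda K V) U). c \<odot>\<^bsub>obj (yoneda K V) W\<^esub> arr (yoneda K V) U W f v)"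
    proof (rule extensionalityI[OF arr_yoneda_ext])
      fix x assume "x \<in> carrier (obj (yoneda K V) U)"
      then obtain a where ab: "a \<in> lin K V U" "x = fcode (carrier V) a" by auto
      have "compose (carrier V) (\<lambda>v\<in>carrier U. c \<odot>\<^bsub>W\<^esub> f v) a =
        (\<lambda>v\<in>carrier V. c \<odot>\<^bsub>W\<^esub> compose (carrier V) f a v)"
        using ab by (auto simp: compose_def)
      with ab f c V show "arr (yoneda K V) U W (\<lambda>v\<in>carrier U. c \<odot>\<^bsub>W\<^esub> f v) x =
        (\<lambda>v\<in>carrier (obj (yoneda K V) U). c \<odot>\<^bsub>obj (yoneda K V) W\<^esub> arr (yoneda K V) U W f v) x"
        by simp
    qed simp
  qed
qed

text \<open>One direction of the Yoneda correspondence: the transformation out of the representable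
  of \<open>V\<close> that is classified by the element \<open>x\<close> of
  \<open>X V\<close>.\<close>

definition yo :: "'u vfunctor \<Rightarrow> ('u, 'u) module \<Rightarrow> 'u \<Rightarrow> ('u, 'u) module \<Rightarrow> 'u \<Rightarrow> 'u" where
  "yo X V x = (\<lambda>W\<in>vect K. \<lambda>a\<in>carrier (obj (yoneda K V) W). arr X V W (fapp (carrier V) a) x)"

lemma yo_apply [simp]:
  "V \<in> vect K \<Longrightarrow> W \<in> vect K \<Longrightarrow> f \<in> lin K V W \<Longrightarrow> yo X V x W (fcode (carrier V) f) = arr X V W f x"
  by (simp add: yo_def)

lemma yo_nat_trans:
  assumes X: "additive_functor K X" and V: "V \<in> vect K" and x: "x \<in> carrier (obj X V)"
  shows "yo X V x \<in> nat_trans K (yoneda K V) X"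
  unfolding yo_def
proof (rule nat_transI)
  note [simp] = lin_add_map[OF V] lin_smult_map[OF V] lin_compose[OF V]
    fapp_lin[OF V lin_smult_map[OF V]] fapp_lin[OF V lin_add_map[OF V]] fapp_lin[OF V lin_compose[OF V]]
  show "vect_valued (yoneda K V)" using V by (simp add: additive_valued)
  fix W a assume W: "W \<in> vect K" and "a \<in> carrier (obj (yoneda K V) W)"
  then obtain f where f: "f \<in> lin K V W" "a = fcode (carrier V) f" by auto
  then show "arr X V W (fapp (carrier V) a) x \<in> carrier (obj X W)" using assms W by simp
  show "arr X V W (fapp (carrier V) (c \<odot>\<^bsub>obj (yoneda K V) W\<^esub> a)) x =
      c \<odot>\<^bsub>obj X W\<^esub> arr X V W (fapp (carrier V) a) x" if c: "c \<in> carrier K" for c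
    using f c V W x by (simp add: additive_smult[OF X V W f(1) c])
  show "arr X V W (fapp (carrier V) (a \<oplus>\<^bsub>obj (yoneda K V) W\<^esub> b)) x =
      arr X V W (fapp (carrier V) a) x \<oplus>\<^bsub>obj X W\<^esub> arr X V W (fapp (carrier V) b) x"
    if b: "b \<in> carrier (obj (yoneda K V) W)" for b
  proof -
    obtain g where g: "g \<in> lin K V W" "b = fcode (carrier V) g" using b by auto
    show ?thesis using f g V W x by (simp add: additive_add[OF X V W f(1) g(1)])
  qed
  show "arr X V T (fapp (carrier V) (arr (yoneda K V) W T g a)) x =
       arr X W T g (arr X V W (fapp (carrier V) a) x)"
    if T: "T \<in> vect K" and g: "g \<in> lin K W T" for T g
    using f g V W x T by (simp, intro additive_comp[OF X V W T f(1) g, symmetric]) (auto simp: compose_eq)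
qed

text \<open>The other direction: naturality along \<open>f\<close>, applied to the identity of
  \<open>V\<close>, shows that a transformation is determined by its value there.\<close>

lemma yoneda_nat_trans_eq:
  assumes "V \<in> vect K" "W \<in> vect K" "\<eta> \<in> nat_trans K (yoneda K V) X" "f \<in> lin K V W"
  shows "\<eta> W (fcode (carrier V) f) = arr X V W f (\<eta> V (fcode (carrier V) (\<lambda>v\<in>carrier V. v)))"
proof -
  have "compose (carrier V) f (\<lambda>v\<in>carrier V. v) = f"
    using assms by (auto intro: compose_Id)
  then show ?thesis
    using nt_nat[OF assms(3,1,2,4), of "fcode (carrier V) (\<lambda>v\<in>carrier V. v)"] assms
    by (simp add: lin_id)
qed

lemma yo_eqI:
  assumes "V \<in> vect K" "\<eta> \<in> nat_trans K (yoneda K V) X" "\<zeta> \<in> nat_trans K (yoneda K V) X"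
    and "\<eta> V (fcode (carrier V) (\<lambda>v\<in>carrier V. v)) = \<zeta> V (fcode (carrier V) (\<lambda>v\<in>carrier V. v))"
  shows "\<eta> = \<zeta>"
  by (rule nt_eqI[OF assms(2,3)])
    (use assms in \<open>auto simp: yoneda_nat_trans_eq[OF assms(1) _ assms(2)] yoneda_nat_trans_eq[OF assms(1) _ assms(3)]\<close>)

section \<open>Strong spaces\<close>

text \<open>Injectivity of the linear map from \<open>X (free I)\<close> to the
  \<open>I\<close>-fold power of \<open>X line\<close> given by the coordinates, stated as
  triviality of its kernel because this form matches quotients and kernels directly.\<close>

definition separated :: "'u vfunctor \<Rightarrow> bool" where
  "separated X \<longleftrightarrow> additive_functor K X \<and>
     (\<forall>I. small I \<longrightarrow> (\<forall>x\<in>carrier (obj X (free I)).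
        (\<forall>i\<in>I. arr X (free I) line (coord K I i) x = \<zero>\<^bsub>obj X line\<^esub>) \<longrightarrow> x = \<zero>\<^bsub>obj X (free I)\<^esub>))"

lemma separated_additive: "separated X \<Longrightarrow> additive_functor K X"
  by (simp add: separated_def)

lemma separated_zeroI:
  "separated X \<Longrightarrow> small I \<Longrightarrow> x \<in> carrier (obj X (free I)) \<Longrightarrow>
    (\<And>i. i \<in> I \<Longrightarrow> arr X (free I) line (coord K I i) x = \<zero>\<^bsub>obj X line\<^esub>) \<Longrightarrow> x = \<zero>\<^bsub>obj X (free I)\<^esub>"
  by (simp add: separated_def)

lemma separated_eqI:
  assumes X: "separated X" and I: "small I"
    and x: "x \<in> carrier (obj X (free I))" and y: "y \<in> carrier (obj X (free I))"
    and eq: "\<And>i. i \<in> I \<Longrightarrow> arr X (free I) line (coord K I i) x = arr X (free I) line (coord K I i) y"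
  shows "x = y"
proof -
  have X': "additive_functor K X" by (rule separated_additive[OF X])
  have F: "obj X (free I) \<in> vect K" "obj X line \<in> vect K" using X' I by simp_all
  have "x \<ominus>\<^bsub>obj X (free I)\<^esub> y = \<zero>\<^bsub>obj X (free I)\<^esub>"
  proof (rule separated_zeroI[OF X I])
    show "x \<ominus>\<^bsub>obj X (free I)\<^esub> y \<in> carrier (obj X (free I))" using F x y by simp
    fix i assume i: "i \<in> I"
    have c: "arr X (free I) line (coord K I i) \<in> lin K (obj X (free I)) (obj X line)"
      using X' I i by simp
    show "arr X (free I) line (coord K I i) (x \<ominus>\<^bsub>obj X (free I)\<^esub> y) = \<zero>\<^bsub>obj X line\<^esub>"
      using lin_minus[OF c F x y] eq[OF i] lin_closed[OF c y] F by (simp add: vect_minus_eq_zero_iff)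
  qed
  with F x y show ?thesis by (simp add: vect_minus_eq_zero_iff)
qed

text \<open>Coordinates determine the element witnessing summability, hence the sum. For
  concreteness, \<open>V\<close> is embedded as a retract in a free space, and the coordinates there
  are values of transformations at \<open>line\<close>.\<close>

lemma separated_strong:
  assumes X: "separated X" shows "strong_space K X"
  unfolding strong_space_def
proof (intro conjI)
  show X': "additive_functor K X" by (rule separated_additive[OF X])
  show "unique_sums K X"
    unfolding unique_sums_def
  proof (intro allI impI ballI)
    fix I f assume I: "small I" and f: "f \<in> I \<rightarrow> carrier (obj X line)" and "summable_family K X I f"
    then obtain x where x: "x \<in> carrier (obj X (free I))"
      "\<And>i. i \<in> I \<Longrightarrow> arr X (free I) line (coord K I i) x = f i" by (auto simp: summable_family_def)
    have "y = x" if "y \<in> carrier (obj X (free I))"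
      "\<forall>i\<in>I. arr X (free I) line (coord K I i) y = f i" for y
      by (rule separated_eqI[OF X I that(1) x(1)]) (use that x in simp)
    with x show "\<exists>!s. is_sum K X I f s" unfolding is_sum_def by metis
  qed
  show "concrete K X"
    unfolding concrete_def
  proof (intro ballI iffI)
    fix V f g assume V: "V \<in> vect K" and f: "f \<in> nat_trans K (yoneda K V) X"
      and g: "g \<in> nat_trans K (yoneda K V) X" and eq: "f line = g line"
    obtain I s r where I: "small I" and s: "s \<in> lin K V (free I)" and r: "r \<in> lin K (free I) V"
      and rs: "\<And>v. v \<in> carrier V \<Longrightarrow> r (s v) = v"
      by (rule free_retract[OF V]) (rule that)
    let ?id = "fcode (carrier V) (\<lambda>v\<in>carrier V. v)"
    have id: "?id \<in> carrier (obj (yoneda K V) V)" using lin_id[OF V] by simp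
    \<comment> \<open>The classifying elements are moved to \<open>free I\<close> by
      \<open>s\<close>. Their coordinates are the values of \<open>f\<close> and \<open>g\<close> at
      the functionals \<open>coord K I i\<close> after \<open>s\<close>, and at \<open>line\<close>
      the two transformations agree.\<close>
    have "arr X V (free I) s (f V ?id) = arr X V (free I) s (g V ?id)"
    proof (rule separated_eqI[OF X I])
      fix i assume i: "i \<in> I"
      let ?h = "compose (carrier V) (coord K I i) s"
      have h: "?h \<in> lin K V line" by (rule lin_compose[OF V s]) (simp add: I i)
      have "arr X (free I) line (coord K I i) (arr X V (free I) s (e V ?id)) = e line (fcode (carrier V) ?h)"
        if e: "e \<in> nat_trans K (yoneda K V) X" for e
        using additive_comp[OF X' V free_vect[OF I] line_vect s coord_lin[OF I i] h compose_eq nt_closed[OF e V id]]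
          yoneda_nat_trans_eq[OF V line_vect e h] by simp
      with f g eq show "arr X (free I) line (coord K I i) (arr X V (free I) s (f V ?id)) =
        arr X (free I) line (coord K I i) (arr X V (free I) s (g V ?id))" by simp
    qed (rule additive_closed[OF X' V free_vect[OF I] s nt_closed[OF f V id]]
        additive_closed[OF X' V free_vect[OF I] s nt_closed[OF g V id]])+
    then have "arr X (free I) V r (arr X V (free I) s (f V ?id)) = arr X (free I) V r (arr X V (free I) s (g V ?id))"
      by simp
    moreover have "arr X (free I) V r (arr X V (free I) s x) = x" if "x \<in> carrier (obj X V)" for x
      using additive_comp[OF X' V free_vect[OF I] V s r lin_id[OF V] _ that]
        additive_id[OF X' V lin_id[OF V] _ that] rs by simp
    ultimately have "f V ?id = g V ?id"
      using nt_closed[OF f V id] nt_closed[OF g V id] by simp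
    then show "f = g" by (rule yo_eqI[OF V f g])
  qed simp
qed

text \<open>Every functional on \<open>free I\<close> is \<open>\<sigma>\<close> after a diagonal map, so that uniqueness of the sums of
  the zero family forces all functionals to kill an element with vanishing coordinates;
  concreteness then makes that element vanish.\<close>

lemma strong_separated:
  assumes X: "strong_space K X" shows "separated X"
  unfolding separated_def
proof (intro conjI allI impI ballI)
  show X': "additive_functor K X" using X by (simp add: strong_space_def)
  fix I x assume I: "small I" and x: "x \<in> carrier (obj X (free I))"
    and zero: "\<forall>i\<in>I. arr X (free I) line (coord K I i) x = \<zero>\<^bsub>obj X line\<^esub>"
  note F = free_vect[OF I]
  let ?o = "\<zero>\<^bsub>obj X (free I)\<^esub>"
  have o: "?o \<in> carrier (obj X (free I))" using X' F by simp
  have arr0: "arr X V W f \<zero>\<^bsub>obj X V\<^esub> = \<zero>\<^bsub>obj X W\<^esub>"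
    if "V \<in> vect K" "W \<in> vect K" "f \<in> lin K V W" for V W f
    using that X' by (simp add: lin_0[OF additive_lin])
  have kill: "arr X (free I) line \<phi> x = \<zero>\<^bsub>obj X line\<^esub>" if \<phi>: "\<phi> \<in> lin K (free I) line" for \<phi>
  proof -
    let ?c = "\<lambda>i. \<phi> (basis_map I i \<one>\<^bsub>K\<^esub>)"
    have c: "?c i \<in> carrier K" if "i \<in> I" for i
      using that lin_closed[OF \<phi>, of "basis_map I i \<one>\<^bsub>K\<^esub>"] I by simp
    \<comment> \<open>The diagonal map multiplying coordinate \<open>i\<close> by the value of
      \<open>\<phi>\<close> on the basis vector at \<open>i\<close>; adding up the coordinates
      afterwards computes \<open>\<phi>\<close>.\<close>
    define T where "T = reindex I I I (\<lambda>i. i) ?c"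
    have T: "T \<in> lin K (free I) (free I)"
      and fT: "\<And>v i. v \<in> carrier (free I) \<Longrightarrow> i \<in> I \<Longrightarrow> fapp I (T v) i = ?c i \<otimes>\<^bsub>K\<^esub> fapp I v i"
      using reindex[OF I I order_refl, of "\<lambda>i. i" ?c] c by (auto simp: T_def)
    interpret cring K by (rule cring_K)
    have \<sigma>T: "compose (carrier (free I)) (sum_functional K I) T = \<phi>"
    proof (rule free_lin_eqI[OF I line_vect lin_compose[OF F T sum_functional_lin[OF I]] \<phi>])
      fix i d assume i: "i \<in> I" and d: "d \<in> carrier K"
      have "T (basis_map I i d) = basis_map I i (?c i \<otimes>\<^bsub>K\<^esub> d)"
        by (rule free_eqI[OF I]) (use i d I c T fT in \<open>auto intro: lin_closed[OF T]\<close>)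
      moreover have "basis_map I i d = d \<odot>\<^bsub>free I\<^esub> basis_map I i \<one>\<^bsub>K\<^esub>"
        by (rule free_eqI[OF I]) (use i d I F in auto)
      then have "\<phi> (basis_map I i d) = ?c i \<otimes>\<^bsub>K\<^esub> d"
        using lin_smult[OF \<phi> d, of "basis_map I i \<one>\<^bsub>K\<^esub>"] i I d c by (simp add: m_comm)
      ultimately show "compose (carrier (free I)) (sum_functional K I) T (basis_map I i d) = \<phi> (basis_map I i d)"
        using i d I c by (simp add: compose_eq)
    qed
    let ?y = "arr X (free I) (free I) T x"
    have y: "?y \<in> carrier (obj X (free I))" by (rule additive_closed[OF X' F F T x])
    have y0: "arr X (free I) line (coord K I i) ?y = \<zero>\<^bsub>obj X line\<^esub>" if i: "i \<in> I" for i
    proof -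
      let ?h = "\<lambda>v\<in>carrier (free I). ?c i \<odot>\<^bsub>line\<^esub> coord K I i v"
      have h: "?h \<in> lin K (free I) line"
        by (rule lin_smult_map[OF F line_vect coord_lin[OF I i] c[OF i]])
      have "arr X (free I) line (coord K I i) ?y = arr X (free I) line ?h x"
        by (rule additive_comp[OF X' F F line_vect T coord_lin[OF I i] h _ x])
          (use fT i I T in \<open>auto simp: lin_closed[OF T]\<close>)
      also have "\<dots> = ?c i \<odot>\<^bsub>obj X line\<^esub> arr X (free I) line (coord K I i) x"
        by (rule additive_smult[OF X' F line_vect coord_lin[OF I i] c[OF i] h _ x]) simp
      also have "\<dots> = \<zero>\<^bsub>obj X line\<^esub>"
        using zero i c[OF i] X' by (simp add: module.smult_r_null[OF vect_module])
      finally show ?thesis .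
    qed
    let ?z = "\<lambda>_. \<zero>\<^bsub>obj X line\<^esub>"
    \<comment> \<open>Both \<open>?y\<close> and the zero element have vanishing coordinates, so
      their sums are sums of the same zero family.\<close>
    have "is_sum K X I ?z (arr X (free I) line (sum_functional K I) ?y)"
      unfolding is_sum_def using y y0 by blast
    moreover have s0: "is_sum K X I ?z \<zero>\<^bsub>obj X line\<^esub>"
      unfolding is_sum_def by (rule bexI[OF _ o]) (use arr0[OF F line_vect] I in auto)
    moreover have "\<exists>!s. is_sum K X I ?z s"
    proof -
      have "?z \<in> I \<rightarrow> carrier (obj X line)" using X' by simp
      moreover have "summable_family K X I ?z"
        using s0 unfolding is_sum_def summable_family_def by blast
      ultimately show ?thesis using X I unfolding strong_space_def unique_sums_def by blast
    qed
    ultimately have "arr X (free I) line (sum_functional K I) ?y = \<zero>\<^bsub>obj X line\<^esub>" by blast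
    moreover have "arr X (free I) line (sum_functional K I) ?y = arr X (free I) line \<phi> x"
      by (rule additive_comp[OF X' F F line_vect T sum_functional_lin[OF I] \<phi> _ x])
        (simp add: \<sigma>T[symmetric] compose_eq)
    ultimately show ?thesis by simp
  qed
  let ?f = "yo X (free I) x" and ?g = "yo X (free I) ?o"
  have fg: "?f \<in> nat_trans K (yoneda K (free I)) X" "?g \<in> nat_trans K (yoneda K (free I)) X"
    using yo_nat_trans[OF X' F x] yo_nat_trans[OF X' F o] .
  \<comment> \<open>Elements of the representable at \<open>line\<close> are functionals on
    \<open>free I\<close>, and all of these kill \<open>x\<close>.\<close>
  have "?f line = ?g line"
    by (rule lin_eqI[OF nt_lin[OF fg(1) line_vect] nt_lin[OF fg(2) line_vect]])
      (use F kill arr0[OF F line_vect] in auto)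
  then have "?f = ?g" using X F fg unfolding strong_space_def concrete_def by blast
  then have "?f (free I) (fcode (carrier (free I)) (\<lambda>v\<in>carrier (free I). v)) =
    ?g (free I) (fcode (carrier (free I)) (\<lambda>v\<in>carrier (free I). v))" by simp
  then show "x = ?o"
    using F lin_id[OF F] additive_id[OF X' F lin_id[OF F] _ x] additive_id[OF X' F lin_id[OF F] _ o] by simp
qed

text \<open>A linear map into \<open>free I\<close> is determined by its coordinates. Representables
  are therefore strong and can serve as test objects for monomorphisms among strong spaces.\<close>

lemma yoneda_separated:
  assumes V: "V \<in> vect K" shows "separated (yoneda K V)"
  unfolding separated_def
proof (intro conjI allI impI ballI)
  show "additive_functor K (yoneda K V)" by (rule yoneda_additive[OF V])
  fix I x assume I: "small I" and "x \<in> carrier (obj (yoneda K V) (free I))"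
    and zero: "\<forall>i\<in>I. arr (yoneda K V) (free I) line (coord K I i) x = \<zero>\<^bsub>obj (yoneda K V) line\<^esub>"
  then obtain f where f: "f \<in> lin K V (free I)" "x = fcode (carrier V) f" by auto
  note F = free_vect[OF I]
  have 0: "(\<lambda>v\<in>carrier V. \<zero>\<^bsub>W\<^esub>) \<in> lin K V W" if "W \<in> vect K" for W by (rule lin_zero_map[OF V that])
  have "f v = \<zero>\<^bsub>free I\<^esub>" if v: "v \<in> carrier V" for v
  proof (rule free_eqI[OF I])
    fix i assume i: "i \<in> I"
    have h: "compose (carrier V) (coord K I i) f \<in> lin K V line"
      by (rule lin_compose[OF V f(1) coord_lin[OF I i]])
    have "compose (carrier V) (coord K I i) f = (\<lambda>v\<in>carrier V. \<zero>\<^bsub>line\<^esub>)"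
      using bspec[OF zero i] f V yoneda_ops(1)[OF V 0[OF line_vect]] h 0[OF line_vect]
        fcode_lin_inject[OF V h 0[OF line_vect]] by (simp del: fcode_lin_inject)
    from fun_cong[OF this, of v] v show "fapp I (f v) i = fapp I \<zero>\<^bsub>free I\<^esub> i"
      using i I lin_closed[OF f(1) v] by (simp add: compose_eq)
  qed (use v F lin_closed[OF f(1) v] in auto)
  then have "f = (\<lambda>v\<in>carrier V. \<zero>\<^bsub>free I\<^esub>)"
    by (intro lin_eqI[OF f(1) 0[OF F]]) simp
  then show "x = \<zero>\<^bsub>obj (yoneda K V) (free I)\<^esub>"
    using f yoneda_ops(1)[OF V f(1)] by simp
qed

text \<open>Elements of \<open>X V\<close> are transformations out of the representable of
  \<open>V\<close>, which is itself strong. Cancelling \<open>m\<close> after such transformations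
  is injectivity on elements.\<close>

lemma strong_mono_injective:
  assumes m: "mono_in K (strong_space K) X Y m" and V: "V \<in> vect K"
  shows "inj_on (m V) (carrier (obj X V))"
proof (rule inj_onI)
  fix x x' assume x: "x \<in> carrier (obj X V)" and x': "x' \<in> carrier (obj X V)" and eq: "m V x = m V x'"
  have X: "additive_functor K X" and nt: "m \<in> nat_trans K X Y"
    using m by (auto simp: mono_in_def strong_space_def)
  have f: "yo X V x \<in> nat_trans K (yoneda K V) X" and f': "yo X V x' \<in> nat_trans K (yoneda K V) X"
    using yo_nat_trans[OF X V] x x' by auto
  let ?Z = "yoneda K V"
  have Z: "vect_valued ?Z" by (rule additive_valued[OF yoneda_additive[OF V]])
  have "nt_comp K ?Z m (yo X V x) = nt_comp K ?Z m (yo X V x')"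
  proof (rule nt_eqI[OF nt_comp_nat_trans[OF Z f nt] nt_comp_nat_trans[OF Z f' nt]])
    fix W a assume W: "W \<in> vect K" and a: "a \<in> carrier (obj ?Z W)"
    then obtain h where h: "h \<in> lin K V W" "a = fcode (carrier V) h" by auto
    have "m W (yo X V x W a) = m W (yo X V x' W a)"
      using h V W eq nt_nat[OF nt V W h(1)] x x' by simp
    with W a show "nt_comp K ?Z m (yo X V x) W a = nt_comp K ?Z m (yo X V x') W a"
      by (simp only: nt_comp_apply)
  qed
  then have "yo X V x = yo X V x'"
    using m f f' separated_strong[OF yoneda_separated[OF V]] unfolding mono_in_def by blast
  then have "yo X V x V (fcode (carrier V) (\<lambda>v\<in>carrier V. v)) = yo X V x' V (fcode (carrier V) (\<lambda>v\<in>carrier V. v))"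
    by simp
  then show "x = x'"
    using V lin_id[OF V] additive_id[OF X V lin_id[OF V] _ x] additive_id[OF X V lin_id[OF V] _ x'] by simp
qed

end

section \<open>Directed systems of generators\<close>

text \<open>A presentation of \<open>X\<close> as a directed colimit of the representables of the
  spaces \<open>G j\<close>, in terms of elements: \<open>gen j\<close> classifies the leg at
  \<open>j\<close>, \<open>generate\<close> says that the legs are jointly onto, and
  \<open>relation\<close> that whatever becomes zero in \<open>X\<close> is already zero at a later
  stage. The maps \<open>\<tau> i j\<close> run against the order because representables are
  contravariant in the representing space. The indices may have any type, and \<open>code\<close>
  moves them into the universe.\<close>

locale generating_system = small_vect +
  fixes X :: "'a vfunctor" and J :: "'i set" and le :: "'i \<Rightarrow> 'i \<Rightarrow> bool" and code :: "'i \<Rightarrow> 'a"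
    and G :: "'i \<Rightarrow> ('a, 'a) module" and \<tau> :: "'i \<Rightarrow> 'i \<Rightarrow> 'a \<Rightarrow> 'a" and gen :: "'i \<Rightarrow> 'a"
  assumes X: "additive_functor K X" and code: "inj_on code J" "small (code ` J)" and J: "J \<noteq> {}"
    and le_refl: "j \<in> J \<Longrightarrow> le j j"
    and le_antisym: "i \<in> J \<Longrightarrow> j \<in> J \<Longrightarrow> le i j \<Longrightarrow> le j i \<Longrightarrow> i = j"
    and le_trans: "i \<in> J \<Longrightarrow> j \<in> J \<Longrightarrow> k \<in> J \<Longrightarrow> le i j \<Longrightarrow> le j k \<Longrightarrow> le i k"
    and directed: "i \<in> J \<Longrightarrow> j \<in> J \<Longrightarrow> \<exists>k\<in>J. le i k \<and> le j k"
    and G: "j \<in> J \<Longrightarrow> G j \<in> vect K"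
    and \<tau>: "i \<in> J \<Longrightarrow> j \<in> J \<Longrightarrow> le i j \<Longrightarrow> \<tau> i j \<in> lin K (G j) (G i)"
    and \<tau>_id: "j \<in> J \<Longrightarrow> v \<in> carrier (G j) \<Longrightarrow> \<tau> j j v = v"
    and \<tau>_comp: "i \<in> J \<Longrightarrow> j \<in> J \<Longrightarrow> k \<in> J \<Longrightarrow> le i j \<Longrightarrow> le j k \<Longrightarrow> v \<in> carrier (G k) \<Longrightarrow>
      \<tau> i j (\<tau> j k v) = \<tau> i k v"
    and gen: "j \<in> J \<Longrightarrow> gen j \<in> carrier (obj X (G j))"
    and gen_\<tau>: "i \<in> J \<Longrightarrow> j \<in> J \<Longrightarrow> le i j \<Longrightarrow> arr X (G j) (G i) (\<tau> i j) (gen j) = gen i"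
    and generate: "V \<in> vect K \<Longrightarrow> x \<in> carrier (obj X V) \<Longrightarrow>
      \<exists>j\<in>J. \<exists>h\<in>lin K (G j) V. x = arr X (G j) V h (gen j)"
    and relation: "j \<in> J \<Longrightarrow> V \<in> vect K \<Longrightarrow> h \<in> lin K (G j) V \<Longrightarrow>
      arr X (G j) V h (gen j) = \<zero>\<^bsub>obj X V\<^esub> \<Longrightarrow>
      \<exists>k\<in>J. le j k \<and> (\<forall>v\<in>carrier (G k). h (\<tau> j k v) = \<zero>\<^bsub>V\<^esub>)"
begin

text \<open>The map \<open>\<tau> i j\<close>, read as an element of the representable of
  \<open>G j\<close> at \<open>G i\<close>; the transformation it classifies is precomposition with
  \<open>\<tau> i j\<close>, and it runs in the direction of the order.\<close>

definition trn :: "'i \<Rightarrow> 'i \<Rightarrow> ('a, 'a) module \<Rightarrow> 'a \<Rightarrow> 'a" where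
  "trn i j = yo (yoneda K (G j)) (G i) (fcode (carrier (G j)) (\<tau> i j))"

definition leg :: "'i \<Rightarrow> ('a, 'a) module \<Rightarrow> 'a \<Rightarrow> 'a" where
  "leg j = yo X (G j) (gen j)"

definition dec :: "'a \<Rightarrow> 'i" where "dec = inv_into J code"

definition idx :: "'a rel" where
  "idx = {(code i, code j) | i j. i \<in> J \<and> j \<in> J \<and> le i j}"

abbreviation pull :: "'i \<Rightarrow> 'i \<Rightarrow> ('a \<Rightarrow> 'a) \<Rightarrow> 'a \<Rightarrow> 'a" where
  "pull i j h \<equiv> compose (carrier (G j)) h (\<tau> i j)"

lemma dec_code [simp]: "j \<in> J \<Longrightarrow> dec (code j) = j"
  using code by (simp add: dec_def)

lemma trn_nat_trans: "i \<in> J \<Longrightarrow> j \<in> J \<Longrightarrow> le i j \<Longrightarrow> trn i j \<in> nat_trans K (yoneda K (G i)) (yoneda K (G j))"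
  unfolding trn_def by (rule yo_nat_trans) (use G \<tau> in auto)

lemma leg_nat_trans: "j \<in> J \<Longrightarrow> leg j \<in> nat_trans K (yoneda K (G j)) X"
  unfolding leg_def by (rule yo_nat_trans[OF X G gen])

lemma pull_lin:
  "i \<in> J \<Longrightarrow> j \<in> J \<Longrightarrow> le i j \<Longrightarrow> h \<in> lin K (G i) V \<Longrightarrow> pull i j h \<in> lin K (G j) V"
  by (rule lin_compose[OF G \<tau>])

lemma trn_apply:
  "i \<in> J \<Longrightarrow> j \<in> J \<Longrightarrow> le i j \<Longrightarrow> V \<in> vect K \<Longrightarrow> h \<in> lin K (G i) V \<Longrightarrow>
    trn i j V (fcode (carrier (G i)) h) = fcode (carrier (G j)) (pull i j h)"
  unfolding trn_def by (simp add: G \<tau>)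

lemma leg_apply:
  "j \<in> J \<Longrightarrow> V \<in> vect K \<Longrightarrow> h \<in> lin K (G j) V \<Longrightarrow>
    leg j V (fcode (carrier (G j)) h) = arr X (G j) V h (gen j)"
  unfolding leg_def by (simp add: G)

lemma arr_pull:
  assumes "i \<in> J" "j \<in> J" "le i j" "V \<in> vect K" "h \<in> lin K (G i) V"
  shows "arr X (G j) V (pull i j h) (gen j) = arr X (G i) V h (gen i)"
  using additive_comp[OF X G G assms(4) \<tau> assms(5) pull_lin compose_eq gen] assms gen_\<tau> by metis

lemma directed_poset_idx: "directed_poset (code ` J) idx"
proof -
  have "refl_on (code ` J) idx" using le_refl by (auto simp: refl_on_def idx_def)
  moreover have "idx \<subseteq> code ` J \<times> code ` J" by (auto simp: idx_def)
  moreover have "trans idx"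
  proof (rule transI)
    fix x y z assume "(x, y) \<in> idx" "(y, z) \<in> idx"
    then obtain i j j' k where *: "i \<in> J" "j \<in> J" "le i j" "j' \<in> J" "k \<in> J" "le j' k" "code j = code j'"
      "x = code i" "z = code k" by (auto simp: idx_def)
    then have "j' = j" using code(1) by (auto dest: inj_onD)
    with * show "(x, z) \<in> idx" unfolding idx_def using le_trans by blast
  qed
  moreover have "antisym idx"
  proof (rule antisymI)
    fix x y assume "(x, y) \<in> idx" "(y, x) \<in> idx"
    then obtain i j i' j' where *: "i \<in> J" "j \<in> J" "le i j" "j' \<in> J" "i' \<in> J" "le j' i'" "code j = code j'"
      "code i = code i'" "x = code i" "y = code j" by (auto simp: idx_def)
    then have "j' = j" "i' = i" using code(1) by (auto dest: inj_onD)
    with * le_antisym show "x = y" by blast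
  qed
  ultimately have "partial_order_on (code ` J) idx"
    by (simp add: partial_order_on_def preorder_on_def)
  moreover have "\<exists>k\<in>code ` J. (x, k) \<in> idx \<and> (y, k) \<in> idx" if xy: "x \<in> code ` J" "y \<in> code ` J" for x y
  proof -
    obtain i j where ij: "i \<in> J" "j \<in> J" "x = code i" "y = code j" using xy by blast
    then obtain k where "k \<in> J" "le i k" "le j k" using directed by blast
    with ij show ?thesis by (auto simp: idx_def)
  qed
  ultimately show ?thesis using J by (auto simp: directed_poset_def)
qed

lemma idxE:
  assumes "(x, y) \<in> idx"
  obtains i j where "i \<in> J" "j \<in> J" "le i j" "x = code i" "y = code j"
  using assms by (auto simp: idx_def)

lemma diagram_trn: "diagram K (code ` J) idx (\<lambda>x. yoneda K (G (dec x))) (\<lambda>x y. trn (dec x) (dec y))"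
  unfolding diagram_def
proof (intro conjI ballI impI)
  fix x assume "x \<in> code ` J"
  then obtain i where i: "i \<in> J" "x = code i" by blast
  then show "additive_functor K (yoneda K (G (dec x)))" by (simp add: G)
  have id: "nt_id K (yoneda K (G i)) \<in> nat_trans K (yoneda K (G i)) (yoneda K (G i))"
    unfolding nt_id_def by (rule nat_transI) (use additive_valued[OF yoneda_additive[OF G[OF i(1)]]] in auto)
  have "trn i i = nt_id K (yoneda K (G i))"
  proof (rule nt_eqI[OF trn_nat_trans id])
    fix V a assume V: "V \<in> vect K" and a: "a \<in> carrier (obj (yoneda K (G i)) V)"
    then obtain h where h: "h \<in> lin K (G i) V" "a = fcode (carrier (G i)) h" by auto
    have "pull i i h = h"
      by (rule lin_eqI[OF pull_lin[OF i(1) i(1) le_refl[OF i(1)] h(1)] h(1)]) (use i in \<open>simp add: compose_eq \<tau>_id\<close>)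
    with h V i a show "trn i i V a = nt_id K (yoneda K (G i)) V a"
      by (simp add: trn_apply le_refl nt_id_def)
  qed (use i le_refl in auto)
  with i show "trn (dec x) (dec x) = nt_id K (yoneda K (G (dec x)))" by simp
next
  fix x y assume "(x, y) \<in> idx"
  then show "trn (dec x) (dec y) \<in> nat_trans K (yoneda K (G (dec x))) (yoneda K (G (dec y)))"
    by (elim idxE) (simp add: trn_nat_trans)
next
  fix x y z assume "(x, y) \<in> idx" "(y, z) \<in> idx"
  then obtain i j j' k where *: "i \<in> J" "j \<in> J" "le i j" "j' \<in> J" "k \<in> J" "le j' k" "code j = code j'"
    "x = code i" "y = code j" "z = code k" by (elim idxE) auto
  then have "j' = j" using code(1) by (auto dest: inj_onD)
  with * have jk: "le j k" and ik: "le i k" using le_trans by blast+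
  have "nt_comp K (yoneda K (G i)) (trn j k) (trn i j) = trn i k"
  proof (rule nt_comp_eqI[OF trn_nat_trans[OF *(1,5) ik]])
    fix V a assume V: "V \<in> vect K" and a: "a \<in> carrier (obj (yoneda K (G i)) V)"
    then obtain h where h: "h \<in> lin K (G i) V" "a = fcode (carrier (G i)) h" by auto
    have ph: "pull i j h \<in> lin K (G j) V" by (rule pull_lin[OF *(1-3) h(1)])
    have "pull j k (pull i j h) = pull i k h"
    proof (rule lin_eqI[OF pull_lin[OF *(2,5) jk ph] pull_lin[OF *(1,5) ik h(1)]])
      fix v assume "v \<in> carrier (G k)"
      then show "pull j k (pull i j h) v = pull i k h v"
        using lin_closed[OF \<tau>[OF *(2,5) jk]] \<tau>_comp[OF *(1,2,5,3) jk] by (simp add: compose_eq)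
    qed
    with h V * jk ik ph show "trn j k V (trn i j V a) = trn i k V a" by (simp add: trn_apply)
  qed
  with * \<open>j' = j\<close> show "trn (dec x) (dec z) = nt_comp K (yoneda K (G (dec x))) (trn (dec y) (dec z)) (trn (dec x) (dec y))"
    by simp
qed

lemma cocone_leg:
  "cocone K (code ` J) idx (\<lambda>x. yoneda K (G (dec x))) (\<lambda>x y. trn (dec x) (dec y)) X (\<lambda>x. leg (dec x))"
  unfolding cocone_def
proof (intro conjI ballI impI)
  fix x assume "x \<in> code ` J"
  then show "leg (dec x) \<in> nat_trans K (yoneda K (G (dec x))) X" by (auto simp: leg_nat_trans)
next
  fix x y assume "(x, y) \<in> idx"
  then obtain i j where *: "i \<in> J" "j \<in> J" "le i j" "x = code i" "y = code j" by (rule idxE)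
  have "nt_comp K (yoneda K (G i)) (leg j) (trn i j) = leg i"
  proof (rule nt_comp_eqI[OF leg_nat_trans[OF *(1)]])
    fix V a assume V: "V \<in> vect K" and a: "a \<in> carrier (obj (yoneda K (G i)) V)"
    then obtain h where h: "h \<in> lin K (G i) V" "a = fcode (carrier (G i)) h" by auto
    show "leg j V (trn i j V a) = leg i V a"
      using h V * pull_lin[OF *(1-3) h(1)] by (simp add: trn_apply leg_apply arr_pull)
  qed
  with * show "nt_comp K (yoneda K (G (dec x))) (leg (dec y)) (trn (dec x) (dec y)) = leg (dec x)" by simp
qed

section \<open>The mediating transformation to an arbitrary cocone\<close>

context
  fixes Z and d
  assumes Z: "additive_functor K Z"
    and d: "cocone K (code ` J) idx (\<lambda>x. yoneda K (G (dec x))) (\<lambda>x y. trn (dec x) (dec y)) Z d"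
begin

abbreviation dd :: "'i \<Rightarrow> ('a, 'a) module \<Rightarrow> ('a \<Rightarrow> 'a) \<Rightarrow> 'a" where
  "dd j V h \<equiv> d (code j) V (fcode (carrier (G j)) h)"

lemma d_nat_trans: "j \<in> J \<Longrightarrow> d (code j) \<in> nat_trans K (yoneda K (G j)) Z"
  using d by (auto simp: cocone_def)

lemma dd_pull:
  assumes "i \<in> J" "j \<in> J" "le i j" "V \<in> vect K" "h \<in> lin K (G i) V"
  shows "dd j V (pull i j h) = dd i V h"
proof -
  have "(code i, code j) \<in> idx" using assms by (auto simp: idx_def)
  with d assms have "nt_comp K (yoneda K (G i)) (d (code j)) (trn i j) = d (code i)"
    by (auto simp: cocone_def)
  from fun_cong[OF fun_cong[OF this], of V "fcode (carrier (G i)) h"] assms show ?thesis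
    by (simp add: trn_apply)
qed

text \<open>This is what makes the mediating map well defined. Two representations of one element
  are moved to a common stage, where the difference of the two maps kills the generator; at a still
  later stage this difference is the zero map.\<close>

lemma dd_eq:
  assumes V: "V \<in> vect K" and i: "i \<in> J" "h \<in> lin K (G i) V" and j: "j \<in> J" "g \<in> lin K (G j) V"
    and eq: "arr X (G i) V h (gen i) = arr X (G j) V g (gen j)"
  shows "dd i V h = dd j V g"
proof -
  obtain k where k: "k \<in> J" "le i k" "le j k" using directed i j by blast
  let ?h = "pull i k h" and ?g = "pull j k g"
  have h: "?h \<in> lin K (G k) V" and g: "?g \<in> lin K (G k) V"
    using pull_lin i j k by auto
  let ?f = "\<lambda>v\<in>carrier (G k). ?h v \<ominus>\<^bsub>V\<^esub> ?g v"
  have f: "?f \<in> lin K (G k) V" by (rule lin_minus_map[OF G[OF k(1)] V h g])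
  have "arr X (G k) V ?h (gen k) = arr X (G k) V ?g (gen k) \<oplus>\<^bsub>obj X V\<^esub> arr X (G k) V ?f (gen k)"
    by (rule additive_add[OF X G[OF k(1)] V g f h _ gen[OF k(1)]])
      (simp add: vect_add_minus_cancel[OF V] lin_closed[OF g] lin_closed[OF h])
  moreover have "arr X (G k) V ?h (gen k) = arr X (G k) V ?g (gen k)"
    using eq arr_pull[OF i(1) k(1,2) V i(2)] arr_pull[OF j(1) k(1,3) V j(2)] by simp
  moreover have gV: "arr X (G k) V ?g (gen k) \<in> carrier (obj X V)" "arr X (G k) V ?f (gen k) \<in> carrier (obj X V)"
    using additive_closed[OF X G[OF k(1)] V _ gen[OF k(1)]] g f by auto
  ultimately have "arr X (G k) V ?f (gen k) = \<zero>\<^bsub>obj X V\<^esub>"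
    using abelian_group.r_neg1[OF vect_abelian_group[OF additive_obj[OF X V]] gV]
      abelian_group.l_neg[OF vect_abelian_group[OF additive_obj[OF X V]] gV(1)] by simp
  \<comment> \<open>From vanishing on the generator \<open>gen k\<close>, \<open>relation\<close>
    leads to vanishing of the linear map itself after pulling back along
    \<open>\<tau> k l\<close>.\<close>
  then obtain l where l: "l \<in> J" "le k l" "\<forall>v\<in>carrier (G l). ?f (\<tau> k l v) = \<zero>\<^bsub>V\<^esub>"
    using relation[OF k(1) V f] by blast
  have "pull k l ?h = pull k l ?g"
  proof (rule lin_eqI[OF pull_lin[OF k(1) l(1,2) h] pull_lin[OF k(1) l(1,2) g]])
    fix v assume v: "v \<in> carrier (G l)"
    have tv: "\<tau> k l v \<in> carrier (G k)" by (rule lin_closed[OF \<tau>[OF k(1) l(1,2)] v])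
    have "?h (\<tau> k l v) \<ominus>\<^bsub>V\<^esub> ?g (\<tau> k l v) = \<zero>\<^bsub>V\<^esub>"
      using bspec[OF l(3) v] unfolding restrict_apply'[OF tv] .
    then have "?h (\<tau> k l v) = ?g (\<tau> k l v)"
      by (simp only: vect_minus_eq_zero_iff[OF V lin_closed[OF h tv] lin_closed[OF g tv]])
    with v show "pull k l ?h v = pull k l ?g v" by (simp only: compose_eq)
  qed
  then show ?thesis
    using dd_pull[OF i(1) k(1,2) V i(2)] dd_pull[OF j(1) k(1,3) V j(2)]
      dd_pull[OF k(1) l(1,2) V h] dd_pull[OF k(1) l(1,2) V g] by metis
qed

text \<open>The value prescribed by any representation of \<open>x\<close>; existence is
  \<open>generate\<close> and uniqueness is \<open>dd_eq\<close>.\<close>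

definition med :: "('a, 'a) module \<Rightarrow> 'a \<Rightarrow> 'a" where
  "med V x = (THE y. \<exists>j\<in>J. \<exists>h\<in>lin K (G j) V. x = arr X (G j) V h (gen j) \<and> y = dd j V h)"

lemma med_apply:
  assumes "V \<in> vect K" "j \<in> J" "h \<in> lin K (G j) V"
  shows "med V (arr X (G j) V h (gen j)) = dd j V h"
  unfolding med_def
proof (rule the_equality)
  fix y assume "\<exists>i\<in>J. \<exists>g\<in>lin K (G i) V. arr X (G j) V h (gen j) = arr X (G i) V g (gen i) \<and> y = dd i V g"
  then obtain i g where "i \<in> J" "g \<in> lin K (G i) V"
    "arr X (G j) V h (gen j) = arr X (G i) V g (gen i)" "y = dd i V g" by blast
  with dd_eq[OF assms(1,2,3)] show "y = dd j V h" by metis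
qed (use assms in blast)

text \<open>Directedness brings two elements to the same stage, where their sum is represented by
  the sum of the representing maps. Additivity of \<open>med\<close> rests on this.\<close>

lemma generate2:
  assumes V: "V \<in> vect K" and "x \<in> carrier (obj X V)" "y \<in> carrier (obj X V)"
  obtains k h g where "k \<in> J" "h \<in> lin K (G k) V" "g \<in> lin K (G k) V"
    "x = arr X (G k) V h (gen k)" "y = arr X (G k) V g (gen k)"
proof -
  obtain i h j g where *: "i \<in> J" "h \<in> lin K (G i) V" "x = arr X (G i) V h (gen i)"
    "j \<in> J" "g \<in> lin K (G j) V" "y = arr X (G j) V g (gen j)"
    using generate[OF V assms(2)] generate[OF V assms(3)] by blast
  obtain k where k: "k \<in> J" "le i k" "le j k" using directed * by blast
  show ?thesis
    using that[OF k(1) pull_lin[OF *(1) k(1,2) *(2)] pull_lin[OF *(4) k(1,3) *(5)]]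
      arr_pull[OF *(1) k(1,2) V *(2)] arr_pull[OF *(4) k(1,3) V *(5)] * by simp
qed

lemma med_nat_trans: "(\<lambda>V\<in>vect K. \<lambda>x\<in>carrier (obj X V). med V x) \<in> nat_trans K X Z"
proof (rule nat_transI[OF additive_valued[OF X]])
  fix V x assume V: "V \<in> vect K" and x: "x \<in> carrier (obj X V)"
  then obtain j h where jh: "j \<in> J" "h \<in> lin K (G j) V" "x = arr X (G j) V h (gen j)"
    using generate by blast
  note med = med_apply[OF V jh(1,2), folded jh(3)]
  note dj = nt_lin[OF d_nat_trans[OF jh(1)]]
  have h': "fcode (carrier (G j)) h \<in> carrier (obj (yoneda K (G j)) V)" using jh by simp
  show "med V x \<in> carrier (obj Z V)"
    unfolding med by (rule lin_closed[OF dj[OF V] h'])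
  show "med V (c \<odot>\<^bsub>obj X V\<^esub> x) = c \<odot>\<^bsub>obj Z V\<^esub> med V x" if c: "c \<in> carrier K" for c
  proof -
    have ch: "(\<lambda>v\<in>carrier (G j). c \<odot>\<^bsub>V\<^esub> h v) \<in> lin K (G j) V"
      by (rule lin_smult_map[OF G[OF jh(1)] V jh(2) c])
    have "arr X (G j) V (\<lambda>v\<in>carrier (G j). c \<odot>\<^bsub>V\<^esub> h v) (gen j) = c \<odot>\<^bsub>obj X V\<^esub> x"
      unfolding jh(3) by (rule additive_smult[OF X G[OF jh(1)] V jh(2) c ch _ gen[OF jh(1)]]) simp
    then have "med V (c \<odot>\<^bsub>obj X V\<^esub> x) = dd j V (\<lambda>v\<in>carrier (G j). c \<odot>\<^bsub>V\<^esub> h v)"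
      using med_apply[OF V jh(1) ch] by simp
    also have "\<dots> = c \<odot>\<^bsub>obj Z V\<^esub> dd j V h"
      using lin_smult[OF dj[OF V] c h'] yoneda_ops(3)[OF G[OF jh(1)] jh(2), of c] by simp
    finally show ?thesis unfolding med .
  qed
  show "med V (x \<oplus>\<^bsub>obj X V\<^esub> y) = med V x \<oplus>\<^bsub>obj Z V\<^esub> med V y" if y: "y \<in> carrier (obj X V)" for y
  proof -
    obtain k h g where k: "k \<in> J" and h: "h \<in> lin K (G k) V" and g: "g \<in> lin K (G k) V"
      and xy: "x = arr X (G k) V h (gen k)" "y = arr X (G k) V g (gen k)"
      by (rule generate2[OF V x y]) (rule that)
    have hg: "(\<lambda>v\<in>carrier (G k). h v \<oplus>\<^bsub>V\<^esub> g v) \<in> lin K (G k) V"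
      by (rule lin_add_map[OF G[OF k] V h g])
    have "arr X (G k) V (\<lambda>v\<in>carrier (G k). h v \<oplus>\<^bsub>V\<^esub> g v) (gen k) = x \<oplus>\<^bsub>obj X V\<^esub> y"
      unfolding xy by (rule additive_add[OF X G[OF k] V h g hg _ gen[OF k]]) simp
    then have "med V (x \<oplus>\<^bsub>obj X V\<^esub> y) = dd k V (\<lambda>v\<in>carrier (G k). h v \<oplus>\<^bsub>V\<^esub> g v)"
      using med_apply[OF V k hg] by simp
    also have "\<dots> = dd k V h \<oplus>\<^bsub>obj Z V\<^esub> dd k V g"
      using lin_add[OF nt_lin[OF d_nat_trans[OF k] V], of "fcode (carrier (G k)) h" "fcode (carrier (G k)) g"]
        h g yoneda_ops(2)[OF G[OF k] h g] by simp
    finally show ?thesis using med_apply[OF V k h] med_apply[OF V k g] xy by simp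
  qed
  show "med W (arr X V W f x) = arr Z V W f (med V x)" if W: "W \<in> vect K" and f: "f \<in> lin K V W" for W f
  proof -
    have fh: "compose (carrier (G j)) f h \<in> lin K (G j) W" by (rule lin_compose[OF G[OF jh(1)] jh(2) f])
    have "arr X V W f x = arr X (G j) W (compose (carrier (G j)) f h) (gen j)"
      unfolding jh(3) by (rule additive_comp[OF X G[OF jh(1)] V W jh(2) f fh compose_eq gen[OF jh(1)]])
    then have "med W (arr X V W f x) = dd j W (compose (carrier (G j)) f h)"
      using med_apply[OF W jh(1) fh] by simp
    also have "\<dots> = arr Z V W f (dd j V h)"
      using nt_nat[OF d_nat_trans[OF jh(1)] V W f h'] G[OF jh(1)] jh(2) by simp
    finally show ?thesis unfolding med .
  qed
qed

text \<open>Every element of \<open>X V\<close> is the value of some leg, which leaves no freedom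
  for the mediating transformation.\<close>

lemma med_unique:
  "\<exists>!u. u \<in> nat_trans K X Z \<and> (\<forall>x\<in>code ` J. nt_comp K (yoneda K (G (dec x))) u (leg (dec x)) = d x)"
proof (rule ex1I[of _ "\<lambda>V\<in>vect K. \<lambda>x\<in>carrier (obj X V). med V x"])
  let ?u = "\<lambda>V\<in>vect K. \<lambda>x\<in>carrier (obj X V). med V x"
  have "nt_comp K (yoneda K (G j)) ?u (leg j) = d (code j)" if j: "j \<in> J" for j
  proof (rule nt_comp_eqI[OF d_nat_trans[OF j]])
    fix V a assume V: "V \<in> vect K" and a: "a \<in> carrier (obj (yoneda K (G j)) V)"
    then obtain h where h: "h \<in> lin K (G j) V" "a = fcode (carrier (G j)) h" by auto
    have "arr X (G j) V h (gen j) \<in> carrier (obj X V)"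
      by (rule additive_closed[OF X G[OF j] V h(1) gen[OF j]])
    with h V j show "?u V (leg j V a) = d (code j) V a" by (simp add: leg_apply med_apply)
  qed
  then show "?u \<in> nat_trans K X Z \<and> (\<forall>x\<in>code ` J. nt_comp K (yoneda K (G (dec x))) ?u (leg (dec x)) = d x)"
    using med_nat_trans by auto
  fix u assume u: "u \<in> nat_trans K X Z \<and> (\<forall>x\<in>code ` J. nt_comp K (yoneda K (G (dec x))) u (leg (dec x)) = d x)"
  show "u = ?u"
  proof (rule nt_eqI[OF conjunct1[OF u] med_nat_trans])
    fix V x assume V: "V \<in> vect K" and x: "x \<in> carrier (obj X V)"
    then obtain j h where jh: "j \<in> J" "h \<in> lin K (G j) V" "x = arr X (G j) V h (gen j)"
      using generate by blast
    have "nt_comp K (yoneda K (G j)) u (leg j) = d (code j)" using u jh(1) by auto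
    from fun_cong[OF fun_cong[OF this], of V "fcode (carrier (G j)) h"]
    have "u V x = dd j V h" using V jh by (simp add: leg_apply)
    also have "\<dots> = med V x" unfolding jh(3) by (rule med_apply[OF V jh(1,2), symmetric])
    finally show "u V x = ?u V x" using V x by simp
  qed
qed

end

lemma small_functor: "small_functor K X"
  unfolding small_functor_def
proof (intro conjI exI)
  show "colimit_cocone K (code ` J) idx (\<lambda>x. yoneda K (G (dec x))) (\<lambda>x y. trn (dec x) (dec y)) X (\<lambda>x. leg (dec x))"
    unfolding colimit_cocone_def using cocone_leg med_unique by blast
  show "diagram K (code ` J) idx (\<lambda>x. yoneda K (G (dec x))) (\<lambda>x y. trn (dec x) (dec y))" by (rule diagram_trn)
  show "\<forall>x\<in>code ` J. G (dec x) \<in> vect K" using G by auto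
qed (use X code directed_poset_idx in auto)

end

context small_vect
begin

subsection \<open>Supports\<close>

lemma sub_sub [simp]: "V\<lparr>carrier := U\<rparr>\<lparr>carrier := W\<rparr> = V\<lparr>carrier := W\<rparr>"
  by simp

lemma lin_restrict_sub:
  assumes "V \<in> vect K" "submodule U K V" "f \<in> lin K V W"
  shows "(\<lambda>u\<in>U. f u) \<in> lin K (V\<lparr>carrier := U\<rparr>) W"
  using lin_compose[OF sub_vect[OF assms(1,2)] lin_incl[OF assms(1,2)] assms(3)]
  by (simp add: compose_def cong: restrict_cong)

lemma submodule_of_sub:
  assumes "V \<in> vect K" "submodule U K V" "submodule W K (V\<lparr>carrier := U\<rparr>)"
  shows "submodule W K V"
  using vect_submodule[OF sub_vect[OF assms(1,2)] assms(3)] vect_submodule(1)[OF assms(1,2)]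
  by (intro vect_submoduleI[OF assms(1)]) auto

text \<open>The complementary projection \<open>id - r\<close> of a retraction \<open>r\<close> onto
  \<open>U\<close>. It exhibits \<open>U\<close> as a kernel, and being idempotent it has an image
  that can represent the quotient by \<open>U\<close>.\<close>

lemma projection_exists:
  assumes V: "V \<in> vect K" and U: "submodule U K V"
  obtains \<phi> where "\<phi> \<in> lin K V V" "\<And>v. v \<in> carrier V \<Longrightarrow> \<phi> v = \<zero>\<^bsub>V\<^esub> \<longleftrightarrow> v \<in> U"
    "\<And>v. v \<in> carrier V \<Longrightarrow> \<phi> (\<phi> v) = \<phi> v"
proof -
  obtain r where r: "r \<in> lin K V V" "\<And>v. v \<in> carrier V \<Longrightarrow> r v \<in> U" "\<And>u. u \<in> U \<Longrightarrow> r u = u"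
    by (rule retraction_exists[OF V U]) (rule that)
  let ?e = "\<lambda>v\<in>carrier V. (\<lambda>v\<in>carrier V. v) v \<ominus>\<^bsub>V\<^esub> r v"
  have e: "?e \<in> lin K V V" by (rule lin_minus_map[OF V V lin_id[OF V] r(1)])
  have e0: "?e v = \<zero>\<^bsub>V\<^esub> \<longleftrightarrow> v \<in> U" if v: "v \<in> carrier V" for v
  proof -
    have "?e v = \<zero>\<^bsub>V\<^esub> \<longleftrightarrow> v = r v"
      using v vect_minus_eq_zero_iff[OF V v lin_closed[OF r(1) v]] by simp
    also have "\<dots> \<longleftrightarrow> v \<in> U" using r(2)[OF v] r(3)[of v] by auto
    finally show ?thesis .
  qed
  have ee: "?e (?e v) = ?e v" if v: "v \<in> carrier V" for v
  proof -
    have ev: "?e v \<in> carrier V" by (rule lin_closed[OF e v])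
    have rv: "r v \<in> carrier V" by (rule lin_closed[OF r(1) v])
    have "r (?e v) = r (v \<ominus>\<^bsub>V\<^esub> r v)" using v by simp
    also have "\<dots> = r v \<ominus>\<^bsub>V\<^esub> r (r v)" by (rule lin_minus[OF r(1) V V v rv])
    also have "\<dots> = \<zero>\<^bsub>V\<^esub>" using r(2)[OF v] r(3) vect_minus_eq_zero_iff[OF V rv rv] by simp
    finally have "r (?e v) = \<zero>\<^bsub>V\<^esub>" .
    moreover have "?e (?e v) = ?e v \<ominus>\<^bsub>V\<^esub> r (?e v)"
      unfolding restrict_apply'[OF ev] ..
    ultimately show ?thesis using vect_minus_zero[OF V ev] by (simp only:)
  qed
  show ?thesis by (rule that[OF e e0 ee])
qed

text \<open>The element \<open>y\<close> of \<open>X V\<close> lies in the image of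
  \<open>X U\<close>. By \<open>incl_injective\<close> this image is a copy of
  \<open>X U\<close>.\<close>

definition supported :: "'u vfunctor \<Rightarrow> ('u, 'u) module \<Rightarrow> 'u set \<Rightarrow> 'u \<Rightarrow> bool" where
  "supported X V U y \<longleftrightarrow>
     (\<exists>z\<in>carrier (obj X (V\<lparr>carrier := U\<rparr>)). arr X (V\<lparr>carrier := U\<rparr>) V (\<lambda>u\<in>U. u) z = y)"

context
  fixes X :: "'u vfunctor"
  assumes X: "additive_functor K X"
begin

lemma arr_zero [simp]:
  "V \<in> vect K \<Longrightarrow> W \<in> vect K \<Longrightarrow> f \<in> lin K V W \<Longrightarrow> arr X V W f \<zero>\<^bsub>obj X V\<^esub> = \<zero>\<^bsub>obj X W\<^esub>"
  using X by (simp add: lin_0[OF additive_lin])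

text \<open>The inclusion of a subspace splits, and the functor carries the splitting along.\<close>

lemma incl_injective:
  assumes V: "V \<in> vect K" and U: "submodule U K V"
    and z: "z \<in> carrier (obj X (V\<lparr>carrier := U\<rparr>))" "z' \<in> carrier (obj X (V\<lparr>carrier := U\<rparr>))"
    and eq: "arr X (V\<lparr>carrier := U\<rparr>) V (\<lambda>u\<in>U. u) z = arr X (V\<lparr>carrier := U\<rparr>) V (\<lambda>u\<in>U. u) z'"
  shows "z = z'"
proof -
  obtain r where r: "r \<in> lin K V V" "\<And>v. v \<in> carrier V \<Longrightarrow> r v \<in> U" "\<And>u. u \<in> U \<Longrightarrow> r u = u"
    by (rule retraction_exists[OF V U]) (rule that)
  note VU = sub_vect[OF V U]
  note r' = lin_codomain[OF r(1,2)]
  have "arr X V (V\<lparr>carrier := U\<rparr>) r (arr X (V\<lparr>carrier := U\<rparr>) V (\<lambda>u\<in>U. u) w) = w"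
    if w: "w \<in> carrier (obj X (V\<lparr>carrier := U\<rparr>))" for w
    using additive_comp[OF X VU V VU lin_incl[OF V U] r' lin_id[OF VU] _ w]
      additive_id[OF X VU lin_id[OF VU] _ w] r(3) by simp
  with z eq show ?thesis by metis
qed

text \<open>Exactness of additive functors on vector spaces: with \<open>r\<close> a retraction onto
  the kernel of \<open>\<phi>\<close>, the map \<open>id - r\<close> factors through
  \<open>\<phi>\<close>. Hence \<open>X\<close> sends \<open>y\<close> to zero along it, and
  \<open>y\<close> is fixed by \<open>X\<close> applied to \<open>r\<close>.\<close>

lemma supported_kernel:
  assumes V: "V \<in> vect K" and W: "W \<in> vect K" and \<phi>: "\<phi> \<in> lin K V W" and y: "y \<in> carrier (obj X V)"
    and zero: "arr X V W \<phi> y = \<zero>\<^bsub>obj X W\<^esub>"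
  shows "supported X V {v \<in> carrier V. \<phi> v = \<zero>\<^bsub>W\<^esub>} y"
proof -
  let ?N = "{v \<in> carrier V. \<phi> v = \<zero>\<^bsub>W\<^esub>}"
  note N = kernel_submodule[OF V W \<phi>]
  obtain r where r: "r \<in> lin K V V" "\<And>v. v \<in> carrier V \<Longrightarrow> r v \<in> ?N" "\<And>u. u \<in> ?N \<Longrightarrow> r u = u"
    by (rule retraction_exists[OF V N]) (rule that)
  let ?e = "\<lambda>v\<in>carrier V. (\<lambda>v\<in>carrier V. v) v \<ominus>\<^bsub>V\<^esub> r v"
  have e: "?e \<in> lin K V V" by (rule lin_minus_map[OF V V lin_id[OF V] r(1)])
  obtain g where g: "g \<in> lin K W V" "\<And>v. v \<in> carrier V \<Longrightarrow> ?e v = g (\<phi> v)"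
  proof (rule factor_through[OF V W V \<phi> e])
    fix v assume "v \<in> carrier V" "\<phi> v = \<zero>\<^bsub>W\<^esub>"
    with r(3)[of v] V show "?e v = \<zero>\<^bsub>V\<^esub>" by (simp add: vect_minus_eq_zero_iff)
  qed (rule that)
  have "arr X V V ?e y = arr X W V g (arr X V W \<phi> y)"
    by (rule additive_comp[OF X V W V \<phi> g(1) e g(2) y, symmetric])
  also have "\<dots> = \<zero>\<^bsub>obj X V\<^esub>" unfolding zero using W V g(1) by simp
  finally have "arr X V V ?e y = \<zero>\<^bsub>obj X V\<^esub>" .
  moreover have "arr X V V (\<lambda>v\<in>carrier V. v) y = arr X V V r y \<oplus>\<^bsub>obj X V\<^esub> arr X V V ?e y"
    by (rule additive_add[OF X V V r(1) e lin_id[OF V] _ y])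
      (simp add: vect_add_minus_cancel[OF V] lin_closed[OF r(1)])
  moreover have "arr X V V (\<lambda>v\<in>carrier V. v) y = y"
    by (rule additive_id[OF X V lin_id[OF V] _ y]) simp
  moreover have "arr X V V r y \<in> carrier (obj X V)" by (rule additive_closed[OF X V V r(1) y])
  ultimately have ry: "arr X V V r y = y" using X V by simp
  note r' = lin_codomain[OF r(1,2)]
  show ?thesis
    unfolding supported_def
  proof (rule bexI)
    show "arr X V (V\<lparr>carrier := ?N\<rparr>) r y \<in> carrier (obj X (V\<lparr>carrier := ?N\<rparr>))"
      by (rule additive_closed[OF X V sub_vect[OF V N] r' y])
    have "arr X (V\<lparr>carrier := ?N\<rparr>) V (\<lambda>u\<in>?N. u) (arr X V (V\<lparr>carrier := ?N\<rparr>) r y) = arr X V V r y"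
      by (rule additive_comp[OF X V sub_vect[OF V N] V r' lin_incl[OF V N] r(1) _ y]) (use r(2) in auto)
    with ry show "arr X (V\<lparr>carrier := ?N\<rparr>) V (\<lambda>u\<in>?N. u) (arr X V (V\<lparr>carrier := ?N\<rparr>) r y) = y" by simp
  qed
qed

text \<open>On \<open>U\<close> the map \<open>\<phi>\<close> is zero, and additive functors
  preserve zero maps. Together with \<open>supported_kernel\<close> this characterises being
  supported on a kernel by an equation.\<close>

lemma supported_kill:
  assumes V: "V \<in> vect K" and W: "W \<in> vect K" and U: "submodule U K V" and \<phi>: "\<phi> \<in> lin K V W"
    and y: "supported X V U y" and zero: "\<And>u. u \<in> U \<Longrightarrow> \<phi> u = \<zero>\<^bsub>W\<^esub>"
  shows "arr X V W \<phi> y = \<zero>\<^bsub>obj X W\<^esub>"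
proof -
  note VU = sub_vect[OF V U]
  obtain z where z: "z \<in> carrier (obj X (V\<lparr>carrier := U\<rparr>))" "arr X (V\<lparr>carrier := U\<rparr>) V (\<lambda>u\<in>U. u) z = y"
    using y by (auto simp: supported_def)
  have 0: "(\<lambda>u\<in>carrier (V\<lparr>carrier := U\<rparr>). \<zero>\<^bsub>W\<^esub>) \<in> lin K (V\<lparr>carrier := U\<rparr>) W"
    by (rule lin_zero_map[OF VU W])
  have "arr X V W \<phi> y = arr X (V\<lparr>carrier := U\<rparr>) W (\<lambda>u\<in>carrier (V\<lparr>carrier := U\<rparr>). \<zero>\<^bsub>W\<^esub>) z"
    unfolding z(2)[symmetric]
    by (rule additive_comp[OF X VU V W lin_incl[OF V U] \<phi> 0 _ z(1)]) (use zero in simp)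
  also have "\<dots> = \<zero>\<^bsub>obj X W\<^esub>" by (rule additive_zero[OF X VU W 0 _ z(1)]) simp
  finally show ?thesis .
qed

lemma supported_image:
  assumes V: "V \<in> vect K" and U: "submodule U K V" and p: "p \<in> lin K V V"
    and y: "y \<in> carrier (obj X V)" "arr X V V p y = y" and pU: "\<And>v. v \<in> carrier V \<Longrightarrow> p v \<in> U"
  shows "supported X V U y"
proof -
  note p' = lin_codomain[OF p pU]
  have "arr X (V\<lparr>carrier := U\<rparr>) V (\<lambda>u\<in>U. u) (arr X V (V\<lparr>carrier := U\<rparr>) p y) = arr X V V p y"
    by (rule additive_comp[OF X V sub_vect[OF V U] V p' lin_incl[OF V U] p _ y(1)]) (use pU in auto)
  with y(2) show ?thesis
    unfolding supported_def using additive_closed[OF X V sub_vect[OF V U] p' y(1)] by metis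
qed

text \<open>Write \<open>U\<close> as the kernel of a projection \<open>\<phi>\<close>; the preimage
  under \<open>f\<close> is then the kernel of the composite of \<open>f\<close> and
  \<open>\<phi>\<close>.\<close>

lemma supported_preimage:
  assumes V: "V \<in> vect K" and W: "W \<in> vect K" and U: "submodule U K W" and f: "f \<in> lin K V W"
    and y: "y \<in> carrier (obj X V)" and supp: "supported X W U (arr X V W f y)"
  shows "supported X V {v \<in> carrier V. f v \<in> U} y"
proof -
  obtain \<phi> where \<phi>: "\<phi> \<in> lin K W W" "\<And>v. v \<in> carrier W \<Longrightarrow> \<phi> v = \<zero>\<^bsub>W\<^esub> \<longleftrightarrow> v \<in> U"
    by (rule projection_exists[OF W U]) (rule that)
  let ?h = "compose (carrier V) \<phi> f"
  have h: "?h \<in> lin K V W" by (rule lin_compose[OF V f \<phi>(1)])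
  have "arr X W W \<phi> (arr X V W f y) = \<zero>\<^bsub>obj X W\<^esub>"
    by (rule supported_kill[OF W W U \<phi>(1) supp]) (use \<phi>(2) vect_submodule(1)[OF W U] in auto)
  then have "arr X V W ?h y = \<zero>\<^bsub>obj X W\<^esub>"
    using additive_comp[OF X V W W f \<phi>(1) h compose_eq y] by simp
  from supported_kernel[OF V W h y this]
  show ?thesis using \<phi>(2) lin_closed[OF f] by (simp add: compose_eq cong: conj_cong)
qed

lemma supported_trans:
  assumes V: "V \<in> vect K" and U: "submodule U K V" and W: "submodule W K (V\<lparr>carrier := U\<rparr>)"
    and z: "z \<in> carrier (obj X (V\<lparr>carrier := U\<rparr>))" "supported X (V\<lparr>carrier := U\<rparr>) W z"
  shows "supported X V W (arr X (V\<lparr>carrier := U\<rparr>) V (\<lambda>u\<in>U. u) z)"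
proof -
  note VU = sub_vect[OF V U]
  note VW = sub_vect[OF VU W]
  note W' = submodule_of_sub[OF V U W]
  obtain z' where z': "z' \<in> carrier (obj X (V\<lparr>carrier := W\<rparr>))"
    "arr X (V\<lparr>carrier := W\<rparr>) (V\<lparr>carrier := U\<rparr>) (\<lambda>u\<in>W. u) z' = z"
    using z(2) by (auto simp: supported_def)
  have "arr X (V\<lparr>carrier := U\<rparr>) V (\<lambda>u\<in>U. u) z = arr X (V\<lparr>carrier := W\<rparr>) V (\<lambda>u\<in>W. u) z'"
    unfolding z'(2)[symmetric]
    by (rule additive_comp[OF X VW VU V lin_incl[OF VU W] lin_incl[OF V U], unfolded sub_sub, OF lin_incl[OF V W'] _ z'(1)])
      (use vect_submodule(1)[OF VU W] in auto)
  with z'(1) show ?thesis unfolding supported_def by metis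
qed

text \<open>The intersection is the preimage of \<open>W\<close> under the inclusion of
  \<open>U\<close>. In the poset of generators this allows two sets of relations to be imposed
  together.\<close>

lemma supported_inter:
  assumes V: "V \<in> vect K" and U: "submodule U K V" and W: "submodule W K V"
    and y: "supported X V U y" "supported X V W y"
  shows "supported X V (U \<inter> W) y"
proof -
  note VU = sub_vect[OF V U]
  obtain z where z: "z \<in> carrier (obj X (V\<lparr>carrier := U\<rparr>))" "arr X (V\<lparr>carrier := U\<rparr>) V (\<lambda>u\<in>U. u) z = y"
    using y(1) by (auto simp: supported_def)
  have "supported X (V\<lparr>carrier := U\<rparr>) {v \<in> carrier (V\<lparr>carrier := U\<rparr>). (\<lambda>u\<in>U. u) v \<in> W} z"
    by (rule supported_preimage[OF VU V W lin_incl[OF V U] z(1)]) (use z(2) y(2) in simp)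
  moreover have eq: "{v \<in> carrier (V\<lparr>carrier := U\<rparr>). (\<lambda>u\<in>U. u) v \<in> W} = U \<inter> W" by auto
  moreover have "submodule (U \<inter> W) K (V\<lparr>carrier := U\<rparr>)"
    using vect_submodule[OF V U] vect_submodule[OF V W] by (intro vect_submoduleI[OF VU]) auto
  ultimately show ?thesis using supported_trans[OF V U _ z(1)] z(2) by simp
qed

section \<open>Small functors from bounded generation\<close>

lemma lin_finsum:
  assumes V: "V \<in> vect K" and W: "W \<in> vect K" and f: "f \<in> lin K V W"
    and A: "finite A" "g \<in> A \<rightarrow> carrier V"
  shows "f (finsum V g A) = finsum W (\<lambda>i. f (g i)) A"
proof -
  interpret V: module K V by (rule vect_module[OF V])
  interpret W: module K W by (rule vect_module[OF W])
  show ?thesis using A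
  proof induction
    case empty
    then show ?case using lin_0[OF f V W] by simp
  next
    case (insert a A)
    then show ?case using lin_add[OF f, of "g a" "finsum V g A"] lin_closed[OF f] by (simp add: Pi_def)
  qed
qed

lemma preimage_submodule:
  assumes "V \<in> vect K" "W \<in> vect K" "f \<in> lin K V W" "submodule U K W"
  shows "submodule {v \<in> carrier V. f v \<in> U} K V"
  using assms vect_submodule[OF assms(2,4)]
  by (intro vect_submoduleI) (auto simp: lin_add[OF assms(3)] lin_smult[OF assms(3)] lin_0[OF assms(3,1,2)])

lemma inter_submodule:
  assumes "V \<in> vect K" "submodule U K V" "submodule W K V" shows "submodule (U \<inter> W) K V"
  using vect_submodule[OF assms(1,2)] vect_submodule[OF assms(1,3)] by (intro vect_submoduleI[OF assms(1)]) auto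

lemma fixed_submodule:
  assumes "V \<in> vect K" "p \<in> lin K V V" shows "submodule {v \<in> carrier V. p v = v} K V"
  using assms by (intro vect_submoduleI) (auto simp: lin_add[OF assms(2)] lin_smult[OF assms(2)])

text \<open>The generators are pairs of a finite set \<open>A\<close> of elements of \<open>X (free B)\<close> and a subspace \<open>U\<close> of
  \<open>(free B)\<^sup>A\<close> supporting the tuple formed by \<open>A\<close>. All these powers are realised inside the single free
  space \<open>free T\<close>, with projections \<open>p A\<close>; enlarging \<open>A\<close> adds generators, shrinking \<open>U\<close> imposes
  relations.\<close>

lemma bounded_generation_small:
  assumes B: "small B"
    and generate: "\<And>V x. V \<in> vect K \<Longrightarrow> x \<in> carrier (obj X V) \<Longrightarrow>
      \<exists>h\<in>lin K (free B) V. \<exists>y\<in>carrier (obj X (free B)). x = arr X (free B) V h y"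
  shows "small_functor K X"
proof -
  interpret cring K by (rule cring_K)
  define S where "S = carrier (obj X (free B))"
  \<comment> \<open>A disjoint union of copies of \<open>B\<close>, one for each element
    \<open>y\<close> of \<open>X (free B)\<close>, so that \<open>free T\<close> contains every
    finite power of \<open>free B\<close> as a coordinate subspace.\<close>
  define T where "T = (\<lambda>(y, b). kpair y b) ` (S \<times> B)"
  define second :: "'u \<Rightarrow> 'u" where "second t = (THE b. \<exists>y. t = kpair y b)" for t
  have [simp]: "second (kpair y b) = b" for y b by (auto simp: second_def)
  have S: "small S" unfolding S_def by (rule vect_small) (use X B in simp)
  have T: "small T" unfolding T_def by (rule small_kpair[OF S B])
  have memT [simp]: "kpair y b \<in> T \<longleftrightarrow> y \<in> S \<and> b \<in> B" for y b by (auto simp: T_def)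
  have TE: "\<exists>y b. t = kpair y b \<and> y \<in> S \<and> b \<in> B" if "t \<in> T" for t using that by (auto simp: T_def)
  note F = free_vect[OF B] and G = free_vect[OF T]
  \<comment> \<open>\<open>ins y\<close> and \<open>pr y\<close> include and project the copy
    labelled \<open>y\<close>; \<open>p A\<close> keeps the copies with label in \<open>A\<close>
    and erases the others.\<close>
  define ins where "ins y = reindex B T (kpair y ` B) second (\<lambda>_. \<one>\<^bsub>K\<^esub>)" for y
  define pr where "pr y = reindex T B B (kpair y) (\<lambda>_. \<one>\<^bsub>K\<^esub>)" for y
  define p where "p A = reindex T T ((\<lambda>(y, b). kpair y b) ` (A \<times> B)) (\<lambda>t. t) (\<lambda>_. \<one>\<^bsub>K\<^esub>)" for A
  have ins: "ins y \<in> lin K (free B) (free T)"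
    and fins: "\<And>u y' b. u \<in> carrier (free B) \<Longrightarrow> y' \<in> S \<Longrightarrow> b \<in> B \<Longrightarrow>
      fapp T (ins y u) (kpair y' b) = (if y' = y then fapp B u b else \<zero>\<^bsub>K\<^esub>)" if "y \<in> S" for y
  proof -
    have 1: "kpair y ` B \<subseteq> T" "inj_on second (kpair y ` B)" "second ` kpair y ` B \<subseteq> B"
      using that by (auto simp: inj_on_def)
    show "ins y \<in> lin K (free B) (free T)"
      unfolding ins_def by (rule reindex_lin[OF T B 1]) simp
    show "fapp T (ins y u) (kpair y' b) = (if y' = y then fapp B u b else \<zero>\<^bsub>K\<^esub>)"
      if "u \<in> carrier (free B)" "y' \<in> S" "b \<in> B" for u y' b
      unfolding ins_def using fapp_reindex[OF T B 1 _ that(1), of "\<lambda>_. \<one>\<^bsub>K\<^esub>" "kpair y' b"] that B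
      by auto
  qed
  have pr: "pr y \<in> lin K (free T) (free B)"
    and fpr: "\<And>u b. u \<in> carrier (free T) \<Longrightarrow> b \<in> B \<Longrightarrow> fapp B (pr y u) b = fapp T u (kpair y b)" if "y \<in> S" for y
  proof -
    have 1: "inj_on (kpair y) B" "kpair y ` B \<subseteq> T" using that by (auto simp: inj_on_def)
    show "pr y \<in> lin K (free T) (free B)"
      unfolding pr_def by (rule reindex_lin[OF B T order_refl 1]) simp
    show "fapp B (pr y u) b = fapp T u (kpair y b)" if u: "u \<in> carrier (free T)" "b \<in> B" for u b
      unfolding pr_def using fapp_reindex[OF B T order_refl 1 _ u(1), of "\<lambda>_. \<one>\<^bsub>K\<^esub>" b] u T \<open>y \<in> S\<close>
      by simp
  qed
  have p: "p A \<in> lin K (free T) (free T)"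
    and fp: "\<And>u y b. u \<in> carrier (free T) \<Longrightarrow> y \<in> S \<Longrightarrow> b \<in> B \<Longrightarrow>
      fapp T (p A u) (kpair y b) = (if y \<in> A then fapp T u (kpair y b) else \<zero>\<^bsub>K\<^esub>)" if "A \<subseteq> S" for A
  proof -
    let ?D = "(\<lambda>(y, b). kpair y b) ` (A \<times> B)"
    have 1: "?D \<subseteq> T" "inj_on (\<lambda>t. t) ?D" "(\<lambda>t. t) ` ?D \<subseteq> T"
      using that by auto
    show "p A \<in> lin K (free T) (free T)"
      unfolding p_def by (rule reindex_lin[OF T T 1]) simp
    show "fapp T (p A u) (kpair y b) = (if y \<in> A then fapp T u (kpair y b) else \<zero>\<^bsub>K\<^esub>)"
      if u: "u \<in> carrier (free T)" "y \<in> S" "b \<in> B" for u y b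
      unfolding p_def using fapp_reindex[OF T T 1 _ u(1), of "\<lambda>_. \<one>\<^bsub>K\<^esub>" "kpair y b"] u T
      by auto
  qed
  have eqT: "v = w" if "v \<in> carrier (free T)" "w \<in> carrier (free T)"
    "\<And>y b. y \<in> S \<Longrightarrow> b \<in> B \<Longrightarrow> fapp T v (kpair y b) = fapp T w (kpair y b)" for v w
    by (rule free_eqI[OF T that(1,2)]) (use TE that(3) in blast)
  have pr_ins: "pr y (ins y u) = u" if "y \<in> S" "u \<in> carrier (free B)" for y u
    by (rule free_eqI[OF B]) (use that in \<open>auto simp: fpr fins lin_closed[OF pr] lin_closed[OF ins]\<close>)
  have p_ins: "p A (ins y u) = (if y \<in> A then ins y u else \<zero>\<^bsub>free T\<^esub>)"
    if "A \<subseteq> S" "y \<in> S" "u \<in> carrier (free B)" for A y u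
    by (rule eqT) (use that G T in \<open>auto simp: fp fins lin_closed[OF p] lin_closed[OF ins]\<close>)
  have p_p: "p A (p C u) = p A u" if "A \<subseteq> C" "C \<subseteq> S" "u \<in> carrier (free T)" for A C u
  proof -
    have "A \<subseteq> S" using that by simp
    note pA = lin_closed[OF p[OF this]] and pC = lin_closed[OF p[OF that(2)] that(3)]
    show ?thesis
      by (rule eqT) (use that \<open>A \<subseteq> S\<close> pA pC in \<open>auto simp: fp\<close>)
  qed
  \<comment> \<open>Each \<open>y\<close> in \<open>A\<close> is placed in the copy that it labels
    itself; \<open>pr y\<close> recovers it from there.\<close>
  define tup where "tup A = finsum (obj X (free T)) (\<lambda>y. arr X (free B) (free T) (ins y) y) A" for A
  have XG: "obj X (free T) \<in> vect K" using X G by simp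
  interpret XG: module K "obj X (free T)" by (rule vect_module[OF XG])
  have ins_y: "arr X (free B) (free T) (ins y) y \<in> carrier (obj X (free T))" if "y \<in> S" for y
    using additive_closed[OF X F G ins[OF that]] that by (simp add: S_def)
  have tup: "tup A \<in> carrier (obj X (free T))" if "A \<subseteq> S" for A
    unfolding tup_def using ins_y that by (intro XG.M.finsum_closed) auto
  have p_tup: "arr X (free T) (free T) (p A) (tup C) = tup A" if "A \<subseteq> C" "C \<subseteq> S" "finite C" for A C
  proof -
    have A: "A \<subseteq> S" using that by simp
    have "arr X (free T) (free T) (p A) (tup C) =
      finsum (obj X (free T)) (\<lambda>y. arr X (free T) (free T) (p A) (arr X (free B) (free T) (ins y) y)) C"
      unfolding tup_def using ins_y that by (intro lin_finsum[OF XG XG additive_lin[OF X G G p[OF A]]]) auto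
    \<comment> \<open>\<open>p A\<close> kills the summands labelled outside \<open>A\<close> and
      fixes the others.\<close>
    also have "\<dots> = tup A"
      unfolding tup_def
    proof (rule XG.M.add.finprod_mono_neutral_cong_right)
      fix y assume "y \<in> C - A"
      then have y: "y \<in> S" "y \<notin> A" using that by auto
      then have yX: "y \<in> carrier (obj X (free B))" by (simp add: S_def)
      have z: "(\<lambda>v\<in>carrier (free B). \<zero>\<^bsub>free T\<^esub>) \<in> lin K (free B) (free T)" by (rule lin_zero_map[OF F G])
      have "arr X (free T) (free T) (p A) (arr X (free B) (free T) (ins y) y) =
        arr X (free B) (free T) (\<lambda>v\<in>carrier (free B). \<zero>\<^bsub>free T\<^esub>) y"
        by (rule additive_comp[OF X F G G ins[OF y(1)] p[OF A] z _ yX]) (use p_ins[OF A y(1)] y(2) in simp)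
      also have "\<dots> = \<zero>\<^bsub>obj X (free T)\<^esub>" by (rule additive_zero[OF X F G z _ yX]) simp
      finally show "arr X (free T) (free T) (p A) (arr X (free B) (free T) (ins y) y) = \<zero>\<^bsub>obj X (free T)\<^esub>" .
    next
      fix y assume "y \<in> A"
      then have y: "y \<in> S" "y \<in> A" using A by auto
      then have yX: "y \<in> carrier (obj X (free B))" by (simp add: S_def)
      show "arr X (free T) (free T) (p A) (arr X (free B) (free T) (ins y) y) = arr X (free B) (free T) (ins y) y"
        by (rule additive_comp[OF X F G G ins[OF y(1)] p[OF A] ins[OF y(1)] _ yX])
          (use p_ins[OF A y(1)] y(2) in simp)
    qed (use that ins_y additive_closed[OF X G G p[OF A]] in auto)
    finally show ?thesis .
  qed
  have pr_tup: "arr X (free T) (free B) (pr y) (tup {y}) = y" if y: "y \<in> S" for y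
  proof -
    have yX: "y \<in> carrier (obj X (free B))" using y by (simp add: S_def)
    have "tup {y} = arr X (free B) (free T) (ins y) y"
      unfolding tup_def using ins_y[OF y] by simp
    then have "arr X (free T) (free B) (pr y) (tup {y}) = arr X (free B) (free B) (\<lambda>v\<in>carrier (free B). v) y"
      using additive_comp[OF X F G F ins[OF y] pr[OF y] lin_id[OF F] _ yX] pr_ins[OF y] by simp
    also have "\<dots> = y" by (rule additive_id[OF X F lin_id[OF F] _ yX]) simp
    finally show ?thesis .
  qed
  \<comment> \<open>That \<open>p A\<close> fixes \<open>U\<close> says that \<open>U\<close> lies
    in the coordinate subspace belonging to \<open>A\<close>. The same condition makes
    \<open>le\<close> reflexive and antisymmetric.\<close>
  define J where "J = {(A, U). finite A \<and> A \<subseteq> S \<and> submodule U K (free T) \<and> (\<forall>u\<in>U. p A u = u) \<and>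
    supported X (free T) U (tup A)}"
  define le where "le i j \<longleftrightarrow> fst i \<subseteq> fst j \<and> p (fst i) ` snd j \<subseteq> snd i" for i j :: "'u set \<times> 'u set"
  define cd where "cd i = kpair (set_code (fst i)) (set_code (snd i))" for i :: "'u set \<times> 'u set"
  define sub where "sub i = (free T)\<lparr>carrier := snd i\<rparr>" for i :: "'u set \<times> 'u set"
  define \<tau> where "\<tau> i j = (\<lambda>v\<in>snd j. p (fst i) v)" for i j :: "'u set \<times> 'u set"
  \<comment> \<open>The tuple regarded as an element of \<open>X U\<close>; by
    \<open>incl_injective\<close> there is only one such element.\<close>
  define gen where "gen i = (SOME z. z \<in> carrier (obj X (sub i)) \<and>
    arr X (sub i) (free T) (\<lambda>u\<in>snd i. u) z = tup (fst i))" for i :: "'u set \<times> 'u set"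
  have J: "finite (fst i)" "fst i \<subseteq> S" "submodule (snd i) K (free T)" "\<And>u. u \<in> snd i \<Longrightarrow> p (fst i) u = u"
    "supported X (free T) (snd i) (tup (fst i))" if "i \<in> J" for i
    using that by (auto simp: J_def)
  have sub: "sub i \<in> vect K" "snd i \<subseteq> carrier (free T)" if "i \<in> J" for i
    unfolding sub_def using sub_vect[OF G J(3)[OF that]] vect_submodule(1)[OF G J(3)[OF that]] by auto
  have incl: "(\<lambda>u\<in>snd i. u) \<in> lin K (sub i) (free T)" if "i \<in> J" for i
    unfolding sub_def by (rule lin_incl[OF G J(3)[OF that]])
  have gen: "gen i \<in> carrier (obj X (sub i))" "arr X (sub i) (free T) (\<lambda>u\<in>snd i. u) (gen i) = tup (fst i)"
    if "i \<in> J" for i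
  proof -
    have "\<exists>z. z \<in> carrier (obj X (sub i)) \<and> arr X (sub i) (free T) (\<lambda>u\<in>snd i. u) z = tup (fst i)"
      using J(5)[OF that] unfolding supported_def sub_def by blast
    from someI_ex[OF this] show "gen i \<in> carrier (obj X (sub i))"
      "arr X (sub i) (free T) (\<lambda>u\<in>snd i. u) (gen i) = tup (fst i)" by (simp_all add: gen_def)
  qed
  have [simp]: "carrier (sub i) = snd i" for i by (simp add: sub_def)
  have \<tau>: "\<tau> i j \<in> lin K (sub j) (sub i)" if ij: "i \<in> J" "j \<in> J" "le i j" for i j
  proof -
    have "\<tau> i j \<in> lin K (sub j) (free T)"
      unfolding \<tau>_def sub_def by (rule lin_restrict_sub[OF G J(3)[OF ij(2)] p[OF J(2)[OF ij(1)]]])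
    then show ?thesis
      unfolding sub_def[of i] by (rule lin_codomain) (use ij(3) in \<open>auto simp: \<tau>_def le_def\<close>)
  qed
  have gen_\<tau>: "arr X (sub j) (sub i) (\<tau> i j) (gen j) = gen i" if ij: "i \<in> J" "j \<in> J" "le i j" for i j
  proof -
    have pj: "(\<lambda>v\<in>snd j. p (fst i) v) \<in> lin K (sub j) (free T)"
      unfolding sub_def by (rule lin_restrict_sub[OF G J(3)[OF ij(2)] p[OF J(2)[OF ij(1)]]])
    \<comment> \<open>Equality is tested after the injection into \<open>X (free T)\<close>, where
      both sides become the tuple of the smaller index.\<close>
    have "arr X (sub i) (free T) (\<lambda>u\<in>snd i. u) (arr X (sub j) (sub i) (\<tau> i j) (gen j)) =
      arr X (sub j) (free T) (\<lambda>v\<in>snd j. p (fst i) v) (gen j)"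
      by (rule additive_comp[OF X sub(1) sub(1) G \<tau> incl pj _ gen(1)])
        (use ij in \<open>auto simp: \<tau>_def le_def\<close>)
    also have "\<dots> = arr X (free T) (free T) (p (fst i)) (arr X (sub j) (free T) (\<lambda>u\<in>snd j. u) (gen j))"
      by (rule additive_comp[OF X sub(1) G G incl p pj _ gen(1), symmetric]) (use ij J in auto)
    also have "\<dots> = tup (fst i)"
      using gen(2)[OF ij(2)] p_tup ij J by (simp add: le_def)
    also have "\<dots> = arr X (sub i) (free T) (\<lambda>u\<in>snd i. u) (gen i)" using gen(2)[OF ij(1)] by simp
    finally show ?thesis
      unfolding sub_def[of i]
      by (rule incl_injective[OF G J(3)[OF ij(1)], rotated 2])
        (use additive_closed[OF X sub(1)[OF ij(2)] sub(1)[OF ij(1)] \<tau>[OF ij] gen(1)[OF ij(2)]]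
          gen(1)[OF ij(1)] in \<open>simp_all add: sub_def\<close>)
  qed
  \<comment> \<open>The index that imposes no relations: \<open>U\<close> is the whole coordinate
    subspace of \<open>A\<close>.\<close>
  have fix_J: "(A, {u \<in> carrier (free T). p A u = u}) \<in> J" if A: "finite A" "A \<subseteq> S" for A
  proof -
    have "supported X (free T) {u \<in> carrier (free T). p A u = u} (tup A)"
      by (rule supported_image[OF G fixed_submodule[OF G p] p tup p_tup])
        (use A p_p[of A A] lin_closed[OF p] in auto)
    then show ?thesis using A fixed_submodule[OF G p] by (simp add: J_def)
  qed
  interpret generating_system K X J le cd sub \<tau> gen
  proof unfold_locales
    show "inj_on cd J"
    proof (rule inj_onI)
      fix i j assume ij: "i \<in> J" "j \<in> J" and "cd i = cd j"
      then have "set_code (fst i) = set_code (fst j)" "set_code (snd i) = set_code (snd j)"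
        by (simp_all add: cd_def)
      moreover have "small (fst i)" "small (fst j)" "small (snd i)" "small (snd j)"
        using small_subset[OF S J(2)] small_subset[OF vect_small[OF G] sub(2)] ij by simp_all
      ultimately show "i = j" by (simp add: set_code_inject prod_eq_iff)
    qed
    show "small (cd ` J)"
    proof (rule small_subset)
      show "small ((\<lambda>(x, y). kpair x y) ` (set_code ` Pow S \<times> set_code ` Pow (carrier (free T))))"
        by (intro small_kpair small_Pow S vect_small[OF G])
      show "cd ` J \<subseteq> (\<lambda>(x, y). kpair x y) ` (set_code ` Pow S \<times> set_code ` Pow (carrier (free T)))"
        using J(2) sub(2) by (fastforce simp: cd_def)
    qed
    show "J \<noteq> {}" using fix_J[of "{}"] by auto
    show "le j j" if "j \<in> J" for j using J(4)[OF that] by (auto simp: le_def)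
    show "i = j" if ij: "i \<in> J" "j \<in> J" "le i j" "le j i" for i j
    proof -
      have eq: "fst i = fst j" using ij(3,4) unfolding le_def by (intro subset_antisym) simp_all
      have "u \<in> snd i" if u: "u \<in> snd j" for u
        using J(4)[OF ij(2) u] u ij(3) eq unfolding le_def by (metis image_subset_iff)
      moreover have "u \<in> snd j" if u: "u \<in> snd i" for u
        using J(4)[OF ij(1) u] u ij(4) eq unfolding le_def by (metis image_subset_iff)
      ultimately have "snd i = snd j" by blast
      with eq show ?thesis by (simp add: prod_eq_iff)
    qed
    show "le i k" if ij: "i \<in> J" "j \<in> J" "k \<in> J" "le i j" "le j k" for i j k
    proof -
      have "p (fst i) u \<in> snd i" if "u \<in> snd k" for u
      proof -
        have "p (fst i) (p (fst j) u) = p (fst i) u"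
          using ij J(2)[OF ij(2)] sub(2)[OF ij(3)] that by (intro p_p) (auto simp: le_def)
        moreover have "p (fst j) u \<in> snd j" using ij(5) that unfolding le_def by blast
        then have "p (fst i) (p (fst j) u) \<in> snd i" using ij(4) unfolding le_def by blast
        ultimately show ?thesis by simp
      qed
      with ij show ?thesis by (auto simp: le_def)
    qed
    show "\<exists>k\<in>J. le i k \<and> le j k" if ij: "i \<in> J" "j \<in> J" for i j
    proof -
      \<comment> \<open>An upper bound takes all generators of both indices and, inside the
        resulting coordinate subspace, the vectors obeying both sets of relations.\<close>
      let ?C = "fst i \<union> fst j"
      have C: "finite ?C" "?C \<subseteq> S" using J(1,2) ij by auto
      let ?Q = "{u \<in> carrier (free T). p ?C u = u}"
      let ?P = "\<lambda>i. {u \<in> carrier (free T). p (fst i) u \<in> snd i}"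
      have sP: "submodule (?P l) K (free T)" if "l \<in> J" for l
        by (rule preimage_submodule[OF G G p[OF J(2)[OF that]] J(3)[OF that]])
      have suP: "supported X (free T) (?P l) (tup ?C)" if "l \<in> J" "fst l \<subseteq> ?C" for l
        by (rule supported_preimage[OF G G J(3)[OF that(1)] p[OF J(2)[OF that(1)]] tup[OF C(2)]])
          (use p_tup[OF that(2) C(2,1)] J(5)[OF that(1)] in simp)
      have sPP: "submodule (?P i \<inter> ?P j) K (free T)" using sP ij by (intro inter_submodule[OF G]) auto
      have sQ: "submodule ?Q K (free T)" by (rule fixed_submodule[OF G p[OF C(2)]])
      have "supported X (free T) (?Q \<inter> (?P i \<inter> ?P j)) (tup ?C)"
        using fix_J[OF C] ij by (intro supported_inter[OF G] sP sPP sQ suP) (auto simp: J_def)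
      then have "(?C, ?Q \<inter> (?P i \<inter> ?P j)) \<in> J"
        using C inter_submodule[OF G sQ sPP] by (simp add: J_def)
      moreover have "le i (?C, ?Q \<inter> (?P i \<inter> ?P j))" "le j (?C, ?Q \<inter> (?P i \<inter> ?P j))"
        by (auto simp: le_def)
      ultimately show ?thesis by blast
    qed
    show "\<tau> j j v = v" if "j \<in> J" "v \<in> carrier (sub j)" for j v
      using that J(4)[OF that(1)] by (simp add: \<tau>_def)
    show "\<tau> i j (\<tau> j k v) = \<tau> i k v"
      if ij: "i \<in> J" "j \<in> J" "k \<in> J" "le i j" "le j k" "v \<in> carrier (sub k)" for i j k v
    proof -
      have "p (fst i) (p (fst j) v) = p (fst i) v"
        using ij J(2)[OF ij(2)] sub(2)[OF ij(3)] by (intro p_p) (auto simp: le_def)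
      then show ?thesis using ij by (auto simp: \<tau>_def le_def)
    qed
    show "\<exists>j\<in>J. \<exists>h\<in>lin K (sub j) V. x = arr X (sub j) V h (gen j)"
      if V: "V \<in> vect K" and x: "x \<in> carrier (obj X V)" for V x
    proof -
      obtain h y where h: "h \<in> lin K (free B) V" and y: "y \<in> S" and xy: "x = arr X (free B) V h y"
        using generate[OF V x] by (auto simp: S_def)
      \<comment> \<open>The single generator \<open>y\<close> without relations; \<open>pr y\<close>
        turns its tuple back into \<open>y\<close>, and \<open>h\<close> sends that to
        \<open>x\<close>.\<close>
      define j where "j = ({y}, {u \<in> carrier (free T). p {y} u = u})"
      have j: "j \<in> J" unfolding j_def by (rule fix_J) (use y in auto)
      let ?q = "\<lambda>v\<in>snd j. pr y v" and ?k = "\<lambda>v\<in>snd j. compose (carrier (free T)) h (pr y) v"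
      have q: "?q \<in> lin K (sub j) (free B)"
        unfolding sub_def by (rule lin_restrict_sub[OF G J(3)[OF j] pr[OF y]])
      have k: "?k \<in> lin K (sub j) V"
        unfolding sub_def by (rule lin_restrict_sub[OF G J(3)[OF j] lin_compose[OF G pr[OF y] h]])
      have "arr X (sub j) (free B) ?q (gen j) = arr X (free T) (free B) (pr y) (tup {y})"
        using additive_comp[OF X sub(1)[OF j] G F incl[OF j] pr[OF y] q _ gen(1)[OF j]] gen(2)[OF j]
        by (simp add: j_def)
      also have "\<dots> = y" by (rule pr_tup[OF y])
      finally have "x = arr X (free B) V h (arr X (sub j) (free B) ?q (gen j))" using xy by simp
      also have "\<dots> = arr X (sub j) V ?k (gen j)"
        by (rule additive_comp[OF X sub(1)[OF j] F V q h k _ gen(1)[OF j]])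
          (use sub(2)[OF j] in \<open>auto simp: compose_eq\<close>)
      finally show ?thesis using j k by blast
    qed
    show "\<exists>k\<in>J. le j k \<and> (\<forall>v\<in>carrier (sub k). h (\<tau> j k v) = \<zero>\<^bsub>V\<^esub>)"
      if j: "j \<in> J" and V: "V \<in> vect K" and h: "h \<in> lin K (sub j) V"
        and zero: "arr X (sub j) V h (gen j) = \<zero>\<^bsub>obj X V\<^esub>" for j V h
    proof -
      \<comment> \<open>The relation is imposed by shrinking the subspace to the kernel of
        \<open>h\<close>, where the generator is still supported.\<close>
      let ?W = "{v \<in> carrier (sub j). h v = \<zero>\<^bsub>V\<^esub>}"
      have W: "submodule ?W K (sub j)" by (rule kernel_submodule[OF sub(1)[OF j] V h])
      have "supported X (sub j) ?W (gen j)" by (rule supported_kernel[OF sub(1)[OF j] V h gen(1)[OF j] zero])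
      then have "supported X (free T) ?W (tup (fst j))"
        using supported_trans[OF G J(3)[OF j], folded sub_def, OF W gen(1)[OF j]] gen(2)[OF j] by simp
      moreover have "submodule ?W K (free T)"
        using submodule_of_sub[OF G J(3)[OF j], folded sub_def, OF W] .
      ultimately have "(fst j, ?W) \<in> J" using J[OF j] by (simp add: J_def)
      moreover have "le j (fst j, ?W)" using J(4)[OF j] by (auto simp: le_def)
      moreover have "h (\<tau> j (fst j, ?W) v) = \<zero>\<^bsub>V\<^esub>" if "v \<in> ?W" for v
        using that J(4)[OF j] by (simp add: \<tau>_def)
      ultimately show ?thesis by (intro bexI[of _ "(fst j, ?W)"]) auto
    qed
  qed (use X sub(1) \<tau> gen(1) gen_\<tau> in auto)
  show ?thesis by (rule small_functor)
qed

end

subsection \<open>Strong spaces are small\<close>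

text \<open>An infinite set of equal coordinates \<open>y\<close> admits an injective self-map missing one point.
  Reindexing along it preserves the sum but removes one summand \<open>y\<close>.\<close>

lemma separated_finite_fibre:
  assumes Y: "separated Y" and I: "small I" and w: "w \<in> carrier (obj Y (free I))"
    and y: "y \<in> carrier (obj Y line)" "y \<noteq> \<zero>\<^bsub>obj Y line\<^esub>"
  shows "finite {i \<in> I. arr Y (free I) line (coord K I i) w = y}"
proof (rule ccontr)
  let ?N = "{i \<in> I. arr Y (free I) line (coord K I i) w = y}"
  note Y' = separated_additive[OF Y] and F = free_vect[OF I]
  assume "infinite ?N"
  then obtain e :: "nat \<Rightarrow> 'u" where e: "inj e" "range e \<subseteq> ?N"
    using infinite_countable_subset by blast
  have eI: "e n \<in> I" and ey: "arr Y (free I) line (coord K I (e n)) w = y" for n using e(2) by auto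
  \<comment> \<open>\<open>g\<close> shifts the sequence \<open>e\<close> by one step and fixes
    everything else; \<open>p\<close> shifts back. Truncated subtraction gives
    \<open>p (e 0) = e 0 = p (e 1)\<close>, so \<open>p\<close> becomes injective once
    \<open>e 0\<close> is left out.\<close>
  define g where "g i = (if i \<in> range e then e (Suc (inv_into UNIV e i)) else i)" for i
  define p where "p i = (if i \<in> range e then e (inv_into UNIV e i - 1) else i)" for i
  define T where "T = reindex I I (I - {e 0}) p (\<lambda>_. \<one>\<^bsub>K\<^esub>)"
  have inv [simp]: "inv_into UNIV e (e n) = n" for n using e(1) by simp
  have ge: "g (e n) = e (Suc n)" and pe: "p (e n) = e (n - 1)" for n by (simp_all add: g_def p_def)
  have go: "g i = i" and po: "p i = i" if "i \<notin> range e" for i using that by (simp_all add: g_def p_def)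
  have ee: "e n = e k \<longleftrightarrow> n = k" for n k using e(1) by (auto dest: injD)
  have pg: "p i = j \<longleftrightarrow> i = g j" if "i \<noteq> e 0" for i j
  proof (cases "i \<in> range e")
    case True
    then obtain n where "i = e n" by auto
    with that have n: "i = e n" "n \<noteq> 0" by (auto intro: ccontr)
    show ?thesis
    proof (cases "j \<in> range e")
      case True
      then obtain k where "j = e k" by auto
      with n show ?thesis by (auto simp: ge pe ee)
    next
      case False
      with n show ?thesis by (auto simp: go pe)
    qed
  next
    case False
    then show ?thesis by (cases "j \<in> range e") (auto simp: po ge go)
  qed
  have gI: "g i \<in> I" if "i \<in> I" for i using that eI by (auto simp: g_def)
  have pI: "p i \<in> I" if "i \<in> I" for i using that eI by (auto simp: p_def)
  have g0: "g i \<noteq> e 0" for i by (cases "i \<in> range e") (auto simp: ge go ee)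
  have pD: "p ` (I - {e 0}) \<subseteq> I" using pI by auto
  have pinj: "inj_on p (I - {e 0})"
  proof (rule inj_onI)
    fix i j assume "i \<in> I - {e 0}" "j \<in> I - {e 0}" "p i = p j"
    then show "i = j" using pg[of i "p j"] pg[of j "p j"] by simp
  qed
  note R = reindex[OF I I Diff_subset pinj pD, of "\<lambda>_. \<one>\<^bsub>K\<^esub>"]
  have T: "T \<in> lin K (free I) (free I)"
    and fT: "\<And>v i. v \<in> carrier (free I) \<Longrightarrow> i \<in> I \<Longrightarrow>
      fapp I (T v) i = (if i = e 0 then \<zero>\<^bsub>K\<^esub> else fapp I v (p i))"
    using R pI I by (simp_all add: T_def)
  \<comment> \<open>Basis vectors go to basis vectors with the same scalar, which is why the sum
    functional is unchanged by \<open>T\<close>.\<close>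
  have Tb: "T (basis_map I i c) = basis_map I (g i) c" if i: "i \<in> I" and c: "c \<in> carrier K" for i c
  proof (rule free_eqI[OF I])
    fix j assume j: "j \<in> I"
    show "fapp I (T (basis_map I i c)) j = fapp I (basis_map I (g i) c) j"
      using i j c gI[OF i] I pI[OF j] fT[OF basis_map_closed[OF I i c] j] pg[of j i] g0[of i] by auto
  qed (use i c gI I lin_closed[OF T] in auto)
  let ?\<sigma> = "sum_functional K I"
  have \<sigma>T: "compose (carrier (free I)) ?\<sigma> T = ?\<sigma>"
    by (rule free_lin_eqI[OF I line_vect lin_compose[OF F T sum_functional_lin[OF I]] sum_functional_lin[OF I]])
      (use I gI in \<open>simp add: compose_eq Tb\<close>)
  let ?T = "arr Y (free I) (free I) T w" and ?b = "basis_map I (e 0)"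
  let ?y = "arr Y line (free I) ?b y"
  have b: "?b \<in> lin K line (free I)" using I eI by simp
  have Tw: "?T \<in> carrier (obj Y (free I))" by (rule additive_closed[OF Y' F F T w])
  have yF: "?y \<in> carrier (obj Y (free I))" by (rule additive_closed[OF Y' line_vect F b y(1)])
  have YF: "obj Y (free I) \<in> vect K" "obj Y line \<in> vect K" using Y' F by simp_all
  \<comment> \<open>By coordinates: at \<open>e 0\<close> the shifted element has zero and the
    correction \<open>?y\<close> contributes \<open>y\<close>; at the other \<open>e n\<close> the
    shift replaces \<open>y\<close> by \<open>y\<close>; off the sequence nothing changes.\<close>
  have "w = ?T \<oplus>\<^bsub>obj Y (free I)\<^esub> ?y"
  proof (rule separated_eqI[OF Y I w])
    fix i assume i: "i \<in> I"
    let ?c = "coord K I i" and ?h = "compose (carrier (free I)) (coord K I i) T"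
    note c = coord_lin[OF I i]
    have h: "?h \<in> lin K (free I) line" by (rule lin_compose[OF F T c])
    have d: "compose (carrier line) ?c ?b \<in> lin K line line" by (rule lin_compose[OF line_vect b c])
    have 1: "arr Y (free I) line ?c ?T = arr Y (free I) line ?h w"
      by (rule additive_comp[OF Y' F F line_vect T c h compose_eq w])
    have 2: "arr Y (free I) line ?c ?y = arr Y line line (compose (carrier line) ?c ?b) y"
      by (rule additive_comp[OF Y' line_vect F line_vect b c d compose_eq y(1)])
    have "arr Y (free I) line ?c w = arr Y (free I) line ?c ?T \<oplus>\<^bsub>obj Y line\<^esub> arr Y (free I) line ?c ?y"
    proof (cases "i = e 0")
      case True
      have "arr Y (free I) line ?h w = \<zero>\<^bsub>obj Y line\<^esub>"
        by (rule additive_zero[OF Y' F line_vect h _ w])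
          (use True i fT I lin_closed[OF T] in \<open>simp add: compose_eq\<close>)
      moreover have "arr Y line line (compose (carrier line) ?c ?b) y = y"
        by (rule additive_id[OF Y' line_vect d _ y(1)]) (use True i I in \<open>simp add: compose_eq\<close>)
      ultimately show ?thesis using 1 2 True ey y YF by simp
    next
      case False
      have "?h = coord K I (p i)"
        by (rule lin_eqI[OF h coord_lin[OF I pI[OF i]]])
          (use False i I fT lin_closed[OF T] pI in \<open>simp add: compose_eq\<close>)
      moreover have "arr Y (free I) line (coord K I (p i)) w = arr Y (free I) line ?c w"
      proof (cases "i \<in> range e")
        case True
        then obtain n where "i = e n" by auto
        then show ?thesis using ey pe by simp
      qed (simp add: po)
      moreover have "arr Y line line (compose (carrier line) ?c ?b) y = \<zero>\<^bsub>obj Y line\<^esub>"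
        by (rule additive_zero[OF Y' line_vect line_vect d _ y(1)])
          (use False i I eI in \<open>simp add: compose_eq\<close>)
      ultimately show ?thesis using 1 2 YF additive_closed[OF Y' F line_vect c w] by simp
    qed
    then show "arr Y (free I) line ?c w = arr Y (free I) line ?c (?T \<oplus>\<^bsub>obj Y (free I)\<^esub> ?y)"
      using lin_add[OF additive_lin[OF Y' F line_vect c] Tw yF] by simp
  qed (use Tw yF YF in simp)
  then have "arr Y (free I) line ?\<sigma> w = arr Y (free I) line ?\<sigma> (?T \<oplus>\<^bsub>obj Y (free I)\<^esub> ?y)" by simp
  also have "\<dots> = arr Y (free I) line ?\<sigma> ?T \<oplus>\<^bsub>obj Y line\<^esub> arr Y (free I) line ?\<sigma> ?y"
    by (rule lin_add[OF additive_lin[OF Y' F line_vect sum_functional_lin[OF I]] Tw yF])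
  also have "arr Y (free I) line ?\<sigma> ?T = arr Y (free I) line ?\<sigma> w"
    by (rule additive_comp[OF Y' F F line_vect T sum_functional_lin[OF I] sum_functional_lin[OF I] _ w])
      (use fun_cong[OF \<sigma>T] compose_eq in metis)
  also have "arr Y (free I) line ?\<sigma> ?y = arr Y line line (\<lambda>c\<in>carrier line. c) y"
    by (rule additive_comp[OF Y' line_vect F line_vect b sum_functional_lin[OF I] lin_id[OF line_vect] _ y(1)])
      (use I eI in simp)
  also have "\<dots> = y" by (rule additive_id[OF Y' line_vect lin_id[OF line_vect] _ y(1)]) simp
  finally have s: "arr Y (free I) line ?\<sigma> w = arr Y (free I) line ?\<sigma> w \<oplus>\<^bsub>obj Y line\<^esub> y" .
  interpret L: module K "obj Y line" by (rule vect_module[OF YF(2)])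
  have c\<sigma>: "arr Y (free I) line ?\<sigma> w \<in> carrier (obj Y line)"
    by (rule additive_closed[OF Y' F line_vect sum_functional_lin[OF I] w])
  have "y = \<zero>\<^bsub>obj Y line\<^esub>" using s L.M.add.l_cancel_one'[OF c\<sigma> y(1)] by blast
  with y(2) show False by simp
qed

text \<open>An element of \<open>Y (free I)\<close> is determined by its nonzero coordinates, and
  each nonzero value occurs finitely often. Its support therefore injects into pairs of a value and
  a number, a set that does not depend on \<open>I\<close>. General \<open>V\<close> are reached as
  retracts of free spaces.\<close>

lemma separated_bounded:
  assumes Y: "separated Y"
  obtains B where "small B" "\<And>V x. V \<in> vect K \<Longrightarrow> x \<in> carrier (obj Y V) \<Longrightarrow>
      \<exists>h\<in>lin K (free B) V. \<exists>y\<in>carrier (obj Y (free B)). x = arr Y (free B) V h y"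
proof -
  note Y' = separated_additive[OF Y]
  obtain Z :: "'u set" and e :: "nat \<Rightarrow> 'u" where Z: "small Z" "inj e" "range e \<subseteq> Z"
    by (rule small_infinite)
  \<comment> \<open>The first component ranges over the possible values of coordinates, the second
    over enough labels to number any finite fibre.\<close>
  define B where "B = (\<lambda>(y, n). kpair y n) ` (carrier (obj Y line) \<times> Z)"
  have B: "small B"
    unfolding B_def by (rule small_kpair[OF vect_small Z(1)]) (use Y' in simp)
  note FB = free_vect[OF B]
  have "\<exists>h\<in>lin K (free B) V. \<exists>y\<in>carrier (obj Y (free B)). x = arr Y (free B) V h y"
    if V: "V \<in> vect K" and x: "x \<in> carrier (obj Y V)" for V x
  proof -
    obtain I s r where I: "small I" and s: "s \<in> lin K V (free I)" and r: "r \<in> lin K (free I) V"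
      and rs: "\<And>v. v \<in> carrier V \<Longrightarrow> r (s v) = v"
      by (rule free_retract[OF V]) (rule that)
    note F = free_vect[OF I]
    define w where "w = arr Y V (free I) s x"
    have w: "w \<in> carrier (obj Y (free I))" unfolding w_def by (rule additive_closed[OF Y' V F s x])
    let ?w = "\<lambda>i. arr Y (free I) line (coord K I i) w"
    have wc: "?w i \<in> carrier (obj Y line)" if "i \<in> I" for i
      by (rule additive_closed[OF Y' F line_vect coord_lin[OF I that] w])
    let ?D = "{i \<in> I. ?w i \<noteq> \<zero>\<^bsub>obj Y line\<^esub>}" and ?fib = "\<lambda>i. {j \<in> I. ?w j = ?w i}"
    \<comment> \<open>An index is renamed by its value and its position in the fibre of that value;
      finiteness of the fibre makes the numbering injective.\<close>
    define g where "g i = kpair (?w i) (e (to_nat_on (?fib i) i))" for i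
    have g: "inj_on g ?D"
    proof (rule inj_onI)
      fix i j assume i: "i \<in> ?D" and j: "j \<in> ?D" and "g i = g j"
      then have eq: "?w i = ?w j" "to_nat_on (?fib i) i = to_nat_on (?fib j) j"
        using Z(2) by (auto simp: g_def dest: injD)
      have "finite (?fib i)" using separated_finite_fibre[OF Y I w] wc i by auto
      then have "inj_on (to_nat_on (?fib i)) (?fib i)"
        by (intro inj_on_to_nat_on countable_finite)
      moreover have "i \<in> ?fib i" "j \<in> ?fib i" "to_nat_on (?fib i) i = to_nat_on (?fib i) j"
        using i j eq by auto
      ultimately show "i = j" by (auto dest: inj_onD)
    qed
    have gB: "g ` ?D \<subseteq> B" using Z(3) wc by (auto simp: g_def B_def)
    let ?ig = "inv_into ?D g"
    \<comment> \<open>\<open>\<alpha>\<close> renames the coordinates in the support and drops the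
      rest; \<open>\<beta>\<close> undoes the renaming and fills up with zeros.\<close>
    define \<alpha> where "\<alpha> = reindex I B (g ` ?D) ?ig (\<lambda>_. \<one>\<^bsub>K\<^esub>)"
    define \<beta> where "\<beta> = reindex B I ?D g (\<lambda>_. \<one>\<^bsub>K\<^esub>)"
    have igD: "?ig ` g ` ?D \<subseteq> I" using g by (auto simp: inv_into_f_f)
    have DI: "?D \<subseteq> I" by auto
    note R\<alpha> = reindex[OF B I gB inj_on_inv_into[OF order_refl] igD, of "\<lambda>_. \<one>\<^bsub>K\<^esub>"]
    note R\<beta> = reindex[OF I B DI g gB, of "\<lambda>_. \<one>\<^bsub>K\<^esub>"]
    have \<alpha>: "\<alpha> \<in> lin K (free I) (free B)" unfolding \<alpha>_def by (rule R\<alpha>(1)) simp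
    have \<beta>: "\<beta> \<in> lin K (free B) (free I)" unfolding \<beta>_def by (rule R\<beta>(1)) simp
    have \<beta>\<alpha>: "fapp I (\<beta> (\<alpha> v)) i = (if i \<in> ?D then fapp I v i else \<zero>\<^bsub>K\<^esub>)"
      if v: "v \<in> carrier (free I)" and i: "i \<in> I" for v i
    proof -
      have av: "\<alpha> v \<in> carrier (free B)" by (rule lin_closed[OF \<alpha> v])
      have "fapp I (\<beta> (\<alpha> v)) i = (if i \<in> ?D then \<one>\<^bsub>K\<^esub> \<otimes>\<^bsub>K\<^esub> fapp B (\<alpha> v) (g i) else \<zero>\<^bsub>K\<^esub>)"
        unfolding \<beta>_def by (rule R\<beta>(2)) (use av i in auto)
      moreover have "fapp B (\<alpha> v) (g i) = fapp I v i" if i: "i \<in> ?D"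
      proof -
        have "fapp B (\<alpha> v) (g i) = (if g i \<in> g ` ?D then \<one>\<^bsub>K\<^esub> \<otimes>\<^bsub>K\<^esub> fapp I v (?ig (g i)) else \<zero>\<^bsub>K\<^esub>)"
          unfolding \<alpha>_def by (rule R\<alpha>(2)) (use v i gB in auto)
        with i v I show ?thesis by (simp add: inv_into_f_f[OF g i])
      qed
      ultimately show ?thesis using v i I by simp
    qed
    define u where "u = arr Y (free I) (free B) \<alpha> w"
    have u: "u \<in> carrier (obj Y (free B))" unfolding u_def by (rule additive_closed[OF Y' F FB \<alpha> w])
    \<comment> \<open>The composite of \<open>\<alpha>\<close> and \<open>\<beta>\<close> erases
      only coordinates at which \<open>w\<close> has the value zero already, so all coordinates of
      both sides agree.\<close>
    have "arr Y (free B) (free I) \<beta> u = w"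
    proof (rule separated_eqI[OF Y I additive_closed[OF Y' FB F \<beta> u] w])
      fix i assume i: "i \<in> I"
      let ?h = "compose (carrier (free I)) (compose (carrier (free B)) (coord K I i) \<beta>) \<alpha>"
      note c = coord_lin[OF I i]
      have c\<beta>: "compose (carrier (free B)) (coord K I i) \<beta> \<in> lin K (free B) line"
        by (rule lin_compose[OF FB \<beta> c])
      have h: "?h \<in> lin K (free I) line" by (rule lin_compose[OF F \<alpha> c\<beta>])
      have hv: "?h v = (if i \<in> ?D then fapp I v i else \<zero>\<^bsub>K\<^esub>)" if "v \<in> carrier (free I)" for v
        using \<beta>\<alpha>[OF that i] lin_closed[OF \<alpha> that] lin_closed[OF \<beta> lin_closed[OF \<alpha> that]] that I
        by (simp add: compose_eq)
      have "arr Y (free I) line (coord K I i) (arr Y (free B) (free I) \<beta> u) = arr Y (free I) line ?h w"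
        using additive_comp[OF Y' FB F line_vect \<beta> c c\<beta> compose_eq u]
          additive_comp[OF Y' F FB line_vect \<alpha> c\<beta> h compose_eq w] by (simp only: u_def)
      also have "\<dots> = ?w i"
      proof (cases "i \<in> ?D")
        case True
        have "?h = coord K I i" by (rule lin_eqI[OF h c]) (use True hv I in simp)
        then show ?thesis by simp
      next
        case False
        have "arr Y (free I) line ?h w = \<zero>\<^bsub>obj Y line\<^esub>"
          by (rule additive_zero[OF Y' F line_vect h _ w]) (simp only: hv False if_False self_module_simps)
        with False i show ?thesis by simp
      qed
      finally show "arr Y (free I) line (coord K I i) (arr Y (free B) (free I) \<beta> u) = ?w i" .
    qed
    then have "arr Y (free I) V r w = arr Y (free I) V r (arr Y (free B) (free I) \<beta> u)" by simp
    also have "\<dots> = arr Y (free B) V (compose (carrier (free B)) r \<beta>) u"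
      by (rule additive_comp[OF Y' FB F V \<beta> r lin_compose[OF FB \<beta> r] compose_eq u])
    finally have "arr Y (free I) V r w = arr Y (free B) V (compose (carrier (free B)) r \<beta>) u" .
    moreover have "arr Y (free I) V r w = arr Y V V (\<lambda>v\<in>carrier V. v) x"
      unfolding w_def by (rule additive_comp[OF Y' V F V s r lin_id[OF V] _ x]) (simp add: rs)
    moreover have "\<dots> = x" by (rule additive_id[OF Y' V lin_id[OF V] _ x]) simp
    ultimately show ?thesis using u lin_compose[OF FB \<beta> r] by metis
  qed
  with B show ?thesis by (rule that)
qed

text \<open>Naturality of \<open>q\<close> carries the generation by \<open>free B\<close> from
  \<open>Y\<close> to \<open>P\<close>. The typical \<open>P\<close> is a cokernel that is not yet
  known to be separated.\<close>

lemma separated_quotient_small: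
  assumes Y: "separated Y" and P: "additive_functor K P" and q: "q \<in> nat_trans K Y P"
    and surj: "\<And>V. V \<in> vect K \<Longrightarrow> q V ` carrier (obj Y V) = carrier (obj P V)"
  shows "small_functor K P"
proof -
  obtain B where B: "small B" and gen: "\<And>V x. V \<in> vect K \<Longrightarrow> x \<in> carrier (obj Y V) \<Longrightarrow>
      \<exists>h\<in>lin K (free B) V. \<exists>y\<in>carrier (obj Y (free B)). x = arr Y (free B) V h y"
    by (rule separated_bounded[OF Y]) (rule that)
  show ?thesis
  proof (rule bounded_generation_small[OF P B])
    fix V z assume V: "V \<in> vect K" and "z \<in> carrier (obj P V)"
    then obtain x where x: "x \<in> carrier (obj Y V)" "z = q V x" using surj by blast
    then obtain h y where h: "h \<in> lin K (free B) V" and y: "y \<in> carrier (obj Y (free B))"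
      and "x = arr Y (free B) V h y" using gen[OF V] by blast
    then have "z = arr P (free B) V h (q (free B) y)"
      using x nt_nat[OF q free_vect[OF B] V h y] by simp
    with h nt_closed[OF q free_vect[OF B] y]
    show "\<exists>h\<in>lin K (free B) V. \<exists>y\<in>carrier (obj P (free B)). z = arr P (free B) V h y" by blast
  qed
qed

lemma separated_small:
  assumes Y: "separated Y" shows "small_functor K Y"
proof -
  obtain B where B: "small B" and gen: "\<And>V x. V \<in> vect K \<Longrightarrow> x \<in> carrier (obj Y V) \<Longrightarrow>
      \<exists>h\<in>lin K (free B) V. \<exists>y\<in>carrier (obj Y (free B)). x = arr Y (free B) V h y"
    by (rule separated_bounded[OF Y]) (rule that)
  show ?thesis by (rule bounded_generation_small[OF separated_additive[OF Y] B gen])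
qed

subsection \<open>Cokernels\<close>

text \<open>The cokernel is realised inside the target, as the image of chosen linear projections with
  kernel the image of \<open>m\<close>.\<close>

definition coker_proj ::
  "'u vfunctor \<Rightarrow> 'u vfunctor \<Rightarrow> (('u, 'u) module \<Rightarrow> 'u \<Rightarrow> 'u) \<Rightarrow> ('u, 'u) module \<Rightarrow> 'u \<Rightarrow> 'u" where
  "coker_proj X Y m = (\<lambda>V\<in>vect K. SOME \<phi>. \<phi> \<in> lin K (obj Y V) (obj Y V) \<and>
     (\<forall>y\<in>carrier (obj Y V). \<phi> y = \<zero>\<^bsub>obj Y V\<^esub> \<longleftrightarrow> y \<in> m V ` carrier (obj X V)) \<and>
     (\<forall>y\<in>carrier (obj Y V). \<phi> (\<phi> y) = \<phi> y))"

definition coker :: "'u vfunctor \<Rightarrow> 'u vfunctor \<Rightarrow> (('u, 'u) module \<Rightarrow> 'u \<Rightarrow> 'u) \<Rightarrow> 'u vfunctor" where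
  "coker X Y m = \<lparr>obj = (\<lambda>V. (obj Y V)\<lparr>carrier := coker_proj X Y m V ` carrier (obj Y V)\<rparr>),
     arr = (\<lambda>V W f. \<lambda>p\<in>coker_proj X Y m V ` carrier (obj Y V). coker_proj X Y m W (arr Y V W f p))\<rparr>"

context
  fixes X Y m
  assumes X: "additive_functor K X" and Y: "additive_functor K Y" and m: "m \<in> nat_trans K X Y"
begin

abbreviation "cp \<equiv> coker_proj X Y m"

lemma
  assumes V: "V \<in> vect K"
  shows coker_proj_lin: "cp V \<in> lin K (obj Y V) (obj Y V)"
    and coker_proj_eq_zero: "y \<in> carrier (obj Y V) \<Longrightarrow>
      cp V y = \<zero>\<^bsub>obj Y V\<^esub> \<longleftrightarrow> y \<in> m V ` carrier (obj X V)"
    and coker_proj_idem: "y \<in> carrier (obj Y V) \<Longrightarrow> cp V (cp V y) = cp V y"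
proof -
  have XV: "obj X V \<in> vect K" and YV: "obj Y V \<in> vect K" using X Y V by simp_all
  let ?P = "\<lambda>\<phi>. \<phi> \<in> lin K (obj Y V) (obj Y V) \<and>
     (\<forall>y\<in>carrier (obj Y V). \<phi> y = \<zero>\<^bsub>obj Y V\<^esub> \<longleftrightarrow> y \<in> m V ` carrier (obj X V)) \<and>
     (\<forall>y\<in>carrier (obj Y V). \<phi> (\<phi> y) = \<phi> y)"
  obtain \<phi> where "?P \<phi>"
    using projection_exists[OF YV image_submodule[OF XV YV nt_lin[OF m V]]] by metis
  then have "?P (SOME \<phi>. ?P \<phi>)" by (rule someI[where P = ?P])
  then have "?P (cp V)" unfolding coker_proj_def restrict_apply'[OF V] .
  then show "cp V \<in> lin K (obj Y V) (obj Y V)"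
    "y \<in> carrier (obj Y V) \<Longrightarrow> cp V y = \<zero>\<^bsub>obj Y V\<^esub> \<longleftrightarrow> y \<in> m V ` carrier (obj X V)"
    "y \<in> carrier (obj Y V) \<Longrightarrow> cp V (cp V y) = cp V y" by blast+
qed

lemma coker_proj_diff:
  assumes V: "V \<in> vect K" and y: "y \<in> carrier (obj Y V)"
  shows "\<exists>x\<in>carrier (obj X V). y \<ominus>\<^bsub>obj Y V\<^esub> cp V y = m V x"
proof -
  have YV: "obj Y V \<in> vect K" using Y V by simp
  note c = coker_proj_lin[OF V]
  have cy: "cp V y \<in> carrier (obj Y V)" by (rule lin_closed[OF c y])
  have "cp V (y \<ominus>\<^bsub>obj Y V\<^esub> cp V y) = \<zero>\<^bsub>obj Y V\<^esub>"
    using lin_minus[OF c YV YV y cy] coker_proj_idem[OF V y] vect_minus_eq_zero_iff[OF YV cy cy] by simp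
  then show ?thesis using coker_proj_eq_zero[OF V vect_minus_closed[OF YV y cy]] by blast
qed

text \<open>The vectors \<open>y\<close> and \<open>cp V y\<close> differ by an element of the image
  of \<open>m\<close>. In effect, the chosen representative of a class may be used in place of any
  other.\<close>

lemma kills_image_coker_proj:
  assumes V: "V \<in> vect K" and W: "W \<in> vect K" and f: "f \<in> lin K (obj Y V) W"
    and y: "y \<in> carrier (obj Y V)" and kill: "\<And>x. x \<in> carrier (obj X V) \<Longrightarrow> f (m V x) = \<zero>\<^bsub>W\<^esub>"
  shows "f (cp V y) = f y"
proof -
  have YV: "obj Y V \<in> vect K" using Y V by simp
  have cy: "cp V y \<in> carrier (obj Y V)" by (rule lin_closed[OF coker_proj_lin[OF V] y])
  have "f y \<ominus>\<^bsub>W\<^esub> f (cp V y) = \<zero>\<^bsub>W\<^esub>"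
    using coker_proj_diff[OF V y] kill lin_minus[OF f YV W y cy] by auto
  then show ?thesis using vect_minus_eq_zero_iff[OF W lin_closed[OF f y] lin_closed[OF f cy]] by simp
qed

text \<open>The projections are chosen separately for each \<open>V\<close> and need not commute
  with the arrows of \<open>Y\<close>. They do so after a further projection in the target, because
  arrows preserve the image of \<open>m\<close>; this gives functoriality of
  \<open>coker\<close>.\<close>

lemma coker_proj_arr:
  assumes V: "V \<in> vect K" and W: "W \<in> vect K" and f: "f \<in> lin K V W" and y: "y \<in> carrier (obj Y V)"
  shows "cp W (arr Y V W f (cp V y)) = cp W (arr Y V W f y)"
proof -
  have YV: "obj Y V \<in> vect K" "obj Y W \<in> vect K" using Y V W by simp_all
  let ?g = "compose (carrier (obj Y V)) (cp W) (arr Y V W f)"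
  have g: "?g \<in> lin K (obj Y V) (obj Y W)"
    by (rule lin_compose[OF YV(1) additive_lin[OF Y V W f] coker_proj_lin[OF W]])
  have "?g (cp V y) = ?g y"
  proof (rule kills_image_coker_proj[OF V YV(2) g y])
    fix x assume x: "x \<in> carrier (obj X V)"
    have "m W (arr X V W f x) = arr Y V W f (m V x)" by (rule nt_nat[OF m V W f x])
    moreover have "m W (arr X V W f x) \<in> carrier (obj Y W)" "arr X V W f x \<in> carrier (obj X W)"
      using additive_closed[OF X V W f x] nt_closed[OF m W] by auto
    ultimately have "cp W (arr Y V W f (m V x)) = \<zero>\<^bsub>obj Y W\<^esub>"
      using coker_proj_eq_zero[OF W, of "m W (arr X V W f x)"] by (metis imageI)
    then show "?g (m V x) = \<zero>\<^bsub>obj Y W\<^esub>" using nt_closed[OF m V x] by (simp add: compose_eq)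
  qed
  then show ?thesis using y lin_closed[OF coker_proj_lin[OF V] y] by (simp add: compose_eq)
qed

lemma coker_simps [simp]:
  "carrier (obj (coker X Y m) V) = cp V ` carrier (obj Y V)"
  "add (obj (coker X Y m) V) = add (obj Y V)" "smult (obj (coker X Y m) V) = smult (obj Y V)"
  "zero (obj (coker X Y m) V) = zero (obj Y V)"
  "arr (coker X Y m) V W f = (\<lambda>p\<in>cp V ` carrier (obj Y V). cp W (arr Y V W f p))"
  by (simp_all add: coker_def)

lemma coker_carrier:
  assumes V: "V \<in> vect K" and p: "p \<in> cp V ` carrier (obj Y V)"
  shows "p \<in> carrier (obj Y V)" "cp V p = p"
  using p lin_closed[OF coker_proj_lin[OF V]] coker_proj_idem[OF V] by auto

lemma coker_vect: "V \<in> vect K \<Longrightarrow> obj (coker X Y m) V \<in> vect K"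
  unfolding coker_def using sub_vect[OF _ image_submodule[OF _ _ coker_proj_lin]] Y by simp

lemma coker_additive: "additive_functor K (coker X Y m)"
  unfolding additive_functor_def
proof (intro conjI ballI)
  fix V assume V: "V \<in> vect K"
  show "obj (coker X Y m) V \<in> vect K" by (rule coker_vect[OF V])
  show "arr (coker X Y m) V V (\<lambda>v\<in>carrier V. v) = (\<lambda>x\<in>carrier (obj (coker X Y m) V). x)"
    unfolding coker_simps
  proof (rule restrict_ext)
    fix p assume p: "p \<in> cp V ` carrier (obj Y V)"
    have "arr Y V V (\<lambda>v\<in>carrier V. v) p = p"
      by (rule additive_id[OF Y V lin_id[OF V] _ coker_carrier(1)[OF V p]]) simp
    then show "cp V (arr Y V V (\<lambda>v\<in>carrier V. v) p) = p"
      using coker_carrier(2)[OF V p] by (simp only:)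
  qed
next
  fix U V W f g
  assume U: "U \<in> vect K" and V: "V \<in> vect K" and W: "W \<in> vect K" and f: "f \<in> lin K U V" and g: "g \<in> lin K V W"
  note gf = lin_compose[OF U f g]
  show "arr (coker X Y m) U W (compose (carrier U) g f) =
    compose (carrier (obj (coker X Y m) U)) (arr (coker X Y m) V W g) (arr (coker X Y m) U V f)"
    unfolding coker_simps compose_def[of "cp U ` carrier (obj Y U)"]
  proof (rule restrict_ext)
    fix p assume p: "p \<in> cp U ` carrier (obj Y U)"
    note pY = coker_carrier(1)[OF U p]
    note fp = additive_closed[OF Y U V f pY]
    have "cp W (arr Y U W (compose (carrier U) g f) p) = cp W (arr Y V W g (arr Y U V f p))"
      using additive_comp[OF Y U V W f g gf compose_eq pY] by simp
    also have "\<dots> = cp W (arr Y V W g (cp V (arr Y U V f p)))"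
      by (rule coker_proj_arr[OF V W g fp, symmetric])
    finally show "cp W (arr Y U W (compose (carrier U) g f) p) =
      (\<lambda>p\<in>cp V ` carrier (obj Y V). cp W (arr Y V W g p))
        ((\<lambda>p\<in>cp U ` carrier (obj Y U). cp V (arr Y U V f p)) p)"
      using p fp by simp
  qed
next
  fix V W assume V: "V \<in> vect K" and W: "W \<in> vect K"
  have YV: "obj Y V \<in> vect K" "obj Y W \<in> vect K" using Y V W by simp_all
  note cW = coker_proj_lin[OF W]
  note cc = coker_carrier[OF V]
  show "linear_map K (hom_module K V W) (hom_module K (obj (coker X Y m) V) (obj (coker X Y m) W))
     (arr (coker X Y m) V W)"
    unfolding linear_map_def hom_module_simps
  proof (intro conjI ballI funcsetI)
    fix f assume f: "f \<in> lin K V W"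
    note Yf = additive_lin[OF Y V W f]
    show "arr (coker X Y m) V W f \<in> lin K (obj (coker X Y m) V) (obj (coker X Y m) W)"
    proof (rule linI)
      fix x y assume x: "x \<in> carrier (obj (coker X Y m) V)" and y: "y \<in> carrier (obj (coker X Y m) V)"
      have "x \<oplus>\<^bsub>obj (coker X Y m) V\<^esub> y \<in> carrier (obj (coker X Y m) V)"
        by (rule vect_add_closed[OF coker_vect[OF V] x y])
      moreover have "x \<in> carrier (obj Y V)" "y \<in> carrier (obj Y V)" using x y cc(1) by simp_all
      ultimately show "arr (coker X Y m) V W f (x \<oplus>\<^bsub>obj (coker X Y m) V\<^esub> y) =
        arr (coker X Y m) V W f x \<oplus>\<^bsub>obj (coker X Y m) W\<^esub> arr (coker X Y m) V W f y"
        using x y lin_add[OF Yf, of x y] lin_add[OF cW, of "arr Y V W f x" "arr Y V W f y"] lin_closed[OF Yf]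
        by simp
    next
      fix c x assume c: "c \<in> carrier K" and x: "x \<in> carrier (obj (coker X Y m) V)"
      have "c \<odot>\<^bsub>obj (coker X Y m) V\<^esub> x \<in> carrier (obj (coker X Y m) V)"
        by (rule vect_smult_closed[OF coker_vect[OF V] c x])
      moreover have "x \<in> carrier (obj Y V)" using x cc(1) by simp
      ultimately show "arr (coker X Y m) V W f (c \<odot>\<^bsub>obj (coker X Y m) V\<^esub> x) =
        c \<odot>\<^bsub>obj (coker X Y m) W\<^esub> arr (coker X Y m) V W f x"
        using x c lin_smult[OF Yf c, of x] lin_smult[OF cW c, of "arr Y V W f x"] lin_closed[OF Yf]
        by simp
    next
      fix x assume x: "x \<in> carrier (obj (coker X Y m) V)"
      then have "arr Y V W f x \<in> carrier (obj Y W)" using cc(1)[of x] lin_closed[OF Yf] by simp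
      with x show "arr (coker X Y m) V W f x \<in> carrier (obj (coker X Y m) W)" by simp
    qed simp
  next
    fix f g assume f: "f \<in> lin K V W" and g: "g \<in> lin K V W"
    note fg = lin_add_map[OF V W f g]
    show "arr (coker X Y m) V W (\<lambda>v\<in>carrier V. f v \<oplus>\<^bsub>W\<^esub> g v) =
      (\<lambda>v\<in>carrier (obj (coker X Y m) V). arr (coker X Y m) V W f v \<oplus>\<^bsub>obj (coker X Y m) W\<^esub> arr (coker X Y m) V W g v)"
      unfolding coker_simps
    proof (rule restrict_ext)
      fix p assume p: "p \<in> cp V ` carrier (obj Y V)"
      note pY = cc(1)[OF p]
      have "arr Y V W (\<lambda>v\<in>carrier V. f v \<oplus>\<^bsub>W\<^esub> g v) p = arr Y V W f p \<oplus>\<^bsub>obj Y W\<^esub> arr Y V W g p"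
        by (rule additive_add[OF Y V W f g fg _ pY]) simp
      with p show "cp W (arr Y V W (\<lambda>v\<in>carrier V. f v \<oplus>\<^bsub>W\<^esub> g v) p) =
        (\<lambda>p\<in>cp V ` carrier (obj Y V). cp W (arr Y V W f p)) p \<oplus>\<^bsub>obj Y W\<^esub>
        (\<lambda>p\<in>cp V ` carrier (obj Y V). cp W (arr Y V W g p)) p"
        using lin_add[OF cW additive_closed[OF Y V W f pY] additive_closed[OF Y V W g pY]] by simp
    qed
  next
    fix c f assume c: "c \<in> carrier K" and f: "f \<in> lin K V W"
    note cf = lin_smult_map[OF V W f c]
    show "arr (coker X Y m) V W (\<lambda>v\<in>carrier V. c \<odot>\<^bsub>W\<^esub> f v) =
      (\<lambda>v\<in>carrier (obj (coker X Y m) V). c \<odot>\<^bsub>obj (coker X Y m) W\<^esub> arr (coker X Y m) V W f v)"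
      unfolding coker_simps
    proof (rule restrict_ext)
      fix p assume p: "p \<in> cp V ` carrier (obj Y V)"
      note pY = cc(1)[OF p]
      have "arr Y V W (\<lambda>v\<in>carrier V. c \<odot>\<^bsub>W\<^esub> f v) p = c \<odot>\<^bsub>obj Y W\<^esub> arr Y V W f p"
        by (rule additive_smult[OF Y V W f c cf _ pY]) simp
      with p show "cp W (arr Y V W (\<lambda>v\<in>carrier V. c \<odot>\<^bsub>W\<^esub> f v) p) =
        c \<odot>\<^bsub>obj Y W\<^esub> (\<lambda>p\<in>cp V ` carrier (obj Y V). cp W (arr Y V W f p)) p"
        using lin_smult[OF cW c additive_closed[OF Y V W f pY]] by simp
    qed
  qed
qed

lemma coker_proj_nat_trans: "cp \<in> nat_trans K Y (coker X Y m)"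
  unfolding nat_trans_def
proof (intro CollectI conjI ballI)
  show "cp \<in> extensional (vect K)" by (simp add: coker_proj_def)
  fix V assume V: "V \<in> vect K"
  show "cp V \<in> lin K (obj Y V) (obj (coker X Y m) V)"
    unfolding coker_def vfunctor.simps by (rule lin_codomain[OF coker_proj_lin[OF V]]) simp
  fix W f assume W: "W \<in> vect K" and f: "f \<in> lin K V W"
  show "compose (carrier (obj Y V)) (cp W) (arr Y V W f) =
    compose (carrier (obj Y V)) (arr (coker X Y m) V W f) (cp V)"
    unfolding compose_def coker_simps
    by (rule restrict_ext) (use coker_proj_arr[OF V W f] in simp)
qed

text \<open>A transformation killing \<open>m\<close> does not distinguish a vector from its
  representative, so its restriction to representatives is the induced map. The category
  \<open>\<C>\<close> is left open, so that the quotient need only be known to belong to it.\<close>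

lemma cokernel_coker:
  assumes \<C>: "\<C> (coker X Y m)" and \<C>_additive: "\<And>Z. \<C> Z \<Longrightarrow> additive_functor K Z"
  shows "cokernel_in K \<C> X Y m (coker X Y m) cp"
  unfolding cokernel_in_def
proof (intro conjI allI impI ballI)
  show "nt_comp K X cp m = nt_zero K X (coker X Y m)"
  proof (rule nt_comp_eqI[OF nt_zero_nat_trans[OF X coker_additive]])
    fix V x assume V: "V \<in> vect K" and x: "x \<in> carrier (obj X V)"
    then have "cp V (m V x) = \<zero>\<^bsub>obj Y V\<^esub>"
      using coker_proj_eq_zero[OF V nt_closed[OF m V x]] by blast
    with V x show "cp V (m V x) = nt_zero K X (coker X Y m) V x" by simp
  qed
next
  fix Z g assume "\<C> Z" and g: "g \<in> nat_trans K Y Z" and gm: "nt_comp K X g m = nt_zero K X Z"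
  have Z: "additive_functor K Z" by (rule \<C>_additive) fact
  have kill: "g V (m V x) = \<zero>\<^bsub>obj Z V\<^esub>" if "V \<in> vect K" "x \<in> carrier (obj X V)" for V x
    using fun_cong[OF fun_cong[OF gm], of V x] that by simp
  have gcp: "g V (cp V y) = g V y" if V: "V \<in> vect K" and y: "y \<in> carrier (obj Y V)" for V y
    by (rule kills_image_coker_proj[OF V additive_obj[OF Z V] nt_lin[OF g V] y kill[OF V]])
  let ?h = "\<lambda>V\<in>vect K. \<lambda>p\<in>carrier (obj (coker X Y m) V). g V p"
  have h: "?h \<in> nat_trans K (coker X Y m) Z"
  proof (rule nat_transI[OF additive_valued[OF coker_additive]])
    fix V p assume V: "V \<in> vect K" and p: "p \<in> carrier (obj (coker X Y m) V)"
    then have pY: "p \<in> carrier (obj Y V)" using coker_carrier(1)[OF V, of p] by simp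
    show "g V p \<in> carrier (obj Z V)" by (rule nt_closed[OF g V pY])
    show "g V (p \<oplus>\<^bsub>obj (coker X Y m) V\<^esub> p') = g V p \<oplus>\<^bsub>obj Z V\<^esub> g V p'"
      if "p' \<in> carrier (obj (coker X Y m) V)" for p'
      using lin_add[OF nt_lin[OF g V] pY coker_carrier(1)[OF V, of p']] that by simp
    show "g V (c \<odot>\<^bsub>obj (coker X Y m) V\<^esub> p) = c \<odot>\<^bsub>obj Z V\<^esub> g V p" if "c \<in> carrier K" for c
      using lin_smult[OF nt_lin[OF g V] that pY] by simp
    show "g W (arr (coker X Y m) V W f p) = arr Z V W f (g V p)" if W: "W \<in> vect K" and f: "f \<in> lin K V W" for W f
      using p gcp[OF W additive_closed[OF Y V W f pY]] nt_nat[OF g V W f pY] by simp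
  qed
  show "\<exists>!h. h \<in> nat_trans K (coker X Y m) Z \<and> nt_comp K Y h cp = g"
  proof (rule ex1I[of _ ?h])
    show "?h \<in> nat_trans K (coker X Y m) Z \<and> nt_comp K Y ?h cp = g"
      using h gcp by (intro conjI nt_comp_eqI[OF g]) auto
    fix h' assume h': "h' \<in> nat_trans K (coker X Y m) Z \<and> nt_comp K Y h' cp = g"
    show "h' = ?h"
    proof (rule nt_eqI[OF conjunct1[OF h'] h])
      fix V p assume V: "V \<in> vect K" and p: "p \<in> carrier (obj (coker X Y m) V)"
      then have pY: "p \<in> carrier (obj Y V)" "cp V p = p" using coker_carrier[OF V, of p] by simp_all
      have "nt_comp K Y h' cp V p = g V p" using h' by simp
      with V pY have "h' V p = g V p" by simp
      with V p show "h' V p = ?h V p" by simp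
    qed
  qed
qed (use \<C> coker_proj_nat_trans in auto)

end

section \<open>Powers and copowers of the line functor\<close>

text \<open>\<open>ray\<close> and \<open>slope\<close> identify the coded linear maps from
  \<open>line\<close> to \<open>V\<close> with the vectors of \<open>V\<close>: a vector gives the
  map \<open>c\<close> to \<open>c v\<close>, and a map gives its value at one.\<close>

definition ray :: "('u, 'u) module \<Rightarrow> 'u \<Rightarrow> 'u" where
  "ray V v = fcode (carrier line) (\<lambda>c\<in>carrier line. c \<odot>\<^bsub>V\<^esub> v)"

definition slope :: "'u \<Rightarrow> 'u" where
  "slope a = fapp (carrier line) a \<one>\<^bsub>K\<^esub>"

lemma scale_lin:
  assumes V: "V \<in> vect K" and v: "v \<in> carrier V" shows "(\<lambda>c\<in>carrier line. c \<odot>\<^bsub>V\<^esub> v) \<in> lin K line V"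
proof -
  interpret V: module K V by (rule vect_module[OF V])
  show ?thesis by (rule lin_restrictI) (use v in \<open>auto simp: V.smult_l_distr V.smult_assoc1\<close>)
qed

lemma slope_fcode: "f \<in> lin K line V \<Longrightarrow> slope (fcode (carrier line) f) = f \<one>\<^bsub>K\<^esub>"
  unfolding slope_def using fapp_lin[OF line_vect, of f V] by simp

lemma ray_closed: "V \<in> vect K \<Longrightarrow> v \<in> carrier V \<Longrightarrow> ray V v \<in> carrier (obj (yoneda K line) V)"
  unfolding ray_def carrier_yoneda by (rule imageI[OF scale_lin])

lemma slope_ray: "V \<in> vect K \<Longrightarrow> v \<in> carrier V \<Longrightarrow> slope (ray V v) = v"
  unfolding ray_def slope_fcode[OF scale_lin] by (simp add: module.smult_one[OF vect_module])

lemma slope_closed: "a \<in> carrier (obj (yoneda K line) V) \<Longrightarrow> slope a \<in> carrier V"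
  unfolding carrier_yoneda using lin_closed[of _ line V "\<one>\<^bsub>K\<^esub>"] by (auto simp: slope_fcode[unfolded self_module_simps])

lemma slope_eqD:
  assumes "a \<in> carrier (obj (yoneda K line) V)" "b \<in> carrier (obj (yoneda K line) V)" "slope a = slope b"
  shows "a = b"
proof -
  obtain f g where f: "f \<in> lin K line V" "a = fcode (carrier line) f"
    and g: "g \<in> lin K line V" "b = fcode (carrier line) g"
    using assms(1,2) unfolding carrier_yoneda by blast
  have fg: "f \<one>\<^bsub>K\<^esub> = g \<one>\<^bsub>K\<^esub>" using assms(3) f g by (simp add: slope_fcode del: self_module_simps(1))
  have "f c = g c" if "c \<in> carrier line" for c
    using lin_smult[OF f(1), of c "\<one>\<^bsub>K\<^esub>"] lin_smult[OF g(1), of c "\<one>\<^bsub>K\<^esub>"] that fg by simp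
  then have "f = g" by (rule lin_eqI[OF f(1) g(1)])
  with f g show ?thesis by simp
qed

lemma
  assumes V: "V \<in> vect K" and a: "a \<in> carrier (obj (yoneda K line) V)"
  shows slope_add: "b \<in> carrier (obj (yoneda K line) V) \<Longrightarrow>
      slope (a \<oplus>\<^bsub>obj (yoneda K line) V\<^esub> b) = slope a \<oplus>\<^bsub>V\<^esub> slope b"
    and slope_smult: "c \<in> carrier K \<Longrightarrow> slope (c \<odot>\<^bsub>obj (yoneda K line) V\<^esub> a) = c \<odot>\<^bsub>V\<^esub> slope a"
    and slope_zero: "slope \<zero>\<^bsub>obj (yoneda K line) V\<^esub> = \<zero>\<^bsub>V\<^esub>"
    and slope_arr: "f \<in> lin K V W \<Longrightarrow> slope (arr (yoneda K line) V W f a) = f (slope a)"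
proof -
  note [simp del] = self_module_simps(1)
  obtain h where h: "h \<in> lin K line V" "a = fcode (carrier line) h"
    using a unfolding carrier_yoneda by blast
  have 1: "\<one>\<^bsub>K\<^esub> \<in> carrier line" unfolding self_module_simps by simp
  show "slope \<zero>\<^bsub>obj (yoneda K line) V\<^esub> = \<zero>\<^bsub>V\<^esub>"
    using 1 by (simp add: yoneda_ops(1)[OF line_vect h(1)] slope_fcode[OF lin_zero_map[OF line_vect V]])
  show "slope (c \<odot>\<^bsub>obj (yoneda K line) V\<^esub> a) = c \<odot>\<^bsub>V\<^esub> slope a" if "c \<in> carrier K"
    using 1 unfolding h(2) yoneda_ops(3)[OF line_vect h(1)]
    by (simp add: slope_fcode[OF lin_smult_map[OF line_vect V h(1) that]] slope_fcode[OF h(1)])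
  show "slope (arr (yoneda K line) V W f a) = f (slope a)" if "f \<in> lin K V W"
    using 1 unfolding h(2) arr_yoneda[OF line_vect h(1)]
    by (simp add: slope_fcode[OF lin_compose[OF line_vect h(1) that]] slope_fcode[OF h(1)] compose_eq)
  show "slope (a \<oplus>\<^bsub>obj (yoneda K line) V\<^esub> b) = slope a \<oplus>\<^bsub>V\<^esub> slope b"
    if b: "b \<in> carrier (obj (yoneda K line) V)"
  proof -
    obtain g where g: "g \<in> lin K line V" "b = fcode (carrier line) g"
      using b unfolding carrier_yoneda by blast
    show ?thesis
      using 1 unfolding h(2) g(2) yoneda_ops(2)[OF line_vect h(1) g(1)]
      by (simp add: slope_fcode[OF lin_add_map[OF line_vect V h(1) g(1)]] slope_fcode[OF h(1)] slope_fcode[OF g(1)])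
  qed
qed

section \<open>The power and the copower of the line functor in coordinates\<close>

context
  fixes I :: "'u set"
  assumes I: "small I"
begin

abbreviation "Pow_line \<equiv> power_functor I (yoneda K line)"
abbreviation "Cop_line \<equiv> copower_functor I (yoneda K line)"
abbreviation "incl_line \<equiv> copower_inclusion K I (yoneda K line)"

text \<open>Through \<open>slope\<close>, the value of the power functor at \<open>V\<close> becomes
  the set of families of vectors of \<open>V\<close>; \<open>entry\<close> reads such a family, and
  \<open>tuple\<close> builds an element from one.\<close>

definition entry :: "'u \<Rightarrow> 'u \<Rightarrow> 'u" where
  "entry a i = slope (fapp I a i)"

definition tuple :: "('u, 'u) module \<Rightarrow> ('u \<Rightarrow> 'u) \<Rightarrow> 'u" where
  "tuple V w = fcode I (\<lambda>i\<in>I. ray V (w i))"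

lemma power_obj: "obj Pow_line V = coded I (power_module I (obj (yoneda K line) V))"
  and copower_obj: "obj Cop_line V = coded I (copower_module I (obj (yoneda K line) V))"
  by (simp_all add: power_functor_def copower_functor_def)

lemma power_carrier:
  "a \<in> carrier (obj Pow_line V) \<longleftrightarrow> (\<exists>A \<in> I \<rightarrow>\<^sub>E carrier (obj (yoneda K line) V). a = fcode I A)"
  unfolding power_obj coded_def power_module_def by auto

lemma fapp_power:
  assumes "a \<in> carrier (obj Pow_line V)"
  shows "fapp I a \<in> I \<rightarrow>\<^sub>E carrier (obj (yoneda K line) V)" "fcode I (fapp I a) = a"
proof -
  obtain A where A: "A \<in> I \<rightarrow>\<^sub>E carrier (obj (yoneda K line) V)" "a = fcode I A"
    using assms unfolding power_carrier by blast
  then have "fapp I a = A" using I by (simp add: fapp_fcode PiE_iff)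
  with A show "fapp I a \<in> I \<rightarrow>\<^sub>E carrier (obj (yoneda K line) V)" "fcode I (fapp I a) = a" by simp_all
qed

lemma entry_closed: "a \<in> carrier (obj Pow_line V) \<Longrightarrow> i \<in> I \<Longrightarrow> entry a i \<in> carrier V"
  unfolding entry_def by (rule slope_closed) (rule PiE_mem[OF fapp_power(1)])

lemma power_eqI:
  assumes a: "a \<in> carrier (obj Pow_line V)" and b: "b \<in> carrier (obj Pow_line V)"
    and eq: "\<And>i. i \<in> I \<Longrightarrow> entry a i = entry b i"
  shows "a = b"
proof -
  have "fapp I a i = fapp I b i" if i: "i \<in> I" for i
    by (rule slope_eqD[OF PiE_mem[OF fapp_power(1)[OF a] i] PiE_mem[OF fapp_power(1)[OF b] i]])
      (rule eq[OF i, unfolded entry_def])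
  then have "fapp I a = fapp I b"
    by (rule extensionalityI[OF fapp_extensional fapp_extensional])
  then show ?thesis using fapp_power(2)[OF a] fapp_power(2)[OF b] by metis
qed

lemma tuple_closed:
  assumes "V \<in> vect K" "\<And>i. i \<in> I \<Longrightarrow> w i \<in> carrier V" shows "tuple V w \<in> carrier (obj Pow_line V)"
  unfolding power_carrier tuple_def
  by (rule bexI, rule refl) (use assms ray_closed in \<open>simp add: PiE_iff\<close>)

lemma entry_tuple:
  "V \<in> vect K \<Longrightarrow> i \<in> I \<Longrightarrow> w i \<in> carrier V \<Longrightarrow> entry (tuple V w) i = w i"
  unfolding entry_def tuple_def using I by (simp add: fapp_fcode slope_ray)

lemma
  assumes V: "V \<in> vect K" and a: "a \<in> carrier (obj Pow_line V)" and i: "i \<in> I"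
  shows entry_add: "b \<in> carrier (obj Pow_line V) \<Longrightarrow>
      entry (a \<oplus>\<^bsub>obj Pow_line V\<^esub> b) i = entry a i \<oplus>\<^bsub>V\<^esub> entry b i"
    and entry_smult: "c \<in> carrier K \<Longrightarrow> entry (c \<odot>\<^bsub>obj Pow_line V\<^esub> a) i = c \<odot>\<^bsub>V\<^esub> entry a i"
    and entry_arr: "f \<in> lin K V W \<Longrightarrow> entry (arr Pow_line V W f a) i = f (entry a i)"
proof -
  have ai: "fapp I a i \<in> carrier (obj (yoneda K line) V)" by (rule PiE_mem[OF fapp_power(1)[OF a] i])
  show "entry (c \<odot>\<^bsub>obj Pow_line V\<^esub> a) i = c \<odot>\<^bsub>V\<^esub> entry a i" if "c \<in> carrier K"
    unfolding entry_def slope_smult[OF V ai that, symmetric] power_obj coded_def power_module_def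
    using I i by (simp add: fapp_fcode)
  show "entry (arr Pow_line V W f a) i = f (entry a i)" if "f \<in> lin K V W"
    unfolding entry_def slope_arr[OF V ai that, symmetric] using I i a
    by (simp add: fapp_fcode power_functor_def)
  show "entry (a \<oplus>\<^bsub>obj Pow_line V\<^esub> b) i = entry a i \<oplus>\<^bsub>V\<^esub> entry b i" if b: "b \<in> carrier (obj Pow_line V)"
  proof -
    have bi: "fapp I b i \<in> carrier (obj (yoneda K line) V)" by (rule PiE_mem[OF fapp_power(1)[OF b] i])
    show ?thesis
      unfolding entry_def slope_add[OF V ai bi, symmetric] power_obj coded_def power_module_def
      using I i by (simp add: fapp_fcode)
  qed
qed

text \<open>Because \<open>slope\<close> vanishes exactly on zero, the support of a family of coded
  maps is the support of its family of vectors. The copower thus consists of the finitely supported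
  elements of the power.\<close>

lemma copower_carrier:
  assumes V: "V \<in> vect K"
  shows "a \<in> carrier (obj Cop_line V) \<longleftrightarrow>
    a \<in> carrier (obj Pow_line V) \<and> finite {i \<in> I. entry a i \<noteq> \<zero>\<^bsub>V\<^esub>}"
proof -
  let ?L = "obj (yoneda K line) V"
  have supp: "{i \<in> I. A i \<noteq> \<zero>\<^bsub>?L\<^esub>} = {i \<in> I. entry (fcode I A) i \<noteq> \<zero>\<^bsub>V\<^esub>}"
    if A: "A \<in> I \<rightarrow>\<^sub>E carrier ?L" for A
  proof -
    have "A i = \<zero>\<^bsub>?L\<^esub> \<longleftrightarrow> entry (fcode I A) i = \<zero>\<^bsub>V\<^esub>" if i: "i \<in> I" for i
    proof -
      have Ai: "A i \<in> carrier ?L" and z: "\<zero>\<^bsub>?L\<^esub> \<in> carrier ?L"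
        using PiE_mem[OF A i] vect_zero_closed[OF yoneda_vect[OF line_vect V]] .
      have "entry (fcode I A) i = slope (A i)" using A I by (simp add: entry_def fapp_fcode PiE_iff)
      moreover have "slope (A i) = \<zero>\<^bsub>V\<^esub> \<longleftrightarrow> A i = \<zero>\<^bsub>?L\<^esub>"
        using slope_eqD[OF Ai z] slope_zero[OF V z] by metis
      ultimately show ?thesis by simp
    qed
    then show ?thesis by auto
  qed
  have "a \<in> carrier (obj Cop_line V) \<longleftrightarrow>
    (\<exists>A \<in> I \<rightarrow>\<^sub>E carrier ?L. finite {i \<in> I. A i \<noteq> \<zero>\<^bsub>?L\<^esub>} \<and> a = fcode I A)"
    unfolding copower_obj coded_def copower_module_def by auto
  with supp show ?thesis unfolding power_carrier by auto
qed

lemma copower_ops: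
  "add (obj Cop_line V) = add (obj Pow_line V)" "smult (obj Cop_line V) = smult (obj Pow_line V)"
  unfolding copower_obj power_obj coded_def copower_module_def by simp_all

lemma copower_arr:
  assumes "V \<in> vect K" "a \<in> carrier (obj Cop_line V)"
  shows "arr Cop_line V W f a = arr Pow_line V W f a"
  using assms copower_carrier[OF assms(1)] by (simp add: copower_functor_def power_functor_def)

lemma power_arr_closed:
  assumes V: "V \<in> vect K" and W: "W \<in> vect K" and f: "f \<in> lin K V W" and a: "a \<in> carrier (obj Pow_line V)"
  shows "arr Pow_line V W f a \<in> carrier (obj Pow_line W)"
proof -
  have "arr Pow_line V W f a = fcode I (\<lambda>i\<in>I. arr (yoneda K line) V W f (fapp I a i))"
    using a by (simp add: power_functor_def)
  moreover have "(\<lambda>i\<in>I. arr (yoneda K line) V W f (fapp I a i)) \<in> I \<rightarrow>\<^sub>E carrier (obj (yoneda K line) W)"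
    using fapp_power(1)[OF a] additive_closed[OF yoneda_additive[OF line_vect] V W f] by auto
  ultimately show ?thesis unfolding power_carrier by blast
qed

lemma power_valued: "vect_valued Pow_line"
  unfolding vect_valued_def power_obj
  using power_vect[OF I yoneda_vect[OF line_vect]] power_arr_closed unfolding power_obj by blast

lemma copower_valued: "vect_valued Cop_line"
  unfolding vect_valued_def
proof (intro conjI ballI)
  fix V assume V: "V \<in> vect K"
  show "obj Cop_line V \<in> vect K"
    unfolding copower_obj by (rule copower_vect[OF I yoneda_vect[OF line_vect V]])
  fix W f a assume W: "W \<in> vect K" and f: "f \<in> lin K V W" and a: "a \<in> carrier (obj Cop_line V)"
  have aP: "a \<in> carrier (obj Pow_line V)" and fin: "finite {i \<in> I. entry a i \<noteq> \<zero>\<^bsub>V\<^esub>}"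
    using a copower_carrier[OF V] by auto
  have "finite {i \<in> I. entry (arr Pow_line V W f a) i \<noteq> \<zero>\<^bsub>W\<^esub>}"
    by (rule finite_subset[OF _ fin]) (use entry_arr[OF V aP _ f] lin_0[OF f V W] in auto)
  then show "arr Cop_line V W f a \<in> carrier (obj Cop_line W)"
    unfolding copower_arr[OF V a] copower_carrier[OF W] using power_arr_closed[OF V W f aP] by simp
qed

lemma incl_apply: "V \<in> vect K \<Longrightarrow> a \<in> carrier (obj Cop_line V) \<Longrightarrow> incl_line V a = a"
  by (simp add: copower_inclusion_def)

lemma incl_nat_trans: "incl_line \<in> nat_trans K Cop_line Pow_line"
  unfolding copower_inclusion_def
  by (rule nat_transI[OF copower_valued]) (auto simp: copower_carrier copower_ops copower_arr)

text \<open>The power of the line functor is represented by \<open>free I\<close>: \<open>spread V a\<close> is the map classified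
  by \<open>a\<close>, and \<open>universal\<close> classifies the identity.\<close>

definition spread :: "('u, 'u) module \<Rightarrow> 'u \<Rightarrow> 'u \<Rightarrow> 'u" where
  "spread V a = lincomb I V (entry a)"

definition universal :: 'u where
  "universal = tuple (free I) (\<lambda>i. basis_map I i \<one>\<^bsub>K\<^esub>)"

lemma spread_lin: "V \<in> vect K \<Longrightarrow> a \<in> carrier (obj Pow_line V) \<Longrightarrow> spread V a \<in> lin K (free I) V"
  unfolding spread_def by (rule lincomb_lin[OF I]) (auto intro: entry_closed)

lemma spread_basis_map:
  "V \<in> vect K \<Longrightarrow> a \<in> carrier (obj Pow_line V) \<Longrightarrow> i \<in> I \<Longrightarrow> c \<in> carrier K \<Longrightarrow>
    spread V a (basis_map I i c) = c \<odot>\<^bsub>V\<^esub> entry a i"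
  unfolding spread_def by (rule lincomb_basis_map[OF I]) (auto intro: entry_closed)

lemma universal_closed: "universal \<in> carrier (obj Pow_line (free I))"
  unfolding universal_def using I by (intro tuple_closed) auto

lemma entry_universal: "i \<in> I \<Longrightarrow> entry universal i = basis_map I i \<one>\<^bsub>K\<^esub>"
  unfolding universal_def using I by (intro entry_tuple) auto

lemma smult_basis_map:
  "i \<in> I \<Longrightarrow> c \<in> carrier K \<Longrightarrow> c \<odot>\<^bsub>free I\<^esub> basis_map I i \<one>\<^bsub>K\<^esub> = basis_map I i c"
  using lin_smult[OF basis_map_lin[OF I], of i c "\<one>\<^bsub>K\<^esub>"] by simp

lemma spread_universal: "v \<in> carrier (free I) \<Longrightarrow> spread (free I) universal v = v"
proof -
  note F = free_vect[OF I]
  assume v: "v \<in> carrier (free I)"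
  have "spread (free I) universal = (\<lambda>v\<in>carrier (free I). v)"
    by (rule free_lin_eqI[OF I F spread_lin[OF F universal_closed] lin_id[OF F]])
      (use F I universal_closed in \<open>simp add: spread_basis_map entry_universal smult_basis_map\<close>)
  with v show ?thesis by simp
qed

text \<open>The Yoneda identity for this representation: every element of the power arises from the
  universal family of basis vectors along its own classifying map.\<close>

lemma arr_spread_universal:
  assumes V: "V \<in> vect K" and a: "a \<in> carrier (obj Pow_line V)"
  shows "arr Pow_line (free I) V (spread V a) universal = a"
proof (rule power_eqI[OF power_arr_closed[OF free_vect[OF I] V spread_lin[OF V a] universal_closed] a])
  fix i assume i: "i \<in> I"
  then show "entry (arr Pow_line (free I) V (spread V a) universal) i = entry a i"
    using entry_arr[OF free_vect[OF I] universal_closed i spread_lin[OF V a]]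
      module.smult_one[OF vect_module[OF V] entry_closed[OF a i]]
    by (simp add: entry_universal spread_basis_map[OF V a])
qed

text \<open>The counterpart of \<open>yo\<close> for the power: an element of
  \<open>Y (free I)\<close> yields a transformation. Its naturality and linearity follow because
  \<open>spread\<close> is additive, homogeneous and natural in the classified element, which can be
  checked on basis vectors.\<close>

lemma power_nat_trans:
  assumes Y: "additive_functor K Y" and y: "y \<in> carrier (obj Y (free I))"
  shows "(\<lambda>V\<in>vect K. \<lambda>a\<in>carrier (obj Pow_line V). arr Y (free I) V (spread V a) y) \<in> nat_trans K Pow_line Y"
proof (rule nat_transI[OF power_valued])
  note F = free_vect[OF I]
  fix V a assume V: "V \<in> vect K" and a: "a \<in> carrier (obj Pow_line V)"
  interpret V: module K V by (rule vect_module[OF V])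
  have PV: "obj Pow_line V \<in> vect K" by (rule valued_obj[OF power_valued V])
  note sa = spread_lin[OF V a] and ba = spread_basis_map[OF V a] and ea = entry_closed[OF a]
  show "arr Y (free I) V (spread V a) y \<in> carrier (obj Y V)" by (rule additive_closed[OF Y F V sa y])
  show "arr Y (free I) V (spread V (a \<oplus>\<^bsub>obj Pow_line V\<^esub> b)) y =
    arr Y (free I) V (spread V a) y \<oplus>\<^bsub>obj Y V\<^esub> arr Y (free I) V (spread V b) y"
    if b: "b \<in> carrier (obj Pow_line V)" for b
  proof (rule additive_add[OF Y F V sa spread_lin[OF V b] _ _ y])
    have ab: "a \<oplus>\<^bsub>obj Pow_line V\<^esub> b \<in> carrier (obj Pow_line V)" by (rule vect_add_closed[OF PV a b])
    then show "spread V (a \<oplus>\<^bsub>obj Pow_line V\<^esub> b) \<in> lin K (free I) V" by (rule spread_lin[OF V])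
    have "spread V (a \<oplus>\<^bsub>obj Pow_line V\<^esub> b) = (\<lambda>u\<in>carrier (free I). spread V a u \<oplus>\<^bsub>V\<^esub> spread V b u)"
      by (rule free_lin_eqI[OF I V spread_lin[OF V ab] lin_add_map[OF F V sa spread_lin[OF V b]]])
        (use I ea entry_closed[OF b] in \<open>simp add: spread_basis_map[OF V ab] ba spread_basis_map[OF V b]
          entry_add[OF V a _ b] V.smult_r_distr\<close>)
    then show "spread V (a \<oplus>\<^bsub>obj Pow_line V\<^esub> b) u = spread V a u \<oplus>\<^bsub>V\<^esub> spread V b u"
      if "u \<in> carrier (free I)" for u using that by simp
  qed
  show "arr Y (free I) V (spread V (c \<odot>\<^bsub>obj Pow_line V\<^esub> a)) y =
    c \<odot>\<^bsub>obj Y V\<^esub> arr Y (free I) V (spread V a) y" if c: "c \<in> carrier K" for c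
  proof (rule additive_smult[OF Y F V sa c _ _ y])
    have ca: "c \<odot>\<^bsub>obj Pow_line V\<^esub> a \<in> carrier (obj Pow_line V)" by (rule vect_smult_closed[OF PV c a])
    then show "spread V (c \<odot>\<^bsub>obj Pow_line V\<^esub> a) \<in> lin K (free I) V" by (rule spread_lin[OF V])
    have "spread V (c \<odot>\<^bsub>obj Pow_line V\<^esub> a) = (\<lambda>u\<in>carrier (free I). c \<odot>\<^bsub>V\<^esub> spread V a u)"
      by (rule free_lin_eqI[OF I V spread_lin[OF V ca] lin_smult_map[OF F V sa c]])
        (use I ea c in \<open>simp add: spread_basis_map[OF V ca] ba entry_smult[OF V a _ c]
          V.smult_assoc1[symmetric] V.R.m_comm\<close>)
    then show "spread V (c \<odot>\<^bsub>obj Pow_line V\<^esub> a) u = c \<odot>\<^bsub>V\<^esub> spread V a u"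
      if "u \<in> carrier (free I)" for u using that by simp
  qed
  show "arr Y (free I) W (spread W (arr Pow_line V W f a)) y = arr Y V W f (arr Y (free I) V (spread V a) y)"
    if W: "W \<in> vect K" and f: "f \<in> lin K V W" for W f
  proof (rule additive_comp[OF Y F V W sa f _ _ y, symmetric])
    have fa: "arr Pow_line V W f a \<in> carrier (obj Pow_line W)" by (rule power_arr_closed[OF V W f a])
    then show "spread W (arr Pow_line V W f a) \<in> lin K (free I) W" by (rule spread_lin[OF W])
    have "spread W (arr Pow_line V W f a) = compose (carrier (free I)) f (spread V a)"
      by (rule free_lin_eqI[OF I W spread_lin[OF W fa] lin_compose[OF F sa f]])
        (use I ea f in \<open>simp add: spread_basis_map[OF W fa] ba entry_arr[OF V a _ f] compose_eq lin_smult[OF f]\<close>)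
    then show "spread W (arr Pow_line V W f a) u = f (spread V a u)"
      if "u \<in> carrier (free I)" for u using that by (simp add: compose_eq)
  qed
qed

text \<open>For finitely supported \<open>w\<close> the map \<open>lincomb I V w\<close> is a finite
  sum of maps that factor through single coordinates. Each summand sends \<open>y\<close> to an
  arrow of \<open>Y\<close> applied to one coordinate of \<open>y\<close>, which lies in the image
  of \<open>m\<close> by naturality.\<close>

lemma arr_finite_support_in_image:
  assumes X: "additive_functor K X" and Y: "additive_functor K Y" and m: "m \<in> nat_trans K X Y"
    and y: "y \<in> carrier (obj Y (free I))"
    and coords: "\<And>i. i \<in> I \<Longrightarrow> arr Y (free I) line (coord K I i) y \<in> m line ` carrier (obj X line)"
    and V: "V \<in> vect K" and w: "\<And>i. i \<in> I \<Longrightarrow> w i \<in> carrier V" and fin: "finite {i \<in> I. w i \<noteq> \<zero>\<^bsub>V\<^esub>}"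
  shows "arr Y (free I) V (lincomb I V w) y \<in> m V ` carrier (obj X V)"
proof -
  note F = free_vect[OF I]
  interpret V: module K V by (rule vect_module[OF V])
  have XV: "obj X V \<in> vect K" and YV: "obj Y V \<in> vect K" using X Y V by simp_all
  note img = vect_submodule[OF YV image_submodule[OF XV YV nt_lin[OF m V]]]
  have "arr Y (free I) V (lincomb I V w) y \<in> m V ` carrier (obj X V)"
    if "finite S" "S \<subseteq> I" "\<And>i. i \<in> I \<Longrightarrow> w i \<in> carrier V" "\<And>i. i \<in> I \<Longrightarrow> i \<notin> S \<Longrightarrow> w i = \<zero>\<^bsub>V\<^esub>" for S w
    using that
  proof (induction S arbitrary: w)
    case empty
    note l = lincomb_lin[OF I V empty.prems(2)]
    have eq: "lincomb I V w = (\<lambda>u\<in>carrier (free I). \<zero>\<^bsub>V\<^esub>)"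
    proof (rule free_lin_eqI[OF I V l lin_zero_map[OF F V]])
      fix i c assume i: "i \<in> I" and c: "c \<in> carrier K"
      have "lincomb I V w (basis_map I i c) = c \<odot>\<^bsub>V\<^esub> w i"
        by (rule lincomb_basis_map[OF I V empty.prems(2) i c])
      then show "lincomb I V w (basis_map I i c) = (\<lambda>u\<in>carrier (free I). \<zero>\<^bsub>V\<^esub>) (basis_map I i c)"
        using empty.prems(3)[OF i] basis_map_closed[OF I i c] c by simp
    qed
    have "arr Y (free I) V (lincomb I V w) y = \<zero>\<^bsub>obj Y V\<^esub>"
    proof (rule additive_zero[OF Y F V l _ y])
      show "lincomb I V w u = \<zero>\<^bsub>V\<^esub>" if "u \<in> carrier (free I)" for u
        using fun_cong[OF eq, of u] that by simp
    qed
    with img(2) show ?case by simp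
  next
    case (insert j S)
    \<comment> \<open>The vector \<open>w j\<close> is split off: what it contributes is the
      coordinate \<open>j\<close> followed by scaling of \<open>w j\<close>.\<close>
    let ?w = "w(j := \<zero>\<^bsub>V\<^esub>)" and ?s = "\<lambda>c\<in>carrier line. c \<odot>\<^bsub>V\<^esub> w j"
    have j: "j \<in> I" and wj: "w j \<in> carrier V" using insert.prems by auto
    have w': "?w i \<in> carrier V" if "i \<in> I" for i using that insert.prems(2) V by simp
    note l = lincomb_lin[where w = w, OF I V insert.prems(2)] and l' = lincomb_lin[where w = ?w, OF I V w']
    note s = scale_lin[OF V wj] and c = coord_lin[OF I j]
    note sc = lin_compose[OF F c s]
    have eq: "lincomb I V w = (\<lambda>u\<in>carrier (free I). lincomb I V ?w u \<oplus>\<^bsub>V\<^esub> compose (carrier (free I)) ?s (coord K I j) u)"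
    proof (rule free_lin_eqI[OF I V l lin_add_map[OF F V l' sc]])
      fix i d assume i: "i \<in> I" and d: "d \<in> carrier K"
      have wi: "w i \<in> carrier V" by (rule insert.prems(2)[OF i])
      show "lincomb I V w (basis_map I i d) =
        (\<lambda>u\<in>carrier (free I). lincomb I V ?w u \<oplus>\<^bsub>V\<^esub> compose (carrier (free I)) ?s (coord K I j) u) (basis_map I i d)"
        using i d j wi wj I V lincomb_basis_map[where w = w, OF I V insert.prems(2) i d]
          lincomb_basis_map[where w = ?w, OF I V w' i d]
        by (simp add: compose_eq module.smult_r_null[OF vect_module])
    qed
    have "arr Y (free I) V (lincomb I V w) y = arr Y (free I) V (lincomb I V ?w) y \<oplus>\<^bsub>obj Y V\<^esub>
      arr Y (free I) V (compose (carrier (free I)) ?s (coord K I j)) y"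
    proof (rule additive_add[OF Y F V l' sc l _ y])
      show "lincomb I V w u = lincomb I V ?w u \<oplus>\<^bsub>V\<^esub> compose (carrier (free I)) ?s (coord K I j) u"
        if "u \<in> carrier (free I)" for u
        using fun_cong[OF eq, of u] that by (simp only: restrict_apply')
    qed
    moreover have "arr Y (free I) V (lincomb I V ?w) y \<in> m V ` carrier (obj X V)"
      by (rule insert.IH) (use insert.prems w' in auto)
    moreover have "arr Y (free I) V (compose (carrier (free I)) ?s (coord K I j)) y \<in> m V ` carrier (obj X V)"
    proof -
      obtain x where x: "x \<in> carrier (obj X line)" "arr Y (free I) line (coord K I j) y = m line x"
        using coords[OF j] by blast
      have "arr Y (free I) V (compose (carrier (free I)) ?s (coord K I j)) y = m V (arr X line V ?s x)"
        using additive_comp[OF Y F line_vect V c s sc compose_eq y] x(2) nt_nat[OF m line_vect V s x(1)] by metis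
      then show ?thesis using additive_closed[OF X line_vect V s x(1)] by blast
    qed
    ultimately show ?case using img(3) by simp
  qed
  from this[where w = w, OF fin _ w] show ?thesis by blast
qed

end

section \<open>Closed embeddings\<close>

context
  fixes X Y m
  assumes sepX: "separated X" and sepY: "separated Y" and m: "m \<in> nat_trans K X Y"
    and inj: "\<And>V. V \<in> vect K \<Longrightarrow> inj_on (m V) (carrier (obj X V))"
begin

lemma X_additive: "additive_functor K X" and Y_additive: "additive_functor K Y"
  using separated_additive sepX sepY by auto

text \<open>As \<open>m\<close> is injective, this says that the square of \<open>m\<close> and the
  coordinate maps to the \<open>I\<close>-fold powers of \<open>X line\<close> and
  \<open>Y line\<close> is a pullback.\<close>

definition lifts :: "'u set \<Rightarrow> bool" where
  "lifts I \<longleftrightarrow> (\<forall>y\<in>carrier (obj Y (free I)).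
     (\<forall>i\<in>I. arr Y (free I) line (coord K I i) y \<in> m line ` carrier (obj X line)) \<longrightarrow>
     y \<in> m (free I) ` carrier (obj X (free I)))"

lemma m_eqD: "V \<in> vect K \<Longrightarrow> x \<in> carrier (obj X V) \<Longrightarrow> x' \<in> carrier (obj X V) \<Longrightarrow> m V x = m V x' \<Longrightarrow> x = x'"
  using inj by (auto dest: inj_onD)

text \<open>A witness of summability in \<open>X\<close> and one in \<open>Y\<close> for the same
  family have the same coordinates, hence correspond under \<open>m\<close> as \<open>Y\<close> is
  separated. Conversely, an element that lifts has the right coordinates because \<open>m\<close> is
  injective at \<open>line\<close>.\<close>

lemma summable_iff_lifts:
  assumes I: "small I"
  shows "(\<forall>f\<in>I \<rightarrow> carrier (obj X line).
    summable_family K Y I (\<lambda>i. m line (f i)) \<longrightarrow> summable_family K X I f) \<longleftrightarrow> lifts I"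
proof
  note F = free_vect[OF I]
  assume sum: "\<forall>f\<in>I \<rightarrow> carrier (obj X line).
    summable_family K Y I (\<lambda>i. m line (f i)) \<longrightarrow> summable_family K X I f"
  show "lifts I"
    unfolding lifts_def
  proof (intro ballI impI)
    fix y assume y: "y \<in> carrier (obj Y (free I))"
      and c: "\<forall>i\<in>I. arr Y (free I) line (coord K I i) y \<in> m line ` carrier (obj X line)"
    then have "\<forall>i\<in>I. \<exists>x. x \<in> carrier (obj X line) \<and> arr Y (free I) line (coord K I i) y = m line x" by blast
    then obtain f where f: "\<forall>i\<in>I. f i \<in> carrier (obj X line) \<and> arr Y (free I) line (coord K I i) y = m line (f i)"
      by (rule bchoice[THEN exE])
    then have "f \<in> I \<rightarrow> carrier (obj X line)" by auto
    moreover have "summable_family K Y I (\<lambda>i. m line (f i))"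
      unfolding summable_family_def using y f by blast
    ultimately obtain x where x: "x \<in> carrier (obj X (free I))"
      "\<forall>i\<in>I. arr X (free I) line (coord K I i) x = f i"
      using sum unfolding summable_family_def by blast
    have "y = m (free I) x"
    proof (rule separated_eqI[OF sepY I y nt_closed[OF m F x(1)]])
      fix i assume i: "i \<in> I"
      show "arr Y (free I) line (coord K I i) y = arr Y (free I) line (coord K I i) (m (free I) x)"
        using f x(2) i nt_nat[OF m F line_vect coord_lin[OF I i] x(1)] by simp
    qed
    with x(1) show "y \<in> m (free I) ` carrier (obj X (free I))" by blast
  qed
next
  note F = free_vect[OF I]
  assume l: "lifts I"
  show "\<forall>f\<in>I \<rightarrow> carrier (obj X line).
    summable_family K Y I (\<lambda>i. m line (f i)) \<longrightarrow> summable_family K X I f"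
  proof (intro ballI impI)
    fix f assume f: "f \<in> I \<rightarrow> carrier (obj X line)" and "summable_family K Y I (\<lambda>i. m line (f i))"
    then obtain y where y: "y \<in> carrier (obj Y (free I))"
      "\<forall>i\<in>I. arr Y (free I) line (coord K I i) y = m line (f i)" unfolding summable_family_def by blast
    have "\<forall>i\<in>I. arr Y (free I) line (coord K I i) y \<in> m line ` carrier (obj X line)" using y f by auto
    then obtain x where x: "x \<in> carrier (obj X (free I))" "y = m (free I) x"
      using l y(1) unfolding lifts_def by blast
    have "arr X (free I) line (coord K I i) x = f i" if i: "i \<in> I" for i
    proof (rule m_eqD[OF line_vect])
      show "arr X (free I) line (coord K I i) x \<in> carrier (obj X line)"
        by (rule additive_closed[OF X_additive F line_vect coord_lin[OF I i] x(1)])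
      show "m line (arr X (free I) line (coord K I i) x) = m line (f i)"
        using nt_nat[OF m F line_vect coord_lin[OF I i] x(1)] x(2) y(2) i by simp
    qed (use f i in auto)
    with x(1) show "summable_family K X I f" unfolding summable_family_def by blast
  qed
qed

text \<open>A transformation from the power to \<open>Y\<close> is an element of
  \<open>Y (free I)\<close>, its value at the universal family. That it restricts on the copower to
  a transformation into \<open>X\<close> says that its coordinates lie in \<open>X line\<close>, and
  a diagonal filler is a lift of the element. Uniqueness of fillers comes from injectivity of
  \<open>m\<close>.\<close>

lemma orthogonal_iff_lifts:
  assumes I: "small I"
  shows "orthogonal K (copower_functor I (yoneda K line)) (power_functor I (yoneda K line))
    (copower_inclusion K I (yoneda K line)) X Y m \<longleftrightarrow> lifts I"
proof
  note F = free_vect[OF I]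
  let ?P = "power_functor I (yoneda K line)" and ?C = "copower_functor I (yoneda K line)"
    and ?e = "copower_inclusion K I (yoneda K line)"
  assume orth: "orthogonal K ?C ?P ?e X Y m"
  show "lifts I"
    unfolding lifts_def
  proof (intro ballI impI)
    fix y assume y: "y \<in> carrier (obj Y (free I))"
      and c: "\<forall>i\<in>I. arr Y (free I) line (coord K I i) y \<in> m line ` carrier (obj X line)"
    let ?k = "\<lambda>V\<in>vect K. \<lambda>a\<in>carrier (obj ?P V). arr Y (free I) V (spread I V a) y"
    have k: "?k \<in> nat_trans K ?P Y" by (rule power_nat_trans[OF I Y_additive y])
    note ke = nt_comp_nat_trans[OF copower_valued[OF I] incl_nat_trans[OF I] k]
    \<comment> \<open>On finitely supported families the transformation given by \<open>y\<close>
      takes values in the image of \<open>m\<close>, which provides the upper edge of the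
      square.\<close>
    obtain l where l: "l \<in> nat_trans K ?C X"
      and ml: "\<And>V a. V \<in> vect K \<Longrightarrow> a \<in> carrier (obj ?C V) \<Longrightarrow> m V (l V a) = nt_comp K ?C ?k ?e V a"
    proof (rule nt_factor[OF copower_valued[OF I] X_additive Y_additive m ke])
      show "inj_on (m V) (carrier (obj X V))" if "V \<in> vect K" for V by (rule inj[OF that])
    next
      fix V a assume V: "V \<in> vect K" and a: "a \<in> carrier (obj ?C V)"
      then have aP: "a \<in> carrier (obj ?P V)" and fin: "finite {i \<in> I. entry I a i \<noteq> \<zero>\<^bsub>V\<^esub>}"
        using copower_carrier[OF I V] by auto
      have "arr Y (free I) V (spread I V a) y \<in> m V ` carrier (obj X V)"
        unfolding spread_def[OF I]
        by (rule arr_finite_support_in_image[OF I X_additive Y_additive m y _ V entry_closed[OF I aP] fin]) (use c in blast)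
      with V a aP show "nt_comp K ?C ?k ?e V a \<in> m V ` carrier (obj X V)"
        by (simp add: incl_apply[OF I])
    qed (rule that)
    have "nt_comp K ?C m l = nt_comp K ?C ?k ?e"
      by (rule nt_comp_eqI[OF ke]) (rule ml)
    then obtain h where h: "h \<in> nat_trans K ?P X" "nt_comp K ?P m h = ?k"
      using orth l k unfolding orthogonal_def by blast
    let ?u = "universal I"
    have u: "?u \<in> carrier (obj ?P (free I))" by (rule universal_closed[OF I])
    \<comment> \<open>The filler evaluated at the universal family is the required lift, since the
      universal family classifies the identity.\<close>
    have "m (free I) (h (free I) ?u) = ?k (free I) ?u"
      using fun_cong[OF fun_cong[OF h(2)], of "free I" ?u] F u by simp
    also have "\<dots> = arr Y (free I) (free I) (spread I (free I) ?u) y" using F u by simp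
    also have "\<dots> = y"
      by (rule additive_id[OF Y_additive F spread_lin[OF I F u] spread_universal[OF I] y])
    finally show "y \<in> m (free I) ` carrier (obj X (free I))"
      using nt_closed[OF h(1) F u] by (metis imageI)
  qed
next
  note F = free_vect[OF I]
  let ?P = "power_functor I (yoneda K line)" and ?C = "copower_functor I (yoneda K line)"
    and ?e = "copower_inclusion K I (yoneda K line)"
  let ?u = "universal I"
  have u: "?u \<in> carrier (obj ?P (free I))" by (rule universal_closed[OF I])
  assume lifts: "lifts I"
  show "orthogonal K ?C ?P ?e X Y m"
    unfolding orthogonal_def
  proof (intro ballI impI)
    fix l k assume l: "l \<in> nat_trans K ?C X" and k: "k \<in> nat_trans K ?P Y"
      and eq: "nt_comp K ?C m l = nt_comp K ?C k ?e"
    have mlk: "m V (l V a) = k V a" if V: "V \<in> vect K" and a: "a \<in> carrier (obj ?C V)" for V a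
      using fun_cong[OF fun_cong[OF eq], of V a] V a incl_apply[OF I V a] by simp
    let ?y = "k (free I) ?u"
    have y: "?y \<in> carrier (obj Y (free I))" by (rule nt_closed[OF k F u])
    have "arr Y (free I) line (coord K I i) ?y \<in> m line ` carrier (obj X line)" if i: "i \<in> I" for i
    proof -
      note ci = coord_lin[OF I i]
      let ?b = "arr ?P (free I) line (coord K I i) ?u"
      have bP: "?b \<in> carrier (obj ?P line)" by (rule power_arr_closed[OF I F line_vect ci u])
      \<comment> \<open>Coordinate \<open>i\<close> of the universal family has a single nonzero
        entry and so belongs to the copower, where \<open>k\<close> factors through \<open>m\<close>
        by way of \<open>l\<close>.\<close>
      have "{j \<in> I. entry I ?b j \<noteq> \<zero>\<^bsub>line\<^esub>} \<subseteq> {i}"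
        using entry_arr[OF I F u _ ci] entry_universal[OF I] I i by (auto split: if_splits)
      then have "finite {j \<in> I. entry I ?b j \<noteq> \<zero>\<^bsub>line\<^esub>}" by (rule finite_subset) simp
      then have bC: "?b \<in> carrier (obj ?C line)" using bP copower_carrier[OF I line_vect] by blast
      have "arr Y (free I) line (coord K I i) ?y = m line (l line ?b)"
        using nt_nat[OF k F line_vect ci u] mlk[OF line_vect bC] by simp
      with nt_closed[OF l line_vect bC] show ?thesis by blast
    qed
    then obtain x where x: "x \<in> carrier (obj X (free I))" "?y = m (free I) x"
      using lifts y unfolding lifts_def by blast
    obtain h where h: "h \<in> nat_trans K ?P X"
      and mh: "\<And>V a. V \<in> vect K \<Longrightarrow> a \<in> carrier (obj ?P V) \<Longrightarrow> m V (h V a) = k V a"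
    proof (rule nt_factor[OF power_valued[OF I] X_additive Y_additive m k])
      show "inj_on (m V) (carrier (obj X V))" if "V \<in> vect K" for V by (rule inj[OF that])
    next
      fix V a assume V: "V \<in> vect K" and a: "a \<in> carrier (obj ?P V)"
      note s = spread_lin[OF I V a]
      \<comment> \<open>Every \<open>a\<close> comes from the universal family along
        \<open>spread I V a\<close>; the lift \<open>x\<close> of its value therefore provides lifts
        of all values of \<open>k\<close>.\<close>
      have "k V a = k V (arr ?P (free I) V (spread I V a) ?u)"
        using arr_spread_universal[OF I V a] by simp
      also have "\<dots> = m V (arr X (free I) V (spread I V a) x)"
        using nt_nat[OF k F V s u] nt_nat[OF m F V s x(1)] x(2) by simp
      finally show "k V a \<in> m V ` carrier (obj X V)"
        using additive_closed[OF X_additive F V s x(1)] by blast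
    qed (rule that)
    have aP: "a \<in> carrier (obj ?P V)" if "V \<in> vect K" "a \<in> carrier (obj ?C V)" for V a
      using that copower_carrier[OF I that(1)] by blast
    show "\<exists>!h. h \<in> nat_trans K ?P X \<and> nt_comp K ?C h ?e = l \<and> nt_comp K ?P m h = k"
    proof (rule ex1I[of _ h])
      have "nt_comp K ?C h ?e = l"
      proof (rule nt_comp_eqI[OF l])
        fix V a assume V: "V \<in> vect K" and a: "a \<in> carrier (obj ?C V)"
        show "h V (?e V a) = l V a"
          unfolding incl_apply[OF I V a]
          by (rule m_eqD[OF V nt_closed[OF h V aP[OF V a]] nt_closed[OF l V a]])
            (use mh[OF V aP[OF V a]] mlk[OF V a] in simp)
      qed
      with h mh show "h \<in> nat_trans K ?P X \<and> nt_comp K ?C h ?e = l \<and> nt_comp K ?P m h = k"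
        by (intro conjI nt_comp_eqI[OF k])
      fix h' assume h': "h' \<in> nat_trans K ?P X \<and> nt_comp K ?C h' ?e = l \<and> nt_comp K ?P m h' = k"
      show "h' = h"
      proof (rule nt_eqI[OF conjunct1[OF h'] h])
        fix V a assume V: "V \<in> vect K" and a: "a \<in> carrier (obj ?P V)"
        have "nt_comp K ?P m h' V a = k V a" using h' by simp
        with V a have "m V (h' V a) = m V (h V a)" using mh by simp
        then show "h' V a = h V a"
          by (rule m_eqD[OF V nt_closed[OF conjunct1[OF h'] V a] nt_closed[OF h V a]])
      qed
    qed
  qed
qed

text \<open>Besides orthogonality, a closed embedding has to be a monomorphism of small functors;
  this is supplied by pointwise injectivity and smallness of separated functors.\<close>

lemma closed_embedding_iff_lifts: "closed_embedding K X Y m \<longleftrightarrow> (\<forall>I. small I \<longrightarrow> lifts I)"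
  unfolding closed_embedding_def
  using injective_mono_in[of "small_functor K", OF separated_small[OF sepX] separated_small[OF sepY] m inj]
    orthogonal_iff_lifts by blast

text \<open>For a quotient map whose kernel is the image of \<open>m\<close>, vanishing of a
  coordinate in the quotient means that the coordinate of a representative lies in
  \<open>X line\<close>. Separatedness of the quotient thus translates into
  \<open>lifts\<close>.\<close>

lemma strong_cokernel_iff_lifts:
  "(\<exists>Q q. cokernel_in K (small_functor K) X Y m Q q \<and> strong_space K Q) \<longleftrightarrow> (\<forall>I. small I \<longrightarrow> lifts I)"
proof -
  let ?P = "coker X Y m" and ?p = "coker_proj X Y m"
  note p = coker_proj_nat_trans[OF X_additive Y_additive m] and P = coker_additive[OF X_additive Y_additive m]
  have P_small: "small_functor K ?P"
    by (rule separated_quotient_small[OF sepY P p]) (simp add: coker_simps[OF X_additive Y_additive m])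
  have ck: "cokernel_in K (small_functor K) X Y m ?P ?p"
    by (rule cokernel_coker[OF X_additive Y_additive m, of "small_functor K", OF P_small]) (simp add: small_functor_def)
  note zero_iff = coker_proj_eq_zero[OF X_additive Y_additive m]
  show ?thesis
  proof
    assume "\<exists>Q q. cokernel_in K (small_functor K) X Y m Q q \<and> strong_space K Q"
    then obtain Q q where Qq: "cokernel_in K (small_functor K) X Y m Q q" and Q: "separated Q"
      using strong_separated by blast
    have q: "q \<in> nat_trans K Y Q" and qm: "nt_comp K X q m = nt_zero K X Q"
      using Qq unfolding cokernel_in_def by blast+
    note Q' = separated_additive[OF Q]
    have "nt_comp K X ?p m = nt_zero K X ?P" using ck unfolding cokernel_in_def by blast
    \<comment> \<open>The given cokernel \<open>Q\<close> is compared with the pointwise one: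
      \<open>h\<close> shows that whatever \<open>q\<close> kills is killed by \<open>?p\<close> and
      hence lies in the image of \<open>m\<close>.\<close>
    then obtain h where h: "h \<in> nat_trans K Q ?P" "nt_comp K Y h q = ?p"
      using Qq P_small p unfolding cokernel_in_def by blast
    have q0: "q V y = \<zero>\<^bsub>obj Q V\<^esub> \<longleftrightarrow> y \<in> m V ` carrier (obj X V)"
      if V: "V \<in> vect K" and y: "y \<in> carrier (obj Y V)" for V y
    proof
      assume z: "q V y = \<zero>\<^bsub>obj Q V\<^esub>"
      have "?p V y = h V (q V y)" using fun_cong[OF fun_cong[OF h(2)], of V y] V y by simp
      also have "\<dots> = \<zero>\<^bsub>obj Y V\<^esub>"
        unfolding z using lin_0[OF nt_lin[OF h(1) V] additive_obj[OF Q' V] additive_obj[OF P V]]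
        by (simp add: coker_simps[OF X_additive Y_additive m])
      finally show "y \<in> m V ` carrier (obj X V)" using zero_iff[OF V y] by blast
    next
      assume "y \<in> m V ` carrier (obj X V)"
      then obtain x where x: "x \<in> carrier (obj X V)" "y = m V x" by blast
      then show "q V y = \<zero>\<^bsub>obj Q V\<^esub>" using fun_cong[OF fun_cong[OF qm], of V x] V by simp
    qed
    show "\<forall>I. small I \<longrightarrow> lifts I"
      unfolding lifts_def
    proof (intro allI impI ballI)
      fix I y assume I: "small I" and y: "y \<in> carrier (obj Y (free I))"
        and c: "\<forall>i\<in>I. arr Y (free I) line (coord K I i) y \<in> m line ` carrier (obj X line)"
      note F = free_vect[OF I]
      have "q (free I) y = \<zero>\<^bsub>obj Q (free I)\<^esub>"
      proof (rule separated_zeroI[OF Q I nt_closed[OF q F y]])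
        fix i assume i: "i \<in> I"
        have "q line (arr Y (free I) line (coord K I i) y) = \<zero>\<^bsub>obj Q line\<^esub>"
          using q0[OF line_vect additive_closed[OF Y_additive F line_vect coord_lin[OF I i] y]] c i by blast
        then show "arr Q (free I) line (coord K I i) (q (free I) y) = \<zero>\<^bsub>obj Q line\<^esub>"
          using nt_nat[OF q F line_vect coord_lin[OF I i] y] by simp
      qed
      then show "y \<in> m (free I) ` carrier (obj X (free I))" using q0[OF F y] by blast
    qed
  next
    assume lifts: "\<forall>I. small I \<longrightarrow> lifts I"
    have "separated ?P"
      unfolding separated_def
    proof (intro conjI allI impI ballI)
      fix I y assume I: "small I" and yP: "y \<in> carrier (obj ?P (free I))"
        and c: "\<forall>i\<in>I. arr ?P (free I) line (coord K I i) y = \<zero>\<^bsub>obj ?P line\<^esub>"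
      note F = free_vect[OF I]
      \<comment> \<open>Elements of the quotient are themselves elements of \<open>Y\<close>, fixed
        by the projection, so \<open>lifts\<close> applies to \<open>y\<close> directly.\<close>
      have y': "y \<in> ?p (free I) ` carrier (obj Y (free I))" using yP by (simp add: coker_simps[OF X_additive Y_additive m])
      note y = coker_carrier[OF X_additive Y_additive m F y']
      have "arr Y (free I) line (coord K I i) y \<in> m line ` carrier (obj X line)" if i: "i \<in> I" for i
      proof -
        have "?p line (arr Y (free I) line (coord K I i) y) = \<zero>\<^bsub>obj Y line\<^esub>"
          using bspec[OF c i] y' by (simp add: coker_simps[OF X_additive Y_additive m])
        then show ?thesis
          using zero_iff[OF line_vect additive_closed[OF Y_additive F line_vect coord_lin[OF I i] y(1)]] by blast
      qed
      then have "y \<in> m (free I) ` carrier (obj X (free I))" using lifts I y(1) unfolding lifts_def by blast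
      then have "?p (free I) y = \<zero>\<^bsub>obj Y (free I)\<^esub>" using zero_iff[OF F y(1)] by blast
      then show "y = \<zero>\<^bsub>obj ?P (free I)\<^esub>" using y(2) by (simp add: coker_simps[OF X_additive Y_additive m])
    qed (rule P)
    then show "\<exists>Q q. cokernel_in K (small_functor K) X Y m Q q \<and> strong_space K Q"
      using ck separated_strong by blast
  qed
qed

end

text \<open>The transformation \<open>m\<close> carries a witness for the family in \<open>X\<close>
  to a witness for its image in \<open>Y\<close>, where sums are unique.\<close>

lemma is_sum_mono:
  assumes Y: "strong_space K Y" and m: "m \<in> nat_trans K X Y" and I: "small I"
    and f: "f \<in> I \<rightarrow> carrier (obj X line)" and s: "is_sum K X I f s"
    and t: "is_sum K Y I (\<lambda>i. m line (f i)) t"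
  shows "t = m line s"
proof -
  note F = free_vect[OF I]
  obtain x where x: "x \<in> carrier (obj X (free I))"
    "\<forall>i\<in>I. arr X (free I) line (coord K I i) x = f i" "s = arr X (free I) line (sum_functional K I) x"
    using s unfolding is_sum_def by blast
  have "is_sum K Y I (\<lambda>i. m line (f i)) (m line s)"
    unfolding is_sum_def
  proof (intro bexI[OF _ nt_closed[OF m F x(1)]] conjI ballI)
    show "arr Y (free I) line (coord K I i) (m (free I) x) = m line (f i)" if "i \<in> I" for i
      using nt_nat[OF m F line_vect coord_lin[OF I that] x(1)] x(2) that by simp
    show "m line s = arr Y (free I) line (sum_functional K I) (m (free I) x)"
      unfolding x(3) by (rule nt_nat[OF m F line_vect sum_functional_lin[OF I] x(1)])
  qed
  moreover have "\<exists>!s. is_sum K Y I (\<lambda>i. m line (f i)) s"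
  proof -
    have "(\<lambda>i. m line (f i)) \<in> I \<rightarrow> carrier (obj Y line)" using f nt_closed[OF m line_vect] by auto
    moreover have "summable_family K Y I (\<lambda>i. m line (f i))"
      using t unfolding is_sum_def summable_family_def by blast
    ultimately show ?thesis using Y I unfolding strong_space_def unique_sums_def by blast
  qed
  ultimately show ?thesis using t by blast
qed

end

theorem proposition4p49:
  fixes K :: "'u::grothendieck_universe ring"
    and X Y :: "'u vfunctor"
    and m :: "('u, 'u) module \<Rightarrow> 'u \<Rightarrow> 'u"
  assumes "field K" and "small (carrier K)"
    and "mono_in K (strong_space K) X Y m"
  shows "(closed_embedding K X Y m \<longleftrightarrow>
      (\<forall>I. small I \<longrightarrow> (\<forall>f\<in>I \<rightarrow> carrier (obj X (self_module K)).
         summable_family K Y I (\<lambda>i. m (self_module K) (f i)) \<longrightarrow> summable_family K X I f)))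
    \<and> (closed_embedding K X Y m \<longleftrightarrow>
      (\<exists>Q q. cokernel_in K (small_functor K) X Y m Q q \<and> strong_space K Q))
    \<and> (\<forall>I. small I \<longrightarrow> (\<forall>f\<in>I \<rightarrow> carrier (obj X (self_module K)). \<forall>s t.
         is_sum K X I f s \<longrightarrow> is_sum K Y I (\<lambda>i. m (self_module K) (f i)) t \<longrightarrow>
         t = m (self_module K) s))"
proof -
  interpret small_vect K by (rule small_vect.intro[OF assms(1,2)])
  have strong: "strong_space K X" "strong_space K Y" and m: "m \<in> nat_trans K X Y"
    using assms(3) by (auto simp: mono_in_def)
  note hyps = strong_separated[OF strong(1)] strong_separated[OF strong(2)] m
    strong_mono_injective[OF assms(3)]
  show ?thesis
    using closed_embedding_iff_lifts[OF hyps] strong_cokernel_iff_lifts[OF hyps]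
      summable_iff_lifts[OF hyps] is_sum_mono[OF strong(2) m]
    by (intro conjI) blast+
qed

end
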